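(* Channel submanifolds of $S^n$ (of dimension $m\ge2$) are M\"obius-flat.
   Context: $\mathbb R^{n+1,1}$ has inner product $(\cdot,\cdot)$ of signature $(n+1,1)$; $S^n$ is the set of its null lines; a half of the light-cone is fixed; $d$ is flat differentiation. An immersion of an $m$-manifold $\Sigma$ ($2\le m<n$) in $S^n$ is a null line subbundle $\Lambda\subset\Sigma\times\mathbb R^{n+1,1}$ (oriented by the half light-cone) with $X\mapsto d_X\sigma$ mod $\Lambda$ injective; it induces the conformal class $c$ of the metrics $(d\sigma,d\sigma)$, $\sigma$ positive sections of $\Lambda$. $\Lambda^{(1)}$ is the span of $\sigma,d\sigma$; the weightless normal bundle is $N\Sigma\,\Lambda=\Lambda^\perp/\Lambda^{(1)}$, where $N\Sigma=\mathrm{Hom}(\Lambda,\Lambda^\perp/\Lambda^{(1)})$. An enveloped ($m$-)sphere congruence is a signature $(m+1,1)$ subbundle $V\supset\Lambda^{(1)}$ of $\Sigma\times\mathbb R^{n+1,1}$; $V^\perp\cong N\Sigma\,\Lambda$. Write $d=\mathfrak D^V+\nabla^V+\mathcal N^V$ with $\mathfrak D^V,\nabla^V$ connections on $V,V^\perp$ and $\mathcal N^V:T\Sigma\to\mathrm{Hom}(V,V^\perp)\oplus\mathrm{Hom}(V^\perp,V)$ off-diagonal. The connection $\nabla$ on $N\Sigma\,\Lambda$ given by $\nabla^V$ is independent of $V$; $\mathrm{II}^V_XY\,\sigma=-\mathcal N^V_X(d_Y\sigma)$. Channel submanifold: a submanifold of dimension $m\ge2$ with flat (weightless) normal bundle which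 is the envelope of a $1$-parameter family of $m$-spheres, i.e. it admits an enveloped sphere congruence $V$ such that $\mathcal N^V$ has rank one (as a map on $T\Sigma$). M\"obius-flat: $V_\Sigma$ is the unique enveloped $V$ with $\mathrm{II}^V$ $c$-tracefree; $\mathrm{II}^0=\mathrm{II}^{V_\Sigma}$; $\mathbb S^0$ is the transpose of $\mathrm{II}^0$. For $m=2$: for a positive section $\sigma$ of $\Lambda$, let $D$, $K$ be the Levi-Civita connection and Gauss curvature of $g=(d\sigma,d\sigma)$; the $V_\Sigma$-component of the tracefree part of $D\,d\sigma$ is $-r_0\otimes\sigma$; $r=r_0+\frac12Kg$ and $C^\Sigma_{X,Y}=(D_Xr)(Y,\cdot)-(D_Yr)(X,\cdot)$ (independent of $\sigma$). A commuting Cotton--York potential is a section $q$ of $S^2_0T^*\Sigma$ (symmetric, tracefree) with $(D_Xq)(Y,\cdot)-(D_Yq)(X,\cdot)=C^\Sigma_{X,Y}$ and $q(X,\mathbb S^0_YU)=q(Y,\mathbb S^0_XU)$ for all tangent $X,Y$, normal $U$. A submanifold with $m\ge2$ is M\"obius-flat if $\nabla$ is flat and either $m\ge3$ and $c$ is conformally flat, or $m=2$ and it admits a commuting Cotton--York potential. *)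

theory Defs
  imports "HOL-Analysis.Analysis"
begin

section \<open>Smooth maps between normed spaces\<close>

definition dir_deriv :: "'a::real_normed_vector \<Rightarrow> ('a \<Rightarrow> 'b::real_normed_vector) \<Rightarrow> 'a \<Rightarrow> 'b" where
  "dir_deriv X f x = frechet_derivative f (at x) X"

primrec Ck_on :: "nat \<Rightarrow> 'a::real_normed_vector set \<Rightarrow> ('a \<Rightarrow> 'b::real_normed_vector) \<Rightarrow> bool" where
  "Ck_on 0 U f \<longleftrightarrow> continuous_on U f"
| "Ck_on (Suc k) U f \<longleftrightarrow> f differentiable_on U \<and> (\<forall>X. Ck_on k U (dir_deriv X f))"

definition smooth_on :: "'a::real_normed_vector set \<Rightarrow> ('a \<Rightarrow> 'b::real_normed_vector) \<Rightarrow> bool" where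
  "smooth_on U f \<longleftrightarrow> open U \<and> (\<forall>k. Ck_on k U f)"


section \<open>Smooth manifolds\<close>

text \<open>A chart is given by its domain \<open>U\<close> in coordinate space and the parametrization
  \<open>\<psi> : U \<rightarrow> \<Sigma>\<close> (the inverse of the coordinate map).  Bundles over \<open>\<Sigma>\<close> are maps on the points of
  \<open>\<Sigma>\<close>; differentiation of sections and tangent vectors are expressed in charts.\<close>

type_synonym ('a, 'm) chart = "(real^'m) set \<times> (real^'m \<Rightarrow> 'a)"

definition transition :: "('a, 'm::finite) chart \<Rightarrow> ('a, 'm) chart \<Rightarrow> real^'m \<Rightarrow> real^'m" where
  "transition = (\<lambda>(U, \<psi>) (U', \<psi>') x. inv_into U' \<psi>' (\<psi> x))"

definition smooth_manifold :: "'a topology \<Rightarrow> ('a, 'm::finite) chart set \<Rightarrow> bool" where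
  "smooth_manifold M A \<longleftrightarrow>
     Hausdorff_space M \<and> second_countable M \<and>
     (\<forall>(U, \<psi>)\<in>A. open U \<and> embedding_map (top_of_set U) M \<psi> \<and> openin M (\<psi> ` U)) \<and>
     (\<Union>(U, \<psi>)\<in>A. \<psi> ` U) = topspace M \<and>
     (\<forall>(U, \<psi>)\<in>A. \<forall>(U', \<psi>')\<in>A.
        smooth_on {x\<in>U. \<psi> x \<in> \<psi>' ` U'} (transition (U, \<psi>) (U', \<psi>')))"


section \<open>Lorentzian linear algebra\<close>

text \<open>\<open>\<real>\<^bsup>n+1,1\<^esup>\<close> is \<open>real^'k \<times> real\<close> with \<open>CARD('k) = n + 1\<close>; the last component is the
  timelike one, and the fixed half of the light-cone is the one where it is positive.\<close>

type_synonym 'k mink = "(real^'k) \<times> real"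

definition lor :: "'k::finite mink \<Rightarrow> 'k mink \<Rightarrow> real" where
  "lor v w = fst v \<bullet> fst w - snd v * snd w"

definition perp :: "'k::finite mink set \<Rightarrow> 'k mink set" where
  "perp W = {v. \<forall>w\<in>W. lor v w = 0}"

text \<open>Orthogonal projection; only meaningful for subspaces on which \<open>lor\<close> is nondegenerate.\<close>

definition lproj :: "'k::finite mink set \<Rightarrow> 'k mink \<Rightarrow> 'k mink" where
  "lproj W v = (THE w. w \<in> W \<and> v - w \<in> perp W)"

definition has_signature :: "'k::finite mink set \<Rightarrow> nat \<Rightarrow> nat \<Rightarrow> bool" where
  "has_signature W p q \<longleftrightarrow>
     (\<exists>P N. subspace P \<and> subspace N \<and> dim P = p \<and> dim N = q \<and>
        W = {v + w | v w. v \<in> P \<and> w \<in> N} \<and>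
        (\<forall>v\<in>P. v \<noteq> 0 \<longrightarrow> lor v v > 0) \<and>
        (\<forall>w\<in>N. w \<noteq> 0 \<longrightarrow> lor w w < 0) \<and>
        (\<forall>v\<in>P. \<forall>w\<in>N. lor v w = 0))"


section \<open>Subbundles of the trivial bundle, over an open subset of coordinate space\<close>

definition smooth_subbundle :: "nat \<Rightarrow> (real^'m::finite) set \<Rightarrow> (real^'m \<Rightarrow> 'k::finite mink set) \<Rightarrow> bool" where
  "smooth_subbundle r U F \<longleftrightarrow>
     (\<forall>x\<in>U. \<exists>W s. open W \<and> x \<in> W \<and> W \<subseteq> U \<and>
        (\<forall>i<r. smooth_on W (s i)) \<and>
        (\<forall>y\<in>W. F y = span ((\<lambda>i::nat. s i y) ` {..<r}) \<and> dim (F y) = r))"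

text \<open>The connection which flat differentiation induces on a nondegenerate subbundle \<open>F\<close>,
  applied to the \<open>F\<close>-component of \<open>s\<close>.  For \<open>F = V\<close> it is \<open>\<DD>\<^sup>V\<close>, for \<open>F = V\<^sup>\<bottom>\<close> it is \<open>\<nabla>\<^sup>V\<close>.\<close>

definition sub_conn :: "(real^'m::finite \<Rightarrow> 'k::finite mink set) \<Rightarrow> real^'m
    \<Rightarrow> (real^'m \<Rightarrow> 'k mink) \<Rightarrow> real^'m \<Rightarrow> 'k mink" where
  "sub_conn F X s x = lproj (F x) (dir_deriv X (\<lambda>y. lproj (F y) (s y)) x)"

definition perp_bundle :: "(real^'m::finite \<Rightarrow> 'k::finite mink set) \<Rightarrow> real^'m \<Rightarrow> 'k mink set" where
  "perp_bundle F x = perp (F x)"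

definition N_form :: "(real^'m::finite \<Rightarrow> 'k::finite mink set) \<Rightarrow> real^'m
    \<Rightarrow> (real^'m \<Rightarrow> 'k mink) \<Rightarrow> real^'m \<Rightarrow> 'k mink" where
  "N_form F X s x = dir_deriv X s x - sub_conn F X s x - sub_conn (perp_bundle F) X s x"

text \<open>\<open>N_form\<close> is tensorial in \<open>s\<close>, so its value on a vector \<open>e\<close> at a point is
  obtained from the constant section \<open>e\<close>.\<close>

definition N_endo :: "(real^'m::finite \<Rightarrow> 'k::finite mink set) \<Rightarrow> real^'m \<Rightarrow> real^'m
    \<Rightarrow> 'k mink \<Rightarrow>\<^sub>L 'k mink" where
  "N_endo F x X = Blinfun (\<lambda>e. N_form F X (\<lambda>_. e) x)"

definition N_rank :: "(real^'m::finite \<Rightarrow> 'k::finite mink set) \<Rightarrow> real^'m \<Rightarrow> nat" where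
  "N_rank F x = dim (range (N_endo F x))"


section \<open>Riemannian metrics in coordinates\<close>

text \<open>Metrics and other covariant 2-tensors are functions of the point and two tangent vectors.
  Vectors in \<open>real^'m\<close> also stand for the constant vector fields, whose Lie brackets vanish.\<close>

type_synonym 'm tensor2 = "real^'m \<Rightarrow> real^'m \<Rightarrow> real^'m \<Rightarrow> real"

text \<open>\<open>D\<^sub>X Y\<close> for constant vector fields \<open>X\<close>, \<open>Y\<close> (Koszul formula).\<close>

definition levi_civita :: "'m::finite tensor2 \<Rightarrow> real^'m \<Rightarrow> real^'m \<Rightarrow> real^'m \<Rightarrow> real^'m" where
  "levi_civita g x X Y = (THE Z. \<forall>W. 2 * g x Z W =
      dir_deriv X (\<lambda>y. g y Y W) x + dir_deriv Y (\<lambda>y. g y X W) x - dir_deriv W (\<lambda>y. g y X Y) x)"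

definition cov_deriv :: "'m::finite tensor2 \<Rightarrow> real^'m \<Rightarrow> (real^'m \<Rightarrow> real^'m) \<Rightarrow> real^'m \<Rightarrow> real^'m" where
  "cov_deriv g X Z x = dir_deriv X Z x + levi_civita g x X (Z x)"

definition riemann :: "'m::finite tensor2 \<Rightarrow> real^'m \<Rightarrow> real^'m \<Rightarrow> real^'m \<Rightarrow> real^'m \<Rightarrow> real^'m" where
  "riemann g x X Y Z = cov_deriv g X (cov_deriv g Y (\<lambda>_. Z)) x - cov_deriv g Y (cov_deriv g X (\<lambda>_. Z)) x"

definition gauss_curvature :: "'m::finite tensor2 \<Rightarrow> real^'m \<Rightarrow> real" where
  "gauss_curvature g x = (THE K. \<forall>X Y. g x (riemann g x X Y Y) X =
      K * (g x X X * g x Y Y - (g x X Y)\<^sup>2))"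

definition cov_deriv2 :: "'m::finite tensor2 \<Rightarrow> 'm tensor2 \<Rightarrow> real^'m \<Rightarrow> real^'m \<Rightarrow> real^'m \<Rightarrow> real^'m \<Rightarrow> real" where
  "cov_deriv2 g q x X Y Z = dir_deriv X (\<lambda>y. q y Y Z) x
      - q x (levi_civita g x X Y) Z - q x Y (levi_civita g x X Z)"

definition ext_cov_deriv :: "'m::finite tensor2 \<Rightarrow> 'm tensor2 \<Rightarrow> real^'m \<Rightarrow> real^'m \<Rightarrow> real^'m \<Rightarrow> real^'m \<Rightarrow> real" where
  "ext_cov_deriv g q x X Y Z = cov_deriv2 g q x X Y Z - cov_deriv2 g q x Y X Z"

definition metric_trace :: "(real^'m::finite \<Rightarrow> real^'m \<Rightarrow> real) \<Rightarrow> (real^'m \<Rightarrow> real^'m \<Rightarrow> 'b::real_vector) \<Rightarrow> 'b" where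
  "metric_trace g B = (\<Sum>i\<in>UNIV. \<Sum>j\<in>UNIV.
      (matrix_inv (\<chi> a b. g (axis a 1) (axis b 1)) $ i $ j) *\<^sub>R B (axis i 1) (axis j 1))"

definition tracefree_part :: "(real^'m::finite \<Rightarrow> real^'m \<Rightarrow> real) \<Rightarrow> (real^'m \<Rightarrow> real^'m \<Rightarrow> 'b::real_vector)
    \<Rightarrow> real^'m \<Rightarrow> real^'m \<Rightarrow> 'b" where
  "tracefree_part g B X Y = B X Y - (g X Y / real CARD('m)) *\<^sub>R metric_trace g B"


section \<open>Submanifolds of the conformal sphere\<close>

definition pos_section :: "(real^'m::finite) set \<Rightarrow> (real^'m \<Rightarrow> 'k::finite mink set) \<Rightarrow> (real^'m \<Rightarrow> 'k mink) \<Rightarrow> bool" where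
  "pos_section U l \<sigma> \<longleftrightarrow> smooth_on U \<sigma> \<and> (\<forall>x\<in>U. \<sigma> x \<in> l x \<and> snd (\<sigma> x) > 0)"

definition induced_metric :: "(real^'m::finite \<Rightarrow> 'k::finite mink) \<Rightarrow> 'm tensor2" where
  "induced_metric \<sigma> x X Y = lor (dir_deriv X \<sigma> x) (dir_deriv Y \<sigma> x)"

text \<open>The fibre of \<open>\<Lambda>\<^bsup>(1)\<^esup>\<close>.\<close>

definition jet1 :: "(real^'m::finite \<Rightarrow> 'k::finite mink) \<Rightarrow> real^'m \<Rightarrow> 'k mink set" where
  "jet1 \<sigma> x = span (insert (\<sigma> x) (range (\<lambda>X. dir_deriv X \<sigma> x)))"

definition immersed_submanifold :: "('a, 'm::finite) chart set \<Rightarrow> ('a \<Rightarrow> 'k::finite mink set) \<Rightarrow> bool" where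
  "immersed_submanifold A L \<longleftrightarrow>
     (\<forall>(U, \<psi>)\<in>A.
        smooth_subbundle 1 U (L \<circ> \<psi>) \<and>
        (\<forall>x\<in>U. \<forall>v\<in>L (\<psi> x). lor v v = 0) \<and>
        (\<forall>\<sigma>. pos_section U (L \<circ> \<psi>) \<sigma> \<longrightarrow>
           (\<forall>x\<in>U. \<forall>X. dir_deriv X \<sigma> x \<in> L (\<psi> x) \<longrightarrow> X = 0)))"

definition enveloped_congruence :: "('a, 'm::finite) chart set \<Rightarrow> ('a \<Rightarrow> 'k::finite mink set)
    \<Rightarrow> ('a \<Rightarrow> 'k mink set) \<Rightarrow> bool" where
  "enveloped_congruence A L V \<longleftrightarrow>
     (\<forall>(U, \<psi>)\<in>A.
        smooth_subbundle (CARD('m) + 2) U (V \<circ> \<psi>) \<and>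
        (\<forall>x\<in>U. has_signature (V (\<psi> x)) (CARD('m) + 1) 1) \<and>
        (\<forall>\<sigma>. pos_section U (L \<circ> \<psi>) \<sigma> \<longrightarrow> (\<forall>x\<in>U. jet1 \<sigma> x \<subseteq> V (\<psi> x))))"

text \<open>Flatness of the connection \<open>\<nabla>\<close> on \<open>\<Lambda>\<^sup>\<bottom>/\<Lambda>\<^bsup>(1)\<^esup>\<close>.  Sections of the quotient are represented by
  sections \<open>\<xi>\<close> of \<open>\<Lambda>\<^sup>\<bottom>\<close>.  As \<open>\<Lambda>\<^bsup>(1)\<^esup> \<subseteq> V\<close>, projection to \<open>V\<^sup>\<bottom>\<close> kills \<open>\<Lambda>\<^bsup>(1)\<^esup>\<close> and induces
  \<open>\<Lambda>\<^sup>\<bottom>/\<Lambda>\<^bsup>(1)\<^esup> \<cong> V\<^sup>\<bottom>\<close>, so \<open>\<nabla>\<^sub>X [\<xi>]\<close> is the class of \<open>sub_conn (perp_bundle V) X \<xi>\<close>.  This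
  class does not depend on \<open>V\<close>.\<close>

definition normal_bundle_flat :: "('a, 'm::finite) chart set \<Rightarrow> ('a \<Rightarrow> 'k::finite mink set) \<Rightarrow> bool" where
  "normal_bundle_flat A L \<longleftrightarrow>
     (\<forall>V. enveloped_congruence A L V \<longrightarrow>
        (\<forall>(U, \<psi>)\<in>A. \<forall>\<sigma> \<xi>. pos_section U (L \<circ> \<psi>) \<sigma> \<longrightarrow>
           smooth_on U \<xi> \<and> (\<forall>x\<in>U. \<xi> x \<in> perp (L (\<psi> x))) \<longrightarrow>
           (\<forall>x\<in>U. \<forall>X Y.
              (let D = sub_conn (perp_bundle (V \<circ> \<psi>)) in D X (D Y \<xi>) x - D Y (D X \<xi>) x) \<in> jet1 \<sigma> x)))"

definition channel_submanifold :: "('a, 'm::finite) chart set \<Rightarrow> ('a \<Rightarrow> 'k::finite mink set) \<Rightarrow> bool" where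
  "channel_submanifold A L \<longleftrightarrow>
     CARD('m) \<ge> 2 \<and> normal_bundle_flat A L \<and>
     (\<exists>V. enveloped_congruence A L V \<and> (\<forall>(U, \<psi>)\<in>A. \<forall>x\<in>U. N_rank (V \<circ> \<psi>) x = 1))"


section \<open>Moebius-flatness\<close>

text \<open>\<open>II F \<sigma> x X Y\<close> is \<open>II\<^sup>V\<^sub>X Y \<sigma>\<close>, where \<open>II\<^sup>V\<^sub>X Y\<close> is a homomorphism from \<open>\<Lambda>\<close> to \<open>V\<^sup>\<bottom>\<close>.\<close>

definition II :: "(real^'m::finite \<Rightarrow> 'k::finite mink set) \<Rightarrow> (real^'m \<Rightarrow> 'k mink)
    \<Rightarrow> real^'m \<Rightarrow> real^'m \<Rightarrow> real^'m \<Rightarrow> 'k mink" where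
  "II F \<sigma> x X Y = - N_form F X (dir_deriv Y \<sigma>) x"

text \<open>The central sphere congruence \<open>V\<^sub>\<Sigma>\<close>; it exists and is unique.\<close>

definition central_congruence :: "('a, 'm::finite) chart set \<Rightarrow> ('a \<Rightarrow> 'k::finite mink set)
    \<Rightarrow> ('a \<Rightarrow> 'k mink set) \<Rightarrow> bool" where
  "central_congruence A L V \<longleftrightarrow>
     enveloped_congruence A L V \<and>
     (\<forall>(U, \<psi>)\<in>A. \<forall>\<sigma>. pos_section U (L \<circ> \<psi>) \<sigma> \<longrightarrow>
        (\<forall>x\<in>U. metric_trace (induced_metric \<sigma> x) (II (V \<circ> \<psi>) \<sigma> x) = 0))"

text \<open>The transpose of \<open>II\<close>: a normal \<open>U\<close> enters through its value \<open>u = U \<sigma> \<in> V\<^sup>\<bottom>\<close>.\<close>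

definition shape_op :: "(real^'m::finite \<Rightarrow> 'k::finite mink set) \<Rightarrow> (real^'m \<Rightarrow> 'k mink)
    \<Rightarrow> real^'m \<Rightarrow> real^'m \<Rightarrow> 'k mink \<Rightarrow> real^'m" where
  "shape_op F \<sigma> x X u = (THE S. \<forall>Y. induced_metric \<sigma> x S Y = lor (II F \<sigma> x X Y) u)"

text \<open>\<open>(D d\<sigma>)(X, Y)\<close>.\<close>

definition hessian :: "(real^'m::finite \<Rightarrow> 'k::finite mink) \<Rightarrow> real^'m \<Rightarrow> real^'m \<Rightarrow> real^'m \<Rightarrow> 'k mink" where
  "hessian \<sigma> x X Y = dir_deriv X (dir_deriv Y \<sigma>) x
      - dir_deriv (levi_civita (induced_metric \<sigma>) x X Y) \<sigma> x"

definition r0 :: "(real^'m::finite \<Rightarrow> 'k::finite mink set) \<Rightarrow> (real^'m \<Rightarrow> 'k mink) \<Rightarrow> 'm tensor2" where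
  "r0 F \<sigma> x X Y = (THE r. lproj (F x) (tracefree_part (induced_metric \<sigma> x) (hessian \<sigma> x) X Y) = - (r *\<^sub>R \<sigma> x))"

definition schouten :: "(real^'m::finite \<Rightarrow> 'k::finite mink set) \<Rightarrow> (real^'m \<Rightarrow> 'k mink) \<Rightarrow> 'm tensor2" where
  "schouten F \<sigma> x X Y = r0 F \<sigma> x X Y
      + 1/2 * gauss_curvature (induced_metric \<sigma>) x * induced_metric \<sigma> x X Y"

definition cotton_york :: "(real^'m::finite \<Rightarrow> 'k::finite mink set) \<Rightarrow> (real^'m \<Rightarrow> 'k mink)
    \<Rightarrow> real^'m \<Rightarrow> real^'m \<Rightarrow> real^'m \<Rightarrow> real^'m \<Rightarrow> real" where
  "cotton_york F \<sigma> = ext_cov_deriv (induced_metric \<sigma>) (schouten F \<sigma>)"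

text \<open>Covariant 2-tensor fields on the manifold, as compatible families over the charts.\<close>

definition smooth_tensor2 :: "('a, 'm::finite) chart set \<Rightarrow> (('a, 'm) chart \<Rightarrow> 'm tensor2) \<Rightarrow> bool" where
  "smooth_tensor2 A q \<longleftrightarrow>
     (\<forall>(U, \<psi>)\<in>A.
        (\<forall>x\<in>U. bilinear (q (U, \<psi>) x)) \<and>
        (\<forall>X Y. smooth_on U (\<lambda>x. q (U, \<psi>) x X Y)) \<and>
        (\<forall>(U', \<psi>')\<in>A. \<forall>x\<in>U. \<psi> x \<in> \<psi>' ` U' \<longrightarrow>
           (let \<tau> = transition (U, \<psi>) (U', \<psi>')
            in \<forall>X Y. q (U, \<psi>) x X Y = q (U', \<psi>') (\<tau> x) (dir_deriv X \<tau> x) (dir_deriv Y \<tau> x))))"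

definition commuting_cotton_york_potential :: "('a, 'm::finite) chart set \<Rightarrow> ('a \<Rightarrow> 'k::finite mink set)
    \<Rightarrow> ('a \<Rightarrow> 'k mink set) \<Rightarrow> (('a, 'm) chart \<Rightarrow> 'm tensor2) \<Rightarrow> bool" where
  "commuting_cotton_york_potential A L V q \<longleftrightarrow>
     smooth_tensor2 A q \<and>
     (\<forall>(U, \<psi>)\<in>A. \<forall>\<sigma>. pos_section U (L \<circ> \<psi>) \<sigma> \<longrightarrow>
        (let q' = q (U, \<psi>); F = V \<circ> \<psi>; g = induced_metric \<sigma> in
          \<forall>x\<in>U.
            (\<forall>X Y. q' x X Y = q' x Y X) \<and>
            metric_trace (g x) (q' x) = 0 \<and>
            (\<forall>X Y Z. ext_cov_deriv g q' x X Y Z = cotton_york F \<sigma> x X Y Z) \<and>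
            (\<forall>X Y. \<forall>u\<in>perp (F x).
               q' x X (shape_op F \<sigma> x Y u) = q' x Y (shape_op F \<sigma> x X u))))"

text \<open>The metrics of the conformal class over \<open>W\<close> are the induced metrics of the positive
  sections over \<open>W\<close>.\<close>

definition conformally_flat :: "('a, 'm::finite) chart set \<Rightarrow> ('a \<Rightarrow> 'k::finite mink set) \<Rightarrow> bool" where
  "conformally_flat A L \<longleftrightarrow>
     (\<forall>(U, \<psi>)\<in>A. \<forall>x\<in>U. \<exists>W \<sigma>. open W \<and> x \<in> W \<and> W \<subseteq> U \<and> pos_section W (L \<circ> \<psi>) \<sigma> \<and>
        (\<forall>y\<in>W. \<forall>X Y Z. riemann (induced_metric \<sigma>) y X Y Z = 0))"

definition moebius_flat :: "('a, 'm::finite) chart set \<Rightarrow> ('a \<Rightarrow> 'k::finite mink set) \<Rightarrow> bool" where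
  "moebius_flat A L \<longleftrightarrow>
     CARD('m) \<ge> 2 \<and> normal_bundle_flat A L \<and>
     (CARD('m) \<ge> 3 \<and> conformally_flat A L \<or>
      CARD('m) = 2 \<and>
        (\<exists>V q. central_congruence A L V \<and> commuting_cotton_york_potential A L V q))"

end

theory Submission
  imports Defs
begin

text \<open>Let \<open>P\<close> be the orthogonal projection onto the sphere congruence \<open>V\<close>.  Then \<open>\<N>\<^sup>V = dP (2P - 1)\<close>,
  so rank one means \<open>dP = \<omega> \<otimes> E\<close> pointwise, and the operators \<open>dP X\<close>, \<open>dP Y\<close> commute: \<open>\<DD>\<^sup>V\<close> is flat.

  For \<open>m \<ge> 3\<close>, the system \<open>du = - dP u\<close> on the trivial bundle is integrable precisely because the \<open>dP X\<close>
  commute, and \<open>v = P u\<close> is \<open>\<DD>\<^sup>V\<close>-parallel.  Rescaling \<open>\<sigma>\<close> so that \<open>(\<sigma>, v) = -1\<close> for a null such \<open>v\<close>, the Hessian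
  becomes \<open>g \<otimes> v + \<omega> \<otimes> \<omega> \<otimes> n\<close>, and the Gauss equation gives curvature zero.

  For \<open>m = 2\<close>, let \<open>b = \<N>\<^sup>V d\<sigma> = \<omega> \<otimes> \<omega> \<otimes> n\<close>, with trace \<open>t\<close> and tracefree part \<open>b\<^sub>0\<close>.  The null rotation
  exp of \<open>\<sigma> \<and> t / 2\<close> carries \<open>V\<close> to the central congruence, and the Schouten tensors of the two congruences
  differ by \<open>q = (t, b\<^sub>0) / 2\<close>.  That of \<open>V\<close> is Codazzi because \<open>\<DD>\<^sup>V\<close> is flat, so \<open>q\<close> is a Cotton--York potential;
  it commutes with \<open>\<S>\<^sup>0\<close> since both are multiples of the tracefree part of \<open>\<omega> \<otimes> \<omega>\<close>.\<close>

section \<open>Smooth maps\<close>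

text \<open>Differentiating P P = P shows that dP interchanges V and its complement: on V it is the
  normal part of d, on the complement minus the V-part. As 2P - 1 is an involution, dP inherits rank
  one from N. The curvature of d + dP on the trivial bundle is the commutator of dP X and dP Y, so
  the equation for u can be integrated without choosing a frame of V, and P dv = P (dP u) + P du =
  0. The Gauss equation is applied to \<sigma> itself, an isometric map into a flat space. The only
  contribution of b to curvature is (b(Y,Z), b(X,W)) - (b(X,Z), b(Y,W)), which vanishes when b has
  rank one. The 1/2 in the null rotation is 1/m: since (dd\<sigma>, \<sigma>) = - g, the rotation
  changes b by - g t / 2, and the trace of g is 2. It also moves the V-part of dd\<sigma> by a
  multiple of \<sigma>, and that multiple is q. Under \<sigma> to \<rho> \<sigma> the vector t is
  divided by \<rho>, so \<sigma> \<and> t and q depend on neither section nor chart; this is why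
  local constructions glue.\<close>

lemma dir_deriv_works:
  "f differentiable (at x) \<Longrightarrow> (f has_derivative (\<lambda>X. dir_deriv X f x)) (at x)"
  unfolding dir_deriv_def using frechet_derivative_works by auto

lemma dir_deriv_eqI: "(f has_derivative f') (at x) \<Longrightarrow> dir_deriv X f x = f' X"
  unfolding dir_deriv_def using frechet_derivative_at by metis

lemma has_derivative_cong_open:
  assumes "open U" "x \<in> U" "\<And>y. y \<in> U \<Longrightarrow> f y = g y"
  shows "(f has_derivative f') (at x) \<longleftrightarrow> (g has_derivative f') (at x)"
  using has_derivative_transform_within_open[of f f' x UNIV U g]
    has_derivative_transform_within_open[of g f' x UNIV U f] assms
  by auto

text \<open>Holds also at points of non-differentiability: \<open>frechet_derivative\<close> chooses
  among the derivatives at x, and both functions have the same ones, so the arbitrary value agrees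
  too.\<close>

lemma dir_deriv_cong_open:
  assumes "open U" "x \<in> U" "\<And>y. y \<in> U \<Longrightarrow> f y = g y"
  shows "dir_deriv X f x = dir_deriv X g x"
  unfolding dir_deriv_def frechet_derivative_def
  using has_derivative_cong_open[OF assms] by simp

lemma differentiable_cong_open:
  assumes "open U" "x \<in> U" "\<And>y. y \<in> U \<Longrightarrow> f y = g y"
  shows "f differentiable (at x) \<longleftrightarrow> g differentiable (at x)"
  unfolding differentiable_def using has_derivative_cong_open[OF assms] by simp

lemma differentiable_on_open:
  "open U \<Longrightarrow> f differentiable_on U \<longleftrightarrow> (\<forall>x\<in>U. f differentiable (at x))"
  by (simp add: differentiable_on_eq_differentiable_at)

lemma dir_deriv_linear:
  assumes "f differentiable (at x)"
  shows "linear (\<lambda>X. dir_deriv X f x)"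
  using has_derivative_linear[OF dir_deriv_works[OF assms]] .

lemma dir_deriv_const [simp]: "dir_deriv X (\<lambda>_. c) x = 0"
  by (rule dir_deriv_eqI[OF has_derivative_const])

lemma dir_deriv_add:
  "f differentiable (at x) \<Longrightarrow> g differentiable (at x) \<Longrightarrow>
   dir_deriv X (\<lambda>y. f y + g y) x = dir_deriv X f x + dir_deriv X g x"
  by (rule dir_deriv_eqI[OF has_derivative_add[OF dir_deriv_works dir_deriv_works]])

lemma dir_deriv_diff:
  "f differentiable (at x) \<Longrightarrow> g differentiable (at x) \<Longrightarrow>
   dir_deriv X (\<lambda>y. f y - g y) x = dir_deriv X f x - dir_deriv X g x"
  by (rule dir_deriv_eqI[OF has_derivative_diff[OF dir_deriv_works dir_deriv_works]])

lemma dir_deriv_bounded_linear: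
  "bounded_linear h \<Longrightarrow> f differentiable (at x) \<Longrightarrow>
   dir_deriv X (\<lambda>y. h (f y)) x = h (dir_deriv X f x)"
  by (rule dir_deriv_eqI[OF bounded_linear.has_derivative[OF _ dir_deriv_works]])

lemma dir_deriv_minus:
  "f differentiable (at x) \<Longrightarrow> dir_deriv X (\<lambda>y. - f y) x = - dir_deriv X f x"
  by (rule dir_deriv_bounded_linear[OF bounded_linear_minus[OF bounded_linear_ident]])

lemma dir_deriv_bilinear:
  "bounded_bilinear h \<Longrightarrow> f differentiable (at x) \<Longrightarrow> g differentiable (at x) \<Longrightarrow>
   dir_deriv X (\<lambda>y. h (f y) (g y)) x = h (f x) (dir_deriv X g x) + h (dir_deriv X f x) (g x)"
  by (rule dir_deriv_eqI[OF bounded_bilinear.FDERIV[OF _ dir_deriv_works dir_deriv_works]])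

lemma differentiable_bilinear:
  "bounded_bilinear h \<Longrightarrow> f differentiable (at x) \<Longrightarrow> g differentiable (at x) \<Longrightarrow>
   (\<lambda>y. h (f y) (g y)) differentiable (at x)"
  using bounded_bilinear.FDERIV[OF _ dir_deriv_works dir_deriv_works] differentiableI by blast

lemma differentiable_bounded_linear:
  "bounded_linear h \<Longrightarrow> f differentiable (at x) \<Longrightarrow> (\<lambda>y. h (f y)) differentiable (at x)"
  using bounded_linear.has_derivative[OF _ dir_deriv_works] differentiableI by blast

lemma dir_deriv_inverse:
  fixes f :: "'a::real_normed_vector \<Rightarrow> real"
  assumes "f differentiable (at x)" "f x \<noteq> 0"
  shows "dir_deriv X (\<lambda>y. inverse (f y)) x = - (inverse (f x) * dir_deriv X f x * inverse (f x))"
  by (rule dir_deriv_eqI[OF Deriv.has_derivative_inverse[OF assms(2) dir_deriv_works[OF assms(1)]]])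

lemma dir_deriv_chain:
  assumes "\<tau> differentiable (at x)" "f differentiable (at (\<tau> x))"
  shows "dir_deriv X (\<lambda>y. f (\<tau> y)) x = dir_deriv (dir_deriv X \<tau> x) f (\<tau> x)"
  using dir_deriv_eqI[OF diff_chain_at[OF dir_deriv_works[OF assms(1)] dir_deriv_works[OF assms(2)]]]
  by (simp add: o_def)

lemma Ck_on_cong:
  assumes "open U" "\<And>y. y \<in> U \<Longrightarrow> f y = g y"
  shows "Ck_on k U f \<longleftrightarrow> Ck_on k U g"
  using assms(2)
proof (induction k arbitrary: f g)
  case 0
  then show ?case by (simp cong: continuous_on_cong)
next
  case (Suc k)
  have "Ck_on k U (dir_deriv X f) \<longleftrightarrow> Ck_on k U (dir_deriv X g)" for X
    by (rule Suc.IH, rule dir_deriv_cong_open[OF assms(1)], assumption, rule Suc.prems)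
  moreover have "f differentiable (at x) \<longleftrightarrow> g differentiable (at x)" if "x \<in> U" for x
    by (rule differentiable_cong_open[OF assms(1) that Suc.prems])
  then have "f differentiable_on U \<longleftrightarrow> g differentiable_on U"
    by (simp add: differentiable_on_open[OF assms(1)])
  ultimately show ?case by simp
qed

lemma Ck_on_Suc_imp: "open U \<Longrightarrow> Ck_on (Suc k) U f \<Longrightarrow> Ck_on k U f"
proof (induction k arbitrary: f)
  case 0
  then show ?case by (auto intro: differentiable_imp_continuous_on)
next
  case (Suc k)
  have "f differentiable_on U" "Ck_on (Suc k) U (dir_deriv X f)" for X
    using Suc.prems(2) by (simp_all only: Ck_on.simps(2)[of "Suc k"])
  then show ?case using Suc.IH[OF Suc.prems(1)] by (simp only: Ck_on.simps(2)[of k] simp_thms)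
qed

lemma Ck_on_const: "open U \<Longrightarrow> Ck_on k U (\<lambda>_. c)"
proof (induction k arbitrary: c)
  case (Suc k)
  have "dir_deriv X (\<lambda>_. c) = (\<lambda>_. 0)" for X :: 'a by (rule ext) simp
  then show ?case using Suc by simp
qed simp

lemma Ck_on_add:
  assumes "open U" "Ck_on k U f" "Ck_on k U g"
  shows "Ck_on k U (\<lambda>x. f x + g x)"
  using assms(2,3)
proof (induction k arbitrary: f g)
  case 0
  then show ?case by (auto intro: continuous_intros)
next
  case (Suc k)
  have d: "f differentiable (at x)" "g differentiable (at x)" if "x \<in> U" for x
    using Suc.prems that differentiable_on_open[OF assms(1)] by auto
  have "Ck_on k U (dir_deriv X (\<lambda>x. f x + g x))" for X
    using Suc Ck_on_cong[OF assms(1), of "dir_deriv X (\<lambda>x. f x + g x)"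
      "\<lambda>x. dir_deriv X f x + dir_deriv X g x"] dir_deriv_add[OF d] by auto
  then show ?case using Suc.prems by (auto intro: differentiable_on_add)
qed

text \<open>One Leibniz rule serves scalar multiples, \<open>lor\<close> and the application of
  operators. The induction step also uses f and g themselves at order k, which
  \<open>Ck_on_Suc_imp\<close> supplies.\<close>

lemma Ck_on_bilinear:
  assumes "bounded_bilinear h" "open U" "Ck_on k U f" "Ck_on k U g"
  shows "Ck_on k U (\<lambda>x. h (f x) (g x))"
  using assms(3,4)
proof (induction k arbitrary: f g)
  case 0
  then show ?case using bounded_bilinear.continuous_on[OF assms(1)] by auto
next
  case (Suc k)
  have d: "f differentiable (at x)" "g differentiable (at x)" if "x \<in> U" for x
    using Suc.prems that differentiable_on_open[OF assms(2)] by auto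
  have "Ck_on k U f" "Ck_on k U g" using Suc.prems Ck_on_Suc_imp[OF assms(2)] by auto
  then have "Ck_on k U (\<lambda>x. h (f x) (dir_deriv X g x) + h (dir_deriv X f x) (g x))" for X
    using Suc by (intro Ck_on_add[OF assms(2)]) auto
  then have "Ck_on k U (dir_deriv X (\<lambda>x. h (f x) (g x)))" for X
    using Ck_on_cong[OF assms(2), of "dir_deriv X (\<lambda>x. h (f x) (g x))"
      "\<lambda>x. h (f x) (dir_deriv X g x) + h (dir_deriv X f x) (g x)"] dir_deriv_bilinear[OF assms(1) d]
    by auto
  moreover have "(\<lambda>x. h (f x) (g x)) differentiable_on U"
    using differentiable_on_open[OF assms(2)] differentiable_bilinear[OF assms(1) d] by auto
  ultimately show ?case by simp
qed

text \<open>The derivative of the inverse is built from the inverse itself and a derivative of f, so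
  the induction on k closes with f fixed.\<close>

lemma Ck_on_inverse:
  fixes f :: "'a::real_normed_vector \<Rightarrow> real"
  assumes "open U" "Ck_on k U f" "\<And>x. x \<in> U \<Longrightarrow> f x \<noteq> 0"
  shows "Ck_on k U (\<lambda>x. inverse (f x))"
  using assms(2)
proof (induction k)
  case 0
  then show ?case using assms(3) by (auto intro: continuous_on_inverse)
next
  case (Suc k)
  have d: "f differentiable (at x)" if "x \<in> U" for x
    using Suc.prems that differentiable_on_open[OF assms(1)] by auto
  have 1: "Ck_on k U (\<lambda>x. inverse (f x))" using Suc Ck_on_Suc_imp[OF assms(1)] by blast
  have "Ck_on k U (\<lambda>x. (-1) * (inverse (f x) * dir_deriv X f x * inverse (f x)))" for X
    using 1 Suc.prems by (intro Ck_on_bilinear[OF bounded_bilinear_mult assms(1)] Ck_on_const assms(1)) auto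
  then have "Ck_on k U (dir_deriv X (\<lambda>x. inverse (f x)))" for X
    using Ck_on_cong[OF assms(1), of "dir_deriv X (\<lambda>x. inverse (f x))"
      "\<lambda>x. (-1) * (inverse (f x) * dir_deriv X f x * inverse (f x))"]
      dir_deriv_inverse[OF d assms(3)] by auto
  moreover have "(\<lambda>x. inverse (f x)) differentiable_on U"
    unfolding differentiable_on_open[OF assms(1)]
    using differentiableI[OF Deriv.has_derivative_inverse[OF assms(3) dir_deriv_works[OF d]]] by blast
  ultimately show ?case by simp
qed

lemma Ck_on_subset: "open U \<Longrightarrow> open W \<Longrightarrow> W \<subseteq> U \<Longrightarrow> Ck_on k U f \<Longrightarrow> Ck_on k W f"
  by (induction k arbitrary: f) (auto intro: continuous_on_subset differentiable_on_subset)

lemma smooth_on_open: "smooth_on U f \<Longrightarrow> open U"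
  by (simp add: smooth_on_def)

lemma smooth_on_cong:
  assumes "smooth_on U g" "\<And>y. y \<in> U \<Longrightarrow> f y = g y"
  shows "smooth_on U f"
  using assms(1) Ck_on_cong[of U f g] assms(2) unfolding smooth_on_def by simp

lemma smooth_on_subset: "smooth_on U f \<Longrightarrow> open W \<Longrightarrow> W \<subseteq> U \<Longrightarrow> smooth_on W f"
  using Ck_on_subset unfolding smooth_on_def by blast

lemma smooth_on_differentiable: "smooth_on U f \<Longrightarrow> x \<in> U \<Longrightarrow> f differentiable (at x)"
  unfolding smooth_on_def using Ck_on.simps(2) differentiable_on_open by blast

lemma smooth_on_continuous: "smooth_on U f \<Longrightarrow> continuous_on U f"
  unfolding smooth_on_def using Ck_on.simps(1) by blast

lemma smooth_on_dir_deriv: "smooth_on U f \<Longrightarrow> smooth_on U (dir_deriv X f)"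
  unfolding smooth_on_def using Ck_on.simps(2) by blast

lemma smooth_on_const: "open U \<Longrightarrow> smooth_on U (\<lambda>_. c)"
  unfolding smooth_on_def using Ck_on_const by blast

lemma smooth_on_add: "smooth_on U f \<Longrightarrow> smooth_on U g \<Longrightarrow> smooth_on U (\<lambda>x. f x + g x)"
  unfolding smooth_on_def using Ck_on_add by blast

lemma smooth_on_bilinear:
  "bounded_bilinear h \<Longrightarrow> smooth_on U f \<Longrightarrow> smooth_on U g \<Longrightarrow> smooth_on U (\<lambda>x. h (f x) (g x))"
  unfolding smooth_on_def using Ck_on_bilinear by blast

lemmas smooth_on_scaleR = smooth_on_bilinear[OF bounded_bilinear_scaleR]
lemmas smooth_on_mult = smooth_on_bilinear[OF bounded_bilinear_mult]

lemma smooth_on_bounded_linear: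
  assumes "bounded_linear h" "smooth_on U f"
  shows "smooth_on U (\<lambda>x. h (f x))"
proof -
  \<comment> \<open>A linear map becomes a product with the constant function 1, so the Leibniz rule
    applies.\<close>
  have "bounded_bilinear (\<lambda>(a::real) b. a *\<^sub>R h b)"
    using bounded_bilinear.comp[OF bounded_bilinear_scaleR bounded_linear_ident assms(1)] .
  from smooth_on_bilinear[OF this smooth_on_const assms(2), of 1] show ?thesis
    using smooth_on_open[OF assms(2)] by simp
qed

lemma smooth_on_minus: "smooth_on U f \<Longrightarrow> smooth_on U (\<lambda>x. - f x)"
  by (rule smooth_on_bounded_linear[OF bounded_linear_minus[OF bounded_linear_ident]])

lemma smooth_on_diff: "smooth_on U f \<Longrightarrow> smooth_on U g \<Longrightarrow> smooth_on U (\<lambda>x. f x - g x)"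
  using smooth_on_add[OF _ smooth_on_minus, of U f g] by simp

lemma smooth_on_inverse:
  fixes f :: "'a::real_normed_vector \<Rightarrow> real"
  shows "smooth_on U f \<Longrightarrow> (\<And>x. x \<in> U \<Longrightarrow> f x \<noteq> 0) \<Longrightarrow> smooth_on U (\<lambda>x. inverse (f x))"
  unfolding smooth_on_def using Ck_on_inverse by blast

lemma smooth_on_sum:
  assumes "open U" "\<And>i. i \<in> I \<Longrightarrow> smooth_on U (f i)"
  shows "smooth_on U (\<lambda>x. \<Sum>i\<in>I. f i x)"
  using assms(2) by (induction I rule: infinite_finite_induct) (auto intro: smooth_on_const assms(1) smooth_on_add)

lemma smooth_on_prod:
  fixes f :: "'i \<Rightarrow> 'a::real_normed_vector \<Rightarrow> real"
  assumes "open U" "\<And>i. i \<in> I \<Longrightarrow> smooth_on U (f i)"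
  shows "smooth_on U (\<lambda>x. \<Prod>i\<in>I. f i x)"
  using assms(2) by (induction I rule: infinite_finite_induct) (auto intro: smooth_on_const assms(1) smooth_on_mult)

lemma smooth_on_local:
  assumes "open U" "\<And>x. x \<in> U \<Longrightarrow> \<exists>W. open W \<and> x \<in> W \<and> W \<subseteq> U \<and> smooth_on W f"
  shows "smooth_on U f"
proof -
  have "Ck_on k U g" if "\<And>x. x \<in> U \<Longrightarrow> \<exists>W. open W \<and> x \<in> W \<and> W \<subseteq> U \<and> Ck_on k W g" for k and g :: "'a \<Rightarrow> 'b"
    using that
  proof (induction k arbitrary: g)
    case 0
    then show ?case
      by (metis Ck_on.simps(1) assms(1) continuous_at_imp_continuous_on continuous_on_eq_continuous_at)
  next
    case (Suc k)
    have "g differentiable_on U" unfolding differentiable_on_open[OF assms(1)]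
    proof
      fix x assume "x \<in> U"
      then obtain W where "open W" "x \<in> W" "g differentiable_on W" using Suc.prems by (metis Ck_on.simps(2))
      then show "g differentiable (at x)" using differentiable_on_open by blast
    qed
    moreover have "Ck_on k U (dir_deriv X g)" for X
      by (rule Suc.IH) (metis Ck_on.simps(2) Suc.prems)
    ultimately show ?case by simp
  qed
  then show ?thesis using assms unfolding smooth_on_def by meson
qed

section \<open>Smooth dependence of solutions of linear equations\<close>

lemma smooth_on_det:
  fixes A :: "'a::real_normed_vector \<Rightarrow> real^'n^'n"
  assumes "open U" "\<And>i j. smooth_on U (\<lambda>x. A x $ i $ j)"
  shows "smooth_on U (\<lambda>x. det (A x))"
  unfolding det_def
  by (intro smooth_on_sum smooth_on_mult smooth_on_prod smooth_on_const assms)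

text \<open>Cramer's rule writes the solution as a quotient of determinants. Frame coefficients of
  projections, the Levi-Civita connection and the inverse Gram matrix all get their smoothness from
  here.\<close>

lemma smooth_on_linear_system:
  fixes A :: "'a::real_normed_vector \<Rightarrow> real^'n^'n"
  assumes "open U" "\<And>i j. smooth_on U (\<lambda>x. A x $ i $ j)" "\<And>i. smooth_on U (\<lambda>x. b x $ i)"
    and "\<And>x. x \<in> U \<Longrightarrow> det (A x) \<noteq> 0" "\<And>x. x \<in> U \<Longrightarrow> A x *v c x = b x"
  shows "smooth_on U (\<lambda>x. c x $ k)"
proof -
  have "c x $ k = det (\<chi> i j. if j = k then b x $ i else A x $ i $ j) * inverse (det (A x))" if "x \<in> U" for x
    using cramer[OF assms(4)[OF that], of "c x" "b x"] assms(5)[OF that] by (simp add: divide_inverse vec_eq_iff)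
  moreover have "smooth_on U (\<lambda>x. det (\<chi> i j. if j = k then b x $ i else A x $ i $ j) * inverse (det (A x)))"
  proof (intro smooth_on_mult smooth_on_inverse smooth_on_det assms)
    fix i j show "smooth_on U (\<lambda>x. (\<chi> i j. if j = k then b x $ i else A x $ i $ j) $ i $ j)"
      using assms by (cases "j = k") auto
  qed
  ultimately show ?thesis by (rule smooth_on_cong[rotated])
qed

lemma smooth_on_vec:
  fixes f :: "'a::real_normed_vector \<Rightarrow> real^'n"
  assumes "open U" "\<And>i. smooth_on U (\<lambda>x. f x $ i)"
  shows "smooth_on U f"
proof -
  have "f x = (\<Sum>i\<in>UNIV. f x $ i *\<^sub>R axis i 1)" for x
    using basis_expansion[of "f x"] by (simp add: scalar_mult_eq_scaleR)
  then show ?thesis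
    by (rule smooth_on_cong[rotated]) (intro smooth_on_sum smooth_on_scaleR smooth_on_const assms)
qed

text \<open>On a finite-dimensional domain an operator is a finite combination of its values on the
  basis.\<close>

lemma smooth_on_blinfun:
  fixes f :: "'a::real_normed_vector \<Rightarrow> 'b::euclidean_space \<Rightarrow>\<^sub>L 'c::real_normed_vector"
  assumes "open U" "\<And>e. smooth_on U (\<lambda>x. blinfun_apply (f x) e)"
  shows "smooth_on U f"
proof -
  have "f x = (\<Sum>b\<in>Basis. blinfun_scaleR_left (f x b) o\<^sub>L blinfun_inner_left b)" for x
  proof (rule blinfun_eqI)
    fix v
    have "f x v = f x (\<Sum>b\<in>Basis. (v \<bullet> b) *\<^sub>R b)" by (simp add: euclidean_representation)
    also have "\<dots> = (\<Sum>b\<in>Basis. (v \<bullet> b) *\<^sub>R f x b)" by (simp only: blinfun.sum_right blinfun.scaleR_right)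
    finally show "f x v = (\<Sum>b\<in>Basis. blinfun_scaleR_left (f x b) o\<^sub>L blinfun_inner_left b) v"
      by (simp add: blinfun.sum_left inner_commute)
  qed
  then show ?thesis
    by (rule smooth_on_cong[rotated])
      (intro smooth_on_sum smooth_on_bounded_linear[OF bounded_linear_compose[OF
        bounded_bilinear.bounded_linear_left[OF bounded_bilinear_blinfun_compose] bounded_linear_blinfun_scaleR_left]] assms)
qed

text \<open>The mean value theorem is used twice: along X for the increment in direction Y, then
  along Y for the derivative in direction X. The left side is symmetric in X and Y, the right side
  not visibly so; comparing the two orders gives the symmetry of second derivatives.\<close>

lemma second_difference_mvt:
  fixes f :: "'a::real_normed_vector \<Rightarrow> real"
  assumes "0 < s"
    and d1: "\<And>a b. 0 \<le> a \<Longrightarrow> a \<le> s \<Longrightarrow> 0 \<le> b \<Longrightarrow> b \<le> s \<Longrightarrow> f differentiable (at (x + a *\<^sub>R X + b *\<^sub>R Y))"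
    and d2: "\<And>a b. 0 \<le> a \<Longrightarrow> a \<le> s \<Longrightarrow> 0 \<le> b \<Longrightarrow> b \<le> s \<Longrightarrow> dir_deriv X f differentiable (at (x + a *\<^sub>R X + b *\<^sub>R Y))"
  shows "\<exists>a b. 0 \<le> a \<and> a \<le> s \<and> 0 \<le> b \<and> b \<le> s \<and>
    f (x + s *\<^sub>R X + s *\<^sub>R Y) - f (x + s *\<^sub>R X) - f (x + s *\<^sub>R Y) + f x
      = s * s * dir_deriv Y (dir_deriv X f) (x + a *\<^sub>R X + b *\<^sub>R Y)"
proof -
  define h where "h a = f (x + a *\<^sub>R X + s *\<^sub>R Y) - f (x + a *\<^sub>R X)" for a
  have der: "((\<lambda>a. f (x + a *\<^sub>R X + b *\<^sub>R Y)) has_derivative (\<lambda>t. t * dir_deriv X f (x + a *\<^sub>R X + b *\<^sub>R Y))) (at a)"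
    if "0 \<le> a" "a \<le> s" "0 \<le> b" "b \<le> s" for a b
  proof -
    have "((\<lambda>a. x + a *\<^sub>R X + b *\<^sub>R Y) has_derivative (\<lambda>t. t *\<^sub>R X)) (at a)"
      by (auto intro!: derivative_eq_intros)
    from diff_chain_at[OF this dir_deriv_works[OF d1[OF that]]]
    show ?thesis using linear_scale[OF dir_deriv_linear[OF d1[OF that]]] by (simp add: o_def)
  qed
  have h': "(h has_derivative (\<lambda>t. t * (dir_deriv X f (x + a *\<^sub>R X + s *\<^sub>R Y) - dir_deriv X f (x + a *\<^sub>R X)))) (at a)"
    if "0 \<le> a" "a \<le> s" for a
    unfolding h_def using has_derivative_diff[OF der[of a s] der[of a 0]] that assms(1)
    by (auto simp: algebra_simps)
  have "\<exists>a\<in>{0<..<s}. h s - h 0 = (s - 0) * (dir_deriv X f (x + a *\<^sub>R X + s *\<^sub>R Y) - dir_deriv X f (x + a *\<^sub>R X))"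
    by (rule mvt_simple[OF assms(1), where f = h and
        f' = "\<lambda>a t. t * (dir_deriv X f (x + a *\<^sub>R X + s *\<^sub>R Y) - dir_deriv X f (x + a *\<^sub>R X))"])
      (rule has_derivative_at_withinI[OF h'])
  then obtain a where a: "0 < a" "a < s"
    "h s - h 0 = s * (dir_deriv X f (x + a *\<^sub>R X + s *\<^sub>R Y) - dir_deriv X f (x + a *\<^sub>R X))" by auto
  have der2: "((\<lambda>b. dir_deriv X f (x + a *\<^sub>R X + b *\<^sub>R Y)) has_derivative
      (\<lambda>t. t * dir_deriv Y (dir_deriv X f) (x + a *\<^sub>R X + b *\<^sub>R Y))) (at b)"
    if "0 \<le> b" "b \<le> s" for b
  proof -
    have "((\<lambda>b. x + a *\<^sub>R X + b *\<^sub>R Y) has_derivative (\<lambda>t. t *\<^sub>R Y)) (at b)"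
      by (auto intro!: derivative_eq_intros)
    from diff_chain_at[OF this dir_deriv_works[OF d2]] that a
    show ?thesis using linear_scale[OF dir_deriv_linear[OF d2]] by (simp add: o_def)
  qed
  have "\<exists>b\<in>{0<..<s}. dir_deriv X f (x + a *\<^sub>R X + s *\<^sub>R Y) - dir_deriv X f (x + a *\<^sub>R X + 0 *\<^sub>R Y)
     = (s - 0) * dir_deriv Y (dir_deriv X f) (x + a *\<^sub>R X + b *\<^sub>R Y)"
    by (rule mvt_simple[OF assms(1), where f = "\<lambda>b. dir_deriv X f (x + a *\<^sub>R X + b *\<^sub>R Y)" and
        f' = "\<lambda>b t. t * dir_deriv Y (dir_deriv X f) (x + a *\<^sub>R X + b *\<^sub>R Y)"])
      (rule has_derivative_at_withinI[OF der2])
  then obtain b where "0 < b" "b < s" "dir_deriv X f (x + a *\<^sub>R X + s *\<^sub>R Y) - dir_deriv X f (x + a *\<^sub>R X)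
     = s * dir_deriv Y (dir_deriv X f) (x + a *\<^sub>R X + b *\<^sub>R Y)" by auto
  with a show ?thesis unfolding h_def by (intro exI[of _ a] exI[of _ b]) (auto simp: algebra_simps)
qed

lemma dir_deriv_commute_real:
  fixes f :: "'a::real_normed_vector \<Rightarrow> real"
  assumes sm: "smooth_on U f" and x: "x \<in> U"
  shows "dir_deriv X (dir_deriv Y f) x = dir_deriv Y (dir_deriv X f) x"
proof (rule ccontr)
  let ?p = "dir_deriv X (dir_deriv Y f)" and ?q = "dir_deriv Y (dir_deriv X f)"
  assume ne: "?p x \<noteq> ?q x"
  \<comment> \<open>Half the gap: the two mixed derivatives take a common value near x, which cannot
    be within e of both limits.\<close>
  define e where "e = \<bar>?p x - ?q x\<bar> / 2"
  have e: "e > 0" using ne by (simp add: e_def)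
  have op: "open U" using smooth_on_open[OF sm] .
  have c: "continuous_on U ?p" "continuous_on U ?q"
    by (rule smooth_on_continuous[OF smooth_on_dir_deriv[OF smooth_on_dir_deriv[OF sm]]])+
  have "isCont ?p x" "isCont ?q x"
    using c x op by (simp_all add: continuous_on_eq_continuous_at)
  then obtain d1 d2 where d: "d1 > 0" "\<forall>y. dist y x < d1 \<longrightarrow> dist (?p y) (?p x) < e"
    "d2 > 0" "\<forall>y. dist y x < d2 \<longrightarrow> dist (?q y) (?q x) < e"
    using e unfolding continuous_at_eps_delta by force
  obtain d3 where d3: "d3 > 0" "ball x d3 \<subseteq> U" using op x open_contains_ball by blast
  define d where "d = min d1 (min d2 d3)"
  \<comment> \<open>Side length for which the whole parallelogram stays within distance d of x; the
    summand 1 avoids division by zero when X and Y vanish.\<close>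
  define s where "s = d / (2 * (norm X + norm Y + 1))"
  have dpos: "d > 0" using d d3 by (simp add: d_def)
  have s: "s > 0" using dpos by (simp add: s_def add_nonneg_pos)
  have near: "dist (x + a *\<^sub>R X + b *\<^sub>R Y) x < d" if "0 \<le> a" "a \<le> s" "0 \<le> b" "b \<le> s" for a b
  proof -
    have "dist (x + a *\<^sub>R X + b *\<^sub>R Y) x = norm (a *\<^sub>R X + b *\<^sub>R Y)" by (simp add: dist_norm add.assoc)
    also have "\<dots> \<le> a * norm X + b * norm Y" using that norm_triangle_ineq[of "a *\<^sub>R X" "b *\<^sub>R Y"] by simp
    also have "\<dots> \<le> s * norm X + s * norm Y" using that by (intro add_mono mult_right_mono) auto
    also have "\<dots> < s * (2 * (norm X + norm Y + 1))"
    proof -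
      have "0 \<le> s * norm X" "0 \<le> s * norm Y" using s by simp_all
      moreover have "s * (2 * (norm X + norm Y + 1)) = 2 * (s * norm X) + 2 * (s * norm Y) + 2 * s"
        by (simp add: algebra_simps)
      ultimately show ?thesis using s by linarith
    qed
    also have "\<dots> = d" unfolding s_def using add_nonneg_pos[of "norm X + norm Y" 1] by (simp add: field_simps)
    finally show ?thesis .
  qed
  have inU: "x + a *\<^sub>R X + b *\<^sub>R Y \<in> U" if "0 \<le> a" "a \<le> s" "0 \<le> b" "b \<le> s" for a b
    using near[OF that] d3 by (auto simp: d_def dist_commute subset_iff)
  have "x + a *\<^sub>R Y + b *\<^sub>R X = x + b *\<^sub>R X + a *\<^sub>R Y" for a b by simp
  then have inU': "x + a *\<^sub>R Y + b *\<^sub>R X \<in> U" if "0 \<le> a" "a \<le> s" "0 \<le> b" "b \<le> s" for a b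
    using inU[of b a] that by (simp add: add_ac)
  obtain a b where ab: "0 \<le> a" "a \<le> s" "0 \<le> b" "b \<le> s"
    "f (x + s *\<^sub>R X + s *\<^sub>R Y) - f (x + s *\<^sub>R X) - f (x + s *\<^sub>R Y) + f x = s * s * ?q (x + a *\<^sub>R X + b *\<^sub>R Y)"
    using second_difference_mvt[OF s smooth_on_differentiable[OF sm inU]
        smooth_on_differentiable[OF smooth_on_dir_deriv[OF sm] inU]] by auto
  obtain a' b' where ab': "0 \<le> a'" "a' \<le> s" "0 \<le> b'" "b' \<le> s"
    "f (x + s *\<^sub>R Y + s *\<^sub>R X) - f (x + s *\<^sub>R Y) - f (x + s *\<^sub>R X) + f x = s * s * ?p (x + a' *\<^sub>R Y + b' *\<^sub>R X)"
    using second_difference_mvt[OF s smooth_on_differentiable[OF sm inU']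
      smooth_on_differentiable[OF smooth_on_dir_deriv[OF sm] inU']] by auto
  have c: "x + s *\<^sub>R Y + s *\<^sub>R X = x + s *\<^sub>R X + s *\<^sub>R Y" "x + a' *\<^sub>R Y + b' *\<^sub>R X = x + b' *\<^sub>R X + a' *\<^sub>R Y" by simp_all
  have "s * s * ?q (x + a *\<^sub>R X + b *\<^sub>R Y) = s * s * ?p (x + b' *\<^sub>R X + a' *\<^sub>R Y)"
    using ab(5) ab'(5) unfolding c by linarith
  then have "?q (x + a *\<^sub>R X + b *\<^sub>R Y) = ?p (x + b' *\<^sub>R X + a' *\<^sub>R Y)" using s by simp
  moreover have "dist (?q (x + a *\<^sub>R X + b *\<^sub>R Y)) (?q x) < e" "dist (?p (x + b' *\<^sub>R X + a' *\<^sub>R Y)) (?p x) < e"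
    using d near[OF ab(1-4)] near[of b' a'] ab' by (auto simp: d_def)
  ultimately show False unfolding e_def dist_real_def by (auto simp: abs_if split: if_splits)
qed

lemma dir_deriv_commute:
  fixes f :: "'a::real_normed_vector \<Rightarrow> 'b::euclidean_space"
  assumes sm: "smooth_on U f" and x: "x \<in> U"
  shows "dir_deriv X (dir_deriv Y f) x = dir_deriv Y (dir_deriv X f) x"
proof (rule euclidean_eqI)
  fix b :: 'b
  have op: "open U" using smooth_on_open[OF sm] .
  have bl: "bounded_linear (\<lambda>v. v \<bullet> b)" by (rule bounded_linear_inner_left)
  have 1: "dir_deriv Z (\<lambda>y. f y \<bullet> b) y = dir_deriv Z f y \<bullet> b" if "y \<in> U" for y Z
    by (rule dir_deriv_bounded_linear[OF bl smooth_on_differentiable[OF sm that]])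
  have 2: "dir_deriv W (dir_deriv Z (\<lambda>y. f y \<bullet> b)) x = dir_deriv W (dir_deriv Z f) x \<bullet> b" for W Z
    by (rule trans[OF dir_deriv_cong_open[OF op x 1]
      dir_deriv_bounded_linear[OF bl smooth_on_differentiable[OF smooth_on_dir_deriv[OF sm] x]]])
  show "dir_deriv X (dir_deriv Y f) x \<bullet> b = dir_deriv Y (dir_deriv X f) x \<bullet> b"
    using dir_deriv_commute_real[OF smooth_on_bounded_linear[OF bl sm] x] 2 by metis
qed

lemmas smooth_on_blinfun_apply = smooth_on_bilinear[OF bounded_bilinear_blinfun_apply]

lemmas blinfun_simps = blinfun.add_left blinfun.add_right blinfun.diff_left blinfun.diff_right
  blinfun.minus_left blinfun.minus_right blinfun.scaleR_left blinfun.scaleR_right blinfun.zero_right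

lemmas bilinear_simps = bilinear_ladd bilinear_radd bilinear_lmul bilinear_rmul bilinear_lsub bilinear_rsub

section \<open>Flat total linear systems\<close>

text \<open>Setting for integrating du = A u along rays from 0. The derivative \<open>A'\<close> is
  an operator-valued map so that it can be bounded and integrated, and \<open>small\<close> will
  make the integral operator a contraction with factor 1/4.\<close>

locale radial_system =
  fixes A :: "'a::euclidean_space \<Rightarrow> 'a \<Rightarrow>\<^sub>L 'b::euclidean_space \<Rightarrow>\<^sub>L 'b"
    and A' :: "'a \<Rightarrow> 'a \<Rightarrow>\<^sub>L 'a \<Rightarrow>\<^sub>L 'b \<Rightarrow>\<^sub>L 'b"
    and r a a' :: real
  assumes r_pos: "0 < r"
    and deriv_A: "\<And>x. x \<in> ball 0 r \<Longrightarrow> (A has_derivative blinfun_apply (A' x)) (at x)"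
    and cont_A': "continuous_on (ball 0 r) A'"
    and bound_A: "\<And>x. x \<in> ball 0 r \<Longrightarrow> norm (A x) \<le> a"
    and bound_A': "\<And>x. x \<in> ball 0 r \<Longrightarrow> norm (A' x) \<le> a'"
    and small: "a * r \<le> 1 / 4"
begin

abbreviation "S \<equiv> ball (0::'a) r"

lemma scale_in_S: "x \<in> S \<Longrightarrow> 0 \<le> t \<Longrightarrow> t \<le> 1 \<Longrightarrow> t *\<^sub>R x \<in> S"
  using mult_left_le_one_le[of "norm x" t] by auto

lemma cont_A: "continuous_on S A"
  using deriv_A by (meson continuous_at_imp_continuous_on has_derivative_continuous)

lemma a_nonneg: "0 \<le> a" "0 \<le> a'"
  using order_trans[OF norm_ge_zero bound_A[of 0]] order_trans[OF norm_ge_zero bound_A'[of 0]] r_pos by auto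

lemma norm_A: "x \<in> S \<Longrightarrow> norm (A x h w) \<le> a * norm h * norm w"
proof -
  assume x: "x \<in> S"
  have "norm (A x h w) \<le> norm (A x h) * norm w" by (rule norm_blinfun)
  also have "\<dots> \<le> norm (A x) * norm h * norm w" by (intro mult_right_mono norm_blinfun) auto
  also have "\<dots> \<le> a * norm h * norm w" by (intro mult_right_mono bound_A x) auto
  finally show ?thesis .
qed

lemma norm_A': "x \<in> S \<Longrightarrow> norm (A' x h k w) \<le> a' * norm h * norm k * norm w"
proof -
  assume x: "x \<in> S"
  have "norm (A' x h k w) \<le> norm (A' x h k) * norm w" by (rule norm_blinfun)
  also have "\<dots> \<le> norm (A' x h) * norm k * norm w" by (intro mult_right_mono norm_blinfun) auto
  also have "\<dots> \<le> norm (A' x) * norm h * norm k * norm w" by (intro mult_right_mono norm_blinfun) auto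
  also have "\<dots> \<le> a' * norm h * norm k * norm w" by (intro mult_right_mono bound_A' x) auto
  finally show ?thesis .
qed

text \<open>The source of the contraction factor: in the radial direction A has norm at most a r
  \<le> 1/4.\<close>

lemma norm_A_radial: "x \<in> S \<Longrightarrow> y \<in> S \<Longrightarrow> norm w \<le> m \<Longrightarrow> norm (A y x w) \<le> m / 4"
proof -
  assume x: "x \<in> S" and y: "y \<in> S" and w: "norm w \<le> m"
  have "a * norm x \<le> 1 / 4" using x small a_nonneg mult_left_mono[of "norm x" r a] by auto
  then have "a * norm x * norm w \<le> 1 / 4 * m"
    using w a_nonneg by (intro mult_mono) auto
  then show ?thesis using norm_A[OF y, of x w] by simp
qed

text \<open>The equation \<open>u = v\<^sub>0 + T u\<close> says that \<open>du = A u\<close> in the radial directions.\<close>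

definition T :: "('a \<Rightarrow> 'b) \<Rightarrow> 'a \<Rightarrow> 'b" where
  "T u x = integral {0..1} (\<lambda>t. A (t *\<^sub>R x) x (u (t *\<^sub>R x)))"

text \<open>The derivative in x of the integrand of \<open>T\<close>, if D is the derivative of u.
  The factors t come from the chain rule; the middle term varies the explicit argument x.\<close>

definition T'_integrand :: "('a \<Rightarrow> 'b) \<Rightarrow> ('a \<Rightarrow> 'a \<Rightarrow>\<^sub>L 'b) \<Rightarrow> 'a \<Rightarrow> real \<Rightarrow> 'a \<Rightarrow> 'b" where
  "T'_integrand u D x t h = t *\<^sub>R A' (t *\<^sub>R x) h x (u (t *\<^sub>R x)) + A (t *\<^sub>R x) h (u (t *\<^sub>R x))
      + t *\<^sub>R A (t *\<^sub>R x) x (D (t *\<^sub>R x) h)"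

definition T' :: "('a \<Rightarrow> 'b) \<Rightarrow> ('a \<Rightarrow> 'a \<Rightarrow>\<^sub>L 'b) \<Rightarrow> 'a \<Rightarrow> 'a \<Rightarrow>\<^sub>L 'b" where
  "T' u D x = integral {0..1} (\<lambda>t. Blinfun (T'_integrand u D x t))"

lemma bounded_linear_T'_integrand: "bounded_linear (T'_integrand u D x t)"
  unfolding T'_integrand_def[abs_def] by (intro bounded_linear_intros)

lemma T'_integrand_apply: "Blinfun (T'_integrand u D x t) h = T'_integrand u D x t h"
  by (simp add: bounded_linear_Blinfun_apply[OF bounded_linear_T'_integrand])

lemma continuous_on_scale: "continuous_on S f \<Longrightarrow> continuous_on (S \<times> {0..1}) (\<lambda>p. f (snd p *\<^sub>R fst p))"
  by (erule continuous_on_compose2) (auto intro!: continuous_intros scale_in_S simp del: mem_ball)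

lemma continuous_on_T'_integrand:
  assumes "continuous_on S u" "continuous_on S D"
  shows "continuous_on (S \<times> {0..1}) (\<lambda>(x, t). Blinfun (T'_integrand u D x t))"
  unfolding split_beta
  apply (rule continuous_on_blinfun_componentwise)
  unfolding T'_integrand_apply T'_integrand_def
  by (intro continuous_intros continuous_on_scale cont_A cont_A' assms)

lemma continuous_on_ray:
  assumes "x \<in> S" "continuous_on (S \<times> {0..1}) (\<lambda>(x, t). f x t)"
  shows "continuous_on {0..1} (f x)"
proof -
  have "continuous_on {0..1} (\<lambda>t. case (x, t) of (x, t) \<Rightarrow> f x t)"
    by (rule continuous_on_compose2[OF assms(2)]) (use assms(1) in \<open>auto intro!: continuous_intros\<close>)
  then show ?thesis by simp
qed

lemma continuous_on_along_ray: "x \<in> S \<Longrightarrow> continuous_on S f \<Longrightarrow> continuous_on {0..1} (\<lambda>t. f (t *\<^sub>R x))"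
  by (erule continuous_on_compose2) (auto intro!: continuous_intros scale_in_S simp del: mem_ball)

lemma continuous_on_T_integrand:
  assumes "continuous_on S u" "x \<in> S"
  shows "continuous_on {0..1} (\<lambda>t. A (t *\<^sub>R x) x (u (t *\<^sub>R x)))"
  by (intro continuous_intros continuous_on_along_ray cont_A assms)

lemma T'_apply:
  assumes "continuous_on S u" "continuous_on S D" "x \<in> S"
  shows "T' u D x h = integral {0..1} (\<lambda>t. T'_integrand u D x t h)"
proof -
  have "(\<lambda>t. Blinfun (T'_integrand u D x t)) integrable_on {0..1}"
    using continuous_on_ray[OF assms(3) continuous_on_T'_integrand[OF assms(1,2)]]
    by (rule integrable_continuous_interval)
  then show ?thesis unfolding T'_def by (simp add: blinfun_apply_integral T'_integrand_apply)
qed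

lemma T_has_derivative:
  assumes u: "\<And>x. x \<in> S \<Longrightarrow> (u has_derivative blinfun_apply (D x)) (at x)"
    and D: "continuous_on S D" and x: "x \<in> S"
  shows "(T u has_derivative blinfun_apply (T' u D x)) (at x)"
proof -
  have cu: "continuous_on S u"
    using u by (meson continuous_at_imp_continuous_on has_derivative_continuous)
  have "((\<lambda>x. integral (cbox 0 1) (\<lambda>t. A (t *\<^sub>R x) x (u (t *\<^sub>R x)))) has_derivative
      blinfun_apply (integral (cbox 0 1) (\<lambda>t. Blinfun (T'_integrand u D x t)))) (at x within S)"
  proof (rule leibniz_rule)
    fix y :: 'a and t :: real assume y: "y \<in> S" and t: "t \<in> cbox 0 1"
    have ty: "t *\<^sub>R y \<in> S" using scale_in_S[OF y] t by simp
    have l: "((\<lambda>x. t *\<^sub>R x) has_derivative (\<lambda>h. t *\<^sub>R h)) (at y)" by (auto intro!: derivative_eq_intros)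
    have "((\<lambda>x. A (t *\<^sub>R x) x (u (t *\<^sub>R x))) has_derivative
      (\<lambda>h. A (t *\<^sub>R y) y (D (t *\<^sub>R y) (t *\<^sub>R h)) + (A (t *\<^sub>R y) h + A' (t *\<^sub>R y) (t *\<^sub>R h) y) (u (t *\<^sub>R y)))) (at y)"
      by (rule blinfun.FDERIV[OF blinfun.FDERIV[OF has_derivative_compose[OF l deriv_A[OF ty]] has_derivative_ident]
        has_derivative_compose[OF l u[OF ty]]])
    moreover have "(\<lambda>h. A (t *\<^sub>R y) y (D (t *\<^sub>R y) (t *\<^sub>R h)) + (A (t *\<^sub>R y) h + A' (t *\<^sub>R y) (t *\<^sub>R h) y) (u (t *\<^sub>R y)))
        = blinfun_apply (Blinfun (T'_integrand u D y t))"
      by (rule ext) (simp add: T'_integrand_apply T'_integrand_def blinfun.add_left blinfun.scaleR_left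
          blinfun.scaleR_right)
    ultimately show "((\<lambda>x. A (t *\<^sub>R x) x (u (t *\<^sub>R x))) has_derivative blinfun_apply (Blinfun (T'_integrand u D y t))) (at y within S)"
      by (simp only: has_derivative_at_withinI)
  next
    fix y assume "y \<in> S"
    then show "(\<lambda>t. A (t *\<^sub>R y) y (u (t *\<^sub>R y))) integrable_on cbox 0 1"
      unfolding cbox_interval by (intro integrable_continuous_interval continuous_on_T_integrand cu)
  next
    show "continuous_on (S \<times> cbox 0 1) (\<lambda>(x, t). Blinfun (T'_integrand u D x t))"
      using continuous_on_T'_integrand[OF cu D] by simp
  qed (use x in auto)
  then show ?thesis
    using x by (simp add: T_def[abs_def] T'_def at_within_open[OF x open_ball])
qed

lemma continuous_on_T':
  assumes "continuous_on S u" "continuous_on S D"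
  shows "continuous_on S (T' u D)"
proof -
  have "continuous_on S (\<lambda>x. integral (cbox 0 1) (\<lambda>t. Blinfun (T'_integrand u D x t)))"
    by (rule integral_continuous_on_param) (use continuous_on_T'_integrand[OF assms] in simp)
  then show ?thesis by (simp add: T'_def[abs_def])
qed

lemma norm_T:
  assumes "continuous_on S u" "\<And>x. x \<in> S \<Longrightarrow> norm (u x) \<le> m" "x \<in> S"
  shows "norm (T u x) \<le> m / 4"
proof -
  have "norm (A (t *\<^sub>R x) x (u (t *\<^sub>R x))) \<le> m / 4" if "t \<in> {0..1}" for t
    using that by (intro norm_A_radial assms scale_in_S) auto
  then have "norm (T u x) \<le> m / 4 * (1 - 0)"
    unfolding T_def by (intro integral_bound continuous_on_T_integrand assms) auto
  then show ?thesis by simp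
qed

text \<open>The bound k on the derivative enters only with the factor 1/4 of
  \<open>norm_A_radial\<close>; differentiating A or varying x costs a multiple of the bound m on
  u.\<close>

lemma norm_T':
  assumes u: "continuous_on S u" "\<And>x. x \<in> S \<Longrightarrow> norm (u x) \<le> m"
    and D: "continuous_on S D" "\<And>x. x \<in> S \<Longrightarrow> norm (D x) \<le> k" and x: "x \<in> S"
  shows "norm (T' u D x) \<le> (a' * r + a) * m + k / 4"
proof -
  have m: "0 \<le> m" using u(2)[OF x] norm_ge_zero order_trans by blast
  have k: "0 \<le> k" using D(2)[OF x] norm_ge_zero order_trans by blast
  have "norm (Blinfun (T'_integrand u D x t)) \<le> (a' * r + a) * m + k / 4" if t: "t \<in> {0..1}" for t
  proof (rule norm_blinfun_bound)
    show "0 \<le> (a' * r + a) * m + k / 4" using m k a_nonneg r_pos by simp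
    fix h
    have tx: "t *\<^sub>R x \<in> S" using scale_in_S[OF x] t by simp
    have 1: "norm (A' (t *\<^sub>R x) h x (u (t *\<^sub>R x))) \<le> a' * r * m * norm h"
    proof -
      have "norm (A' (t *\<^sub>R x) h x (u (t *\<^sub>R x))) \<le> a' * norm h * norm x * norm (u (t *\<^sub>R x))"
        by (rule norm_A'[OF tx])
      also have "\<dots> \<le> a' * norm h * r * m"
        using x u(2)[OF tx] a_nonneg r_pos m by (intro mult_mono mult_nonneg_nonneg) auto
      finally show ?thesis by (simp add: mult_ac)
    qed
    have 2: "norm (A (t *\<^sub>R x) h (u (t *\<^sub>R x))) \<le> a * m * norm h"
    proof -
      have "norm (A (t *\<^sub>R x) h (u (t *\<^sub>R x))) \<le> a * norm h * norm (u (t *\<^sub>R x))" by (rule norm_A[OF tx])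
      also have "\<dots> \<le> a * norm h * m" using u(2)[OF tx] a_nonneg by (intro mult_left_mono mult_nonneg_nonneg) auto
      finally show ?thesis by (simp add: mult_ac)
    qed
    have 3: "norm (A (t *\<^sub>R x) x (D (t *\<^sub>R x) h)) \<le> k * norm h / 4"
    proof (rule norm_A_radial[OF x tx])
      have "norm (D (t *\<^sub>R x) h) \<le> norm (D (t *\<^sub>R x)) * norm h" by (rule norm_blinfun)
      also have "\<dots> \<le> k * norm h" by (intro mult_right_mono D(2) tx) auto
      finally show "norm (D (t *\<^sub>R x) h) \<le> k * norm h" .
    qed
    have s: "norm (t *\<^sub>R w) \<le> norm w" for w :: 'b using t mult_left_le_one_le[of "norm w" t] by auto
    have "norm (T'_integrand u D x t h) \<le> norm (t *\<^sub>R A' (t *\<^sub>R x) h x (u (t *\<^sub>R x)))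
        + norm (A (t *\<^sub>R x) h (u (t *\<^sub>R x))) + norm (t *\<^sub>R A (t *\<^sub>R x) x (D (t *\<^sub>R x) h))"
      unfolding T'_integrand_def using norm_triangle_ineq by (smt (verit, best))
    also have "\<dots> \<le> a' * r * m * norm h + a * m * norm h + k * norm h / 4"
      by (intro add_mono order_trans[OF s] 1 2 3)
    finally show "norm (Blinfun (T'_integrand u D x t) h) \<le> ((a' * r + a) * m + k / 4) * norm h"
      by (simp add: T'_integrand_apply algebra_simps)
  qed
  then have "norm (T' u D x) \<le> ((a' * r + a) * m + k / 4) * (1 - 0)"
    unfolding T'_def
    by (intro integral_bound) (auto intro!: continuous_on_ray[OF x continuous_on_T'_integrand[OF u(1) D(1)]])
  then show ?thesis by simp
qed

text \<open>Terms of the Neumann series, not successive approximations: the first entry is T applied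
  k times to v0, the second its derivative. Carrying the derivative along lets the series be
  differentiated termwise.\<close>

fun picard :: "'b \<Rightarrow> nat \<Rightarrow> ('a \<Rightarrow> 'b) \<times> ('a \<Rightarrow> 'a \<Rightarrow>\<^sub>L 'b)" where
  "picard v0 0 = ((\<lambda>_. v0), (\<lambda>_. 0))"
| "picard v0 (Suc k) = (T (fst (picard v0 k)), T' (fst (picard v0 k)) (snd (picard v0 k)))"

text \<open>The value for which the derivative bound reproduces itself: if the k-th bound is K n p,
  then \<open>norm_T'\<close> gives (K / 4) n p + K n p / 4 = K n p / 2, the ratio 1/2 used in
  \<open>picard_props\<close>.\<close>

definition K where "K = 4 * (a' * r + a)"

lemma picard_props:
  shows "(\<forall>x\<in>S. (fst (picard v0 k) has_derivative blinfun_apply (snd (picard v0 k) x)) (at x)) \<and>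
    continuous_on S (fst (picard v0 k)) \<and> continuous_on S (snd (picard v0 k)) \<and>
    (\<forall>x\<in>S. norm (fst (picard v0 k) x) \<le> norm v0 * (1 / 2) ^ k) \<and>
    (\<forall>x\<in>S. norm (snd (picard v0 k) x) \<le> K * norm v0 * (1 / 2) ^ k)"
proof (induction k)
  case 0
  have "0 \<le> K" using a_nonneg r_pos by (simp add: K_def)
  then show ?case by (auto intro!: derivative_eq_intros)
next
  case (Suc k)
  let ?u = "fst (picard v0 k)" and ?D = "snd (picard v0 k)"
  have c: "\<And>x. x \<in> S \<Longrightarrow> (?u has_derivative blinfun_apply (?D x)) (at x)" "continuous_on S ?u" "continuous_on S ?D"
    "\<And>x. x \<in> S \<Longrightarrow> norm (?u x) \<le> norm v0 * (1 / 2) ^ k"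
    "\<And>x. x \<in> S \<Longrightarrow> norm (?D x) \<le> K * norm v0 * (1 / 2) ^ k" using Suc by blast+
  have d: "(T ?u has_derivative blinfun_apply (T' ?u ?D x)) (at x)" if "x \<in> S" for x
    by (rule T_has_derivative[OF c(1) c(3) that])
  moreover have "continuous_on S (T ?u)"
    using d by (meson continuous_at_imp_continuous_on has_derivative_continuous)
  moreover have "continuous_on S (T' ?u ?D)" by (rule continuous_on_T'[OF c(2,3)])
  moreover have "norm (T ?u x) \<le> norm v0 * (1 / 2) ^ Suc k" if "x \<in> S" for x
  proof -
    have "0 \<le> norm v0 * (1 / 2) ^ k" by simp
    then have "norm v0 * (1 / 2) ^ k / 4 \<le> norm v0 * (1 / 2) ^ Suc k" by simp
    with norm_T[OF c(2) c(4) that] show ?thesis by linarith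
  qed
  moreover have "norm (T' ?u ?D x) \<le> K * norm v0 * (1 / 2) ^ Suc k" if "x \<in> S" for x
  proof -
    have "c * z + (4 * c) * n * p / 4 = (4 * c) * n * (1 / 2 * p)" if "z = n * p" for c z n p :: real
      by (simp add: that)
    from this[OF refl] have "(a' * r + a) * (norm v0 * (1 / 2) ^ k) + K * norm v0 * (1 / 2) ^ k / 4 = K * norm v0 * (1 / 2) ^ Suc k"
      unfolding K_def power_Suc .
    then show ?thesis using norm_T'[OF c(2) c(4) c(3) c(5) that] by (rule ord_le_eq_trans[rotated])
  qed
  ultimately show ?case by simp
qed

lemma T_add:
  assumes "continuous_on S u" "continuous_on S w" "x \<in> S"
  shows "T (\<lambda>y. u y + w y) x = T u x + T w x"
  unfolding T_def blinfun.add_right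
  by (intro integral_add integrable_continuous_interval continuous_on_T_integrand assms)

lemma T_diff:
  assumes "continuous_on S u" "continuous_on S w" "x \<in> S"
  shows "T (\<lambda>y. u y - w y) x = T u x - T w x"
  unfolding T_def blinfun.diff_right
  by (intro integral_diff integrable_continuous_interval continuous_on_T_integrand assms)

lemma fixed_point:
  obtains v D C where "\<And>x. x \<in> S \<Longrightarrow> (v has_derivative blinfun_apply (D x)) (at x)" "continuous_on S D"
    "\<And>x. x \<in> S \<Longrightarrow> norm (D x) \<le> C" "\<And>x. x \<in> S \<Longrightarrow> norm (v x) \<le> C" "\<And>x. x \<in> S \<Longrightarrow> v x = v0 + T v x"
proof -
  define u where "u k = fst (picard v0 k)" for k
  define d where "d k = snd (picard v0 k)" for k
  have u: "\<And>k x. x \<in> S \<Longrightarrow> (u k has_derivative blinfun_apply (d k x)) (at x)" "\<And>k. continuous_on S (u k)"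
    "\<And>k. continuous_on S (d k)" "\<And>k x. x \<in> S \<Longrightarrow> norm (u k x) \<le> norm v0 * (1 / 2) ^ k"
    "\<And>k x. x \<in> S \<Longrightarrow> norm (d k x) \<le> K * norm v0 * (1 / 2) ^ k"
    unfolding u_def d_def using picard_props by blast+
  define s where "s n x = (\<Sum>i<n. u i x)" for n x
  define ds where "ds n x = (\<Sum>i<n. d i x)" for n x
  define v where "v x = (\<Sum>i. u i x)" for x
  define D where "D x = (\<Sum>i. d i x)" for x
  have sm: "summable (\<lambda>k. norm v0 * (1 / 2) ^ k)" "summable (\<lambda>k. K * norm v0 * (1 / 2) ^ k)"
    by (intro summable_mult summable_geometric, simp)+
  have ul: "uniform_limit S s v sequentially" "uniform_limit S ds D sequentially"
    unfolding s_def[abs_def] v_def[abs_def] ds_def[abs_def] D_def[abs_def]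
    by (rule Weierstrass_m_test[OF u(4) sm(1)] Weierstrass_m_test[OF u(5) sm(2)], assumption)+
  have cs: "continuous_on S (s n)" "continuous_on S (ds n)" for n
    unfolding s_def[abs_def] ds_def[abs_def] by (intro continuous_intros u)+
  have cv: "continuous_on S v" "continuous_on S D"
    using uniform_limit_theorem[OF _ ul(1)] uniform_limit_theorem[OF _ ul(2)] cs by auto
  have s_lim: "(\<lambda>n. s n x) \<longlonglongrightarrow> v x" if "x \<in> S" for x
    using tendsto_uniform_limitI[OF ul(1) that] .
  have der_s: "(s n has_derivative blinfun_apply (ds n x)) (at x within S)" if "x \<in> S" for n x
  proof -
    have "((\<lambda>x. \<Sum>i<n. u i x) has_derivative (\<lambda>h. \<Sum>i<n. d i x h)) (at x within S)"
      by (rule has_derivative_sum) (rule has_derivative_at_withinI[OF u(1)[OF that]])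
    moreover have "(\<lambda>h. \<Sum>i<n. d i x h) = blinfun_apply (ds n x)"
      by (rule ext) (simp add: ds_def blinfun.sum_left)
    moreover have "s n = (\<lambda>x. \<Sum>i<n. u i x)" by (rule ext) (simp add: s_def)
    ultimately show ?thesis by (simp only:)
  qed
  have lim_ds: "\<forall>\<^sub>F n in sequentially. \<forall>x\<in>S. \<forall>h. norm (ds n x h - D x h) \<le> e * norm h" if "e > 0" for e
    using uniform_limitD[OF ul(2) that]
  proof eventually_elim
    case (elim n)
    have "norm (ds n x h - D x h) \<le> e * norm h" if "x \<in> S" for x h
    proof -
      have "norm (ds n x h - D x h) = norm ((ds n x - D x) h)" by (simp only: blinfun.diff_left)
      also have "\<dots> \<le> norm (ds n x - D x) * norm h" by (rule norm_blinfun)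
      also have "norm (ds n x - D x) \<le> e" using bspec[OF elim that] by (simp only: dist_norm less_imp_le)
      finally show ?thesis by (simp add: mult_right_mono)
    qed
    then show ?case by blast
  qed
  have zero: "0 \<in> S" using r_pos by simp
  \<comment> \<open>Uniform convergence of the derivatives and convergence at the single point 0
    give a differentiable limit, which is v by uniqueness of limits.\<close>
  have "\<exists>g. \<forall>x\<in>S. (\<lambda>n. s n x) \<longlonglongrightarrow> g x \<and> (g has_derivative blinfun_apply (D x)) (at x within S)"
    by (rule has_derivative_sequence[OF convex_ball der_s lim_ds zero s_lim[OF zero]])
  then obtain g where g: "\<And>x. x \<in> S \<Longrightarrow> (\<lambda>n. s n x) \<longlonglongrightarrow> g x"
    "\<And>x. x \<in> S \<Longrightarrow> (g has_derivative blinfun_apply (D x)) (at x within S)" by blast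
  have gv: "g x = v x" if "x \<in> S" for x using LIMSEQ_unique[OF g(1)[OF that] s_lim[OF that]] .
  have dv: "(v has_derivative blinfun_apply (D x)) (at x)" if "x \<in> S" for x
    using g(2)[OF that] has_derivative_cong_open[OF open_ball that gv] at_within_open[OF that open_ball] by simp
  have nD: "norm (D x) \<le> (\<Sum>k. K * norm v0 * (1 / 2) ^ k)" if "x \<in> S" for x
    unfolding D_def by (rule norm_suminf_le[OF u(5)[OF that] sm(2)])
  have nv: "norm (v x) \<le> (\<Sum>k. norm v0 * (1 / 2) ^ k)" if "x \<in> S" for x
    unfolding v_def by (rule norm_suminf_le[OF u(4)[OF that] sm(1)])
  \<comment> \<open>The zeroth term v0 splits off and T carries each term to the next, so the
    equation links consecutive partial sums; passing to the limit uses that T contracts the uniform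
    error.\<close>
  have "s (Suc n) x = v0 + T (s n) x" if "x \<in> S" for n x
  proof (induction n)
    case 0
    show ?case by (simp add: s_def T_def u_def)
  next
    case (Suc n)
    have "T (s (Suc n)) x = T (\<lambda>y. s n y + u n y) x" by (simp add: s_def[abs_def])
    also have "\<dots> = T (s n) x + T (u n) x" by (rule T_add[OF cs(1) u(2) that])
    also have "T (u n) x = u (Suc n) x" by (simp add: u_def)
    finally show ?case using Suc by (simp add: s_def)
  qed
  moreover have "(\<lambda>n. T (s n) x) \<longlonglongrightarrow> T v x" if "x \<in> S" for x
  proof (rule tendstoI)
    fix e :: real assume e: "e > 0"
    show "\<forall>\<^sub>F n in sequentially. dist (T (s n) x) (T v x) < e"
      using uniform_limitD[OF ul(1) e]
    proof eventually_elim
      case (elim n)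
      have "norm (T (\<lambda>y. s n y - v y) x) \<le> e / 4"
        by (rule norm_T) (use elim that in \<open>auto simp: dist_norm intro!: continuous_intros cs cv less_imp_le simp del: mem_ball\<close>)
      then show ?case using T_diff[OF cs(1) cv(1) that, of n] e by (simp add: dist_norm)
    qed
  qed
  ultimately have "(\<lambda>n. s (Suc n) x) \<longlonglongrightarrow> v0 + T v x" if "x \<in> S" for x
    using that by (simp add: tendsto_add)
  then have fp: "v x = v0 + T v x" if "x \<in> S" for x
    using LIMSEQ_unique[OF LIMSEQ_Suc[OF s_lim[OF that]]] that by blast
  show ?thesis
    by (rule that[OF dv cv(2) _ _ fp, of "max (\<Sum>k. K * norm v0 * (1 / 2) ^ k) (\<Sum>k. norm v0 * (1 / 2) ^ k)"])
      (use nD nv in \<open>auto simp: le_max_iff_disj simp del: mem_ball\<close>)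
qed

section \<open>From the radial equation to the total system\<close>

lemma ray_derivative:
  assumes dv: "\<And>x. x \<in> S \<Longrightarrow> (v has_derivative blinfun_apply (D x)) (at x)"
    and x: "x \<in> S" and t: "0 \<le> t" "t \<le> 1"
  shows "((\<lambda>t. t *\<^sub>R A (t *\<^sub>R x) h (v (t *\<^sub>R x))) has_vector_derivative
      A (t *\<^sub>R x) h (v (t *\<^sub>R x)) + t *\<^sub>R (A' (t *\<^sub>R x) x h (v (t *\<^sub>R x)) + A (t *\<^sub>R x) h (D (t *\<^sub>R x) x))) (at t within {0..1})"
proof -
  have tx: "t *\<^sub>R x \<in> S" using scale_in_S[OF x t] .
  have l: "((\<lambda>t. t *\<^sub>R x) has_derivative (\<lambda>s. s *\<^sub>R x)) (at t)" by (auto intro!: derivative_eq_intros)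
  have "((\<lambda>t. t *\<^sub>R A (t *\<^sub>R x) h (v (t *\<^sub>R x))) has_derivative
      (\<lambda>s. t *\<^sub>R (A (t *\<^sub>R x) h (D (t *\<^sub>R x) (s *\<^sub>R x)) + (A (t *\<^sub>R x) 0 + A' (t *\<^sub>R x) (s *\<^sub>R x) h) (v (t *\<^sub>R x)))
        + s *\<^sub>R A (t *\<^sub>R x) h (v (t *\<^sub>R x)))) (at t)"
    by (rule has_derivative_scaleR[OF has_derivative_ident blinfun.FDERIV[OF blinfun.FDERIV[OF
        has_derivative_compose[OF l deriv_A[OF tx]] has_derivative_const] has_derivative_compose[OF l dv[OF tx]]]])
  moreover have "(\<lambda>s. t *\<^sub>R (A (t *\<^sub>R x) h (D (t *\<^sub>R x) (s *\<^sub>R x)) + (A (t *\<^sub>R x) 0 + A' (t *\<^sub>R x) (s *\<^sub>R x) h) (v (t *\<^sub>R x)))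
        + s *\<^sub>R A (t *\<^sub>R x) h (v (t *\<^sub>R x)))
     = (\<lambda>s. s *\<^sub>R (A (t *\<^sub>R x) h (v (t *\<^sub>R x)) + t *\<^sub>R (A' (t *\<^sub>R x) x h (v (t *\<^sub>R x)) + A (t *\<^sub>R x) h (D (t *\<^sub>R x) x))))"
    by (rule ext) (simp add: blinfun.scaleR_right blinfun.scaleR_left blinfun.zero_right algebra_simps)
  ultimately show ?thesis
    unfolding has_vector_derivative_def by (simp only: has_derivative_at_withinI)
qed

text \<open>Fundamental theorem of calculus for t A(tx) h v(tx); the factor t kills the lower
  boundary term. This puts A x h (v x) in the same integral form as the derivative of v in direction
  h.\<close>

lemma ray_integral:
  assumes dv: "\<And>x. x \<in> S \<Longrightarrow> (v has_derivative blinfun_apply (D x)) (at x)" and x: "x \<in> S"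
  shows "((\<lambda>t. A (t *\<^sub>R x) h (v (t *\<^sub>R x)) + t *\<^sub>R (A' (t *\<^sub>R x) x h (v (t *\<^sub>R x)) + A (t *\<^sub>R x) h (D (t *\<^sub>R x) x)))
    has_integral A x h (v x)) {0..1}"
proof -
  let ?f = "\<lambda>t. t *\<^sub>R A (t *\<^sub>R x) h (v (t *\<^sub>R x))"
  have "((\<lambda>t. A (t *\<^sub>R x) h (v (t *\<^sub>R x)) + t *\<^sub>R (A' (t *\<^sub>R x) x h (v (t *\<^sub>R x)) + A (t *\<^sub>R x) h (D (t *\<^sub>R x) x)))
    has_integral ?f 1 - ?f 0) {0..1}"
  proof (rule fundamental_theorem_of_calculus[where f = ?f])
    fix t :: real assume "t \<in> {0..1}"
    then show "(?f has_vector_derivative A (t *\<^sub>R x) h (v (t *\<^sub>R x)) + t *\<^sub>R (A' (t *\<^sub>R x) x h (v (t *\<^sub>R x)) + A (t *\<^sub>R x) h (D (t *\<^sub>R x) x)))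
      (at t within {0..1})" by (intro ray_derivative[OF dv x]) auto
  qed simp
  then show ?thesis by simp
qed

text \<open>The fixed point satisfies the equation along rays by construction. Its derivative in any
  other direction is obtained under the integral and compared with \<open>ray_integral\<close>; the
  two integrands differ by \<open>A'\<close> with its arguments exchanged, which is what flatness
  controls.\<close>

lemma flat_solution:
  assumes flat: "\<And>x X Y w. x \<in> S \<Longrightarrow> A' x X Y w + A x Y (A x X w) = A' x Y X w + A x X (A x Y w)"
  obtains v where "v 0 = v0" "\<And>x. x \<in> S \<Longrightarrow> (v has_derivative (\<lambda>X. A x X (v x))) (at x)"
proof -
  obtain v D C where dv: "\<And>x. x \<in> S \<Longrightarrow> (v has_derivative blinfun_apply (D x)) (at x)"
    and cD: "continuous_on S D" and bD: "\<And>x. x \<in> S \<Longrightarrow> norm (D x) \<le> C"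
    and bv: "\<And>x. x \<in> S \<Longrightarrow> norm (v x) \<le> C" and fp: "\<And>x. x \<in> S \<Longrightarrow> v x = v0 + T v x"
    using fixed_point by blast
  have cv: "continuous_on S v"
    using dv by (meson continuous_at_imp_continuous_on has_derivative_continuous)
  have int: "((\<lambda>t. T'_integrand v D x t h) has_integral D x h) {0..1}" if x: "x \<in> S" for x h
  proof -
    have "((\<lambda>y. v0 + T v y) has_derivative (\<lambda>h. 0 + T' v D x h)) (at x)"
      by (rule has_derivative_add[OF has_derivative_const T_has_derivative[OF dv cD x]])
    then have "(v has_derivative blinfun_apply (T' v D x)) (at x)"
      using has_derivative_cong_open[OF open_ball x fp] by simp
    then have "D x h = T' v D x h" using has_derivative_unique[OF dv[OF x]] by metis
    moreover have "(\<lambda>t. T'_integrand v D x t h) integrable_on {0..1}"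
    proof (rule integrable_continuous_interval)
      have "continuous_on {0..1} (\<lambda>t. Blinfun (T'_integrand v D x t) h)"
        by (intro continuous_intros continuous_on_ray[OF x continuous_on_T'_integrand[OF cv cD]])
      then show "continuous_on {0..1} (\<lambda>t. T'_integrand v D x t h)" by (simp add: T'_integrand_apply)
    qed
    ultimately show ?thesis using T'_apply[OF cv cD x] by (simp add: has_integral_integral)
  qed
  \<comment> \<open>For h = x the integrand of the derivative and that of
    \<open>ray_integral\<close> coincide term by term.\<close>
  have radial: "D x x = A x x (v x)" if x: "x \<in> S" for x
  proof (rule has_integral_unique[OF int[OF x]])
    show "((\<lambda>t. T'_integrand v D x t x) has_integral A x x (v x)) {0..1}"
      using ray_integral[OF dv x, of x] by (simp add: T'_integrand_def algebra_simps)
  qed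
  \<comment> \<open>By flatness the defect of \<open>dv = A v\<close> solves the homogeneous radial equation, hence vanishes.\<close>
  define w where "w h x = D x h - A x h (v x)" for h x
  have cw: "continuous_on S (w h)" for h
    unfolding w_def[abs_def] by (intro continuous_intros cD cv cont_A)
  have iw: "((\<lambda>t. t *\<^sub>R A (t *\<^sub>R x) x (w h (t *\<^sub>R x))) has_integral w h x) {0..1}" if x: "x \<in> S" for x h
  proof -
    have "((\<lambda>t. T'_integrand v D x t h - (A (t *\<^sub>R x) h (v (t *\<^sub>R x)) + t *\<^sub>R (A' (t *\<^sub>R x) x h (v (t *\<^sub>R x)) + A (t *\<^sub>R x) h (D (t *\<^sub>R x) x))))
      has_integral w h x) {0..1}"
      unfolding w_def by (rule has_integral_diff[OF int[OF x] ray_integral[OF dv x]])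
    moreover have "T'_integrand v D x t h - (A (t *\<^sub>R x) h (v (t *\<^sub>R x)) + t *\<^sub>R (A' (t *\<^sub>R x) x h (v (t *\<^sub>R x)) + A (t *\<^sub>R x) h (D (t *\<^sub>R x) x)))
      = t *\<^sub>R A (t *\<^sub>R x) x (w h (t *\<^sub>R x))" if t: "t \<in> {0..1}" for t
    proof -
      let ?y = "t *\<^sub>R x"
      have y: "?y \<in> S" using scale_in_S[OF x] t by simp
      \<comment> \<open>The radial equation at tx concerns the direction tx, so it comes with a
        factor t, which cannot be cancelled at t = 0 and is kept throughout.\<close>
      have 1: "t *\<^sub>R D ?y x = t *\<^sub>R A ?y x (v ?y)"
        using radial[OF y] by (simp add: blinfun.scaleR_right blinfun.scaleR_left)
      have "t *\<^sub>R A ?y h (D ?y x) = A ?y h (t *\<^sub>R D ?y x)" by (simp add: blinfun.scaleR_right)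
      also have "\<dots> = t *\<^sub>R A ?y h (A ?y x (v ?y))" unfolding 1 by (simp add: blinfun.scaleR_right)
      finally have 2: "t *\<^sub>R A ?y h (D ?y x) = t *\<^sub>R A ?y h (A ?y x (v ?y))" .
      have 3: "t *\<^sub>R A' ?y h x (v ?y) + t *\<^sub>R A ?y x (A ?y h (v ?y)) = t *\<^sub>R A' ?y x h (v ?y) + t *\<^sub>R A ?y h (A ?y x (v ?y))"
        using arg_cong[OF flat[OF y, of h x "v ?y"], of "\<lambda>z. t *\<^sub>R z"] by (simp only: scaleR_add_right)
      show ?thesis
        using 2 3 by (auto simp: T'_integrand_def w_def blinfun.diff_right algebra_simps)
    qed
    ultimately show ?thesis by (rule has_integral_eq[rotated])
  qed
  \<comment> \<open>Each substitution of the homogeneous equation \<open>iw\<close> into itself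
    gains another factor 1/4.\<close>
  have bw: "norm (w h x) \<le> (C * norm h + a * norm h * C) * (1 / 4) ^ n" if "x \<in> S" for x h n
    using that
  proof (induction n arbitrary: x)
    case 0
    have "norm (D x h) \<le> C * norm h"
      using norm_blinfun[of "D x" h] mult_right_mono[OF bD[OF 0], of "norm h"] by simp
    moreover have "norm (A x h (v x)) \<le> a * norm h * C"
      using norm_A[OF 0, of h "v x"] mult_left_mono[OF bv[OF 0], of "a * norm h"] a_nonneg by simp
    ultimately show ?case unfolding w_def using norm_triangle_ineq4[of "D x h" "A x h (v x)"] by simp
  next
    case (Suc n)
    let ?m = "(C * norm h + a * norm h * C) * (1 / 4) ^ n"
    have "norm (t *\<^sub>R A (t *\<^sub>R x) x (w h (t *\<^sub>R x))) \<le> ?m / 4" if t: "t \<in> {0..1}" for t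
    proof -
      have "norm (t *\<^sub>R A (t *\<^sub>R x) x (w h (t *\<^sub>R x))) \<le> norm (A (t *\<^sub>R x) x (w h (t *\<^sub>R x)))"
        using t by (simp add: mult_left_le_one_le)
      also have "\<dots> \<le> ?m / 4" using t scale_in_S[OF Suc.prems] by (intro norm_A_radial Suc) auto
      finally show ?thesis .
    qed
    then have "norm (integral {0..1} (\<lambda>t. t *\<^sub>R A (t *\<^sub>R x) x (w h (t *\<^sub>R x)))) \<le> ?m / 4 * (1 - 0)"
      by (intro integral_bound continuous_intros continuous_on_T_integrand cw Suc.prems) auto
    then show ?case using integral_unique[OF iw[OF Suc.prems]] by simp
  qed
  have "w h x = 0" if "x \<in> S" for h x
  proof -
    have "(\<lambda>n. (C * norm h + a * norm h * C) * (1 / 4) ^ n) \<longlonglongrightarrow> (C * norm h + a * norm h * C) * 0"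
      by (intro tendsto_mult_left LIMSEQ_power_zero) simp
    then have "norm (w h x) \<le> 0"
      by (intro LIMSEQ_le_const) (auto intro!: bw that simp del: mem_ball)
    then show ?thesis by simp
  qed
  then have "blinfun_apply (D x) = (\<lambda>X. A x X (v x))" if "x \<in> S" for x
    using that by (auto simp: w_def fun_eq_iff simp del: mem_ball)
  moreover have "v 0 = v0" using fp[of 0] r_pos by (simp add: T_def blinfun.zero_right)
  ultimately show ?thesis using that dv by metis
qed

end

text \<open>The Frobenius theorem for linear systems; \<open>flat\<close> is the vanishing curvature
  of d - A on constant vector fields. It reduces to \<open>radial_system\<close> by moving x0 to the
  origin and shrinking the ball.\<close>

proposition total_linear_system_local_solution:
  fixes A :: "'a::euclidean_space \<Rightarrow> 'a \<Rightarrow>\<^sub>L 'b::euclidean_space \<Rightarrow>\<^sub>L 'b"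
  assumes sm: "smooth_on U A" and x0: "x0 \<in> U"
    and flat: "\<And>x X Y w. x \<in> U \<Longrightarrow>
      dir_deriv X A x Y w + A x Y (A x X w) = dir_deriv Y A x X w + A x X (A x Y w)"
  obtains r v where "0 < r" "ball x0 r \<subseteq> U" "v x0 = v0"
    "\<And>x. x \<in> ball x0 r \<Longrightarrow> (v has_derivative (\<lambda>X. A x X (v x))) (at x)"
proof -
  have op: "open U" using smooth_on_open[OF sm] .
  define A' where "A' x = Blinfun (\<lambda>X. dir_deriv X A x)" for x
  have A'_apply: "A' x X = dir_deriv X A x" if "x \<in> U" for x X
    unfolding A'_def
    using bounded_linear_Blinfun_apply[OF has_derivative_bounded_linear[OF dir_deriv_works[OF smooth_on_differentiable[OF sm that]]]]
    by simp
  have smA': "smooth_on U A'"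
    by (rule smooth_on_blinfun[OF op]) (rule smooth_on_cong[OF smooth_on_dir_deriv[OF sm] A'_apply])
  have derA: "(A has_derivative blinfun_apply (A' x)) (at x)" if "x \<in> U" for x
    using dir_deriv_works[OF smooth_on_differentiable[OF sm that]] A'_apply[OF that] by presburger
  obtain r0 where r0: "r0 > 0" "cball x0 r0 \<subseteq> U" using op x0 open_contains_cball by blast
  have "bounded (A ` cball x0 r0)" "bounded (A' ` cball x0 r0)"
    using r0 by (auto intro!: compact_imp_bounded compact_continuous_image
        continuous_on_subset[OF smooth_on_continuous[OF sm]] continuous_on_subset[OF smooth_on_continuous[OF smA']])
  then obtain a a' where a: "\<And>x. x \<in> cball x0 r0 \<Longrightarrow> norm (A x) \<le> a" "\<And>x. x \<in> cball x0 r0 \<Longrightarrow> norm (A' x) \<le> a'"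
    unfolding bounded_iff by blast
  have a0: "0 \<le> a" using order_trans[OF norm_ge_zero a(1)[of x0]] r0 by simp
  \<comment> \<open>Makes a r \<le> 1/4; the summand 1 covers a = 0.\<close>
  define r where "r = min r0 (1 / (4 * (a + 1)))"
  have r: "0 < r" "r \<le> r0" using r0 a0 by (auto simp: r_def)
  have ar: "a * r \<le> 1 / 4"
  proof -
    have "a * r \<le> a * (1 / (4 * (a + 1)))" using a0 by (intro mult_left_mono) (auto simp: r_def)
    also have "\<dots> \<le> 1 / 4" using a0 by (simp add: field_simps)
    finally show ?thesis .
  qed
  have in_c: "x0 + y \<in> cball x0 r0" if "y \<in> ball 0 r" for y using that r by (simp add: dist_norm)
  have in_U: "x0 + y \<in> U" if "y \<in> ball 0 r" for y using in_c[OF that] r0 by blast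
  have sh: "((+) x0 has_derivative (\<lambda>h. h)) (at y)" for y
    by (auto intro!: derivative_eq_intros)
  interpret radial_system "\<lambda>y. A (x0 + y)" "\<lambda>y. A' (x0 + y)" r a a'
  proof
    show "((\<lambda>y. A (x0 + y)) has_derivative blinfun_apply (A' (x0 + y))) (at y)" if "y \<in> ball 0 r" for y
      using has_derivative_compose[OF sh derA[OF in_U[OF that]]] by simp
    show "continuous_on (ball 0 r) (\<lambda>y. A' (x0 + y))"
    proof (rule continuous_on_compose2[OF smooth_on_continuous[OF smA']])
      show "(+) x0 ` ball 0 r \<subseteq> U" using in_U by blast
    qed (intro continuous_intros)
  qed (use r a in_c ar in \<open>auto simp del: mem_ball mem_cball\<close>)
  obtain u where u: "u 0 = v0" "\<And>y. y \<in> ball 0 r \<Longrightarrow> (u has_derivative (\<lambda>X. A (x0 + y) X (u y))) (at y)"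
    by (rule flat_solution[of v0]) (use flat[OF in_U] A'_apply[OF in_U] in \<open>auto simp del: mem_ball\<close>)
  show ?thesis
  proof (rule that[of r "\<lambda>x. u (x - x0)"])
    show "((\<lambda>x. u (x - x0)) has_derivative (\<lambda>X. A x X (u (x - x0)))) (at x)" if "x \<in> ball x0 r" for x
    proof -
      have "x - x0 \<in> ball 0 r" using that by (simp add: dist_norm norm_minus_commute)
      moreover have "((\<lambda>x. x - x0) has_derivative (\<lambda>h. h)) (at x)" by (auto intro!: derivative_eq_intros)
      ultimately show ?thesis using has_derivative_compose[OF _ u(2)] by fastforce
    qed
    show "ball x0 r \<subseteq> U"
    proof
      fix x assume "x \<in> ball x0 r"
      then have "x - x0 \<in> ball 0 r" by (simp add: dist_norm norm_minus_commute)
      from in_U[OF this] show "x \<in> U" by simp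
    qed
  qed (use u(1) r(1) in simp_all)
qed

section \<open>Projections in Lorentz space\<close>

interpretation lor: bounded_bilinear "lor :: 'k::finite mink \<Rightarrow> 'k mink \<Rightarrow> real"
proof -
  \<comment> \<open>\<open>lor\<close> is the Euclidean product after reversing time in the second
    argument.\<close>
  have "bounded_linear (\<lambda>w::'k mink. (fst w, - snd w))"
    by (intro bounded_linear_Pair bounded_linear_fst bounded_linear_minus bounded_linear_snd)
  from bounded_bilinear.comp[OF bounded_bilinear_inner bounded_linear_ident this]
  show "bounded_bilinear (lor :: 'k mink \<Rightarrow> 'k mink \<Rightarrow> real)"
    by (simp add: lor_def[abs_def] inner_prod_def)
qed

lemmas lor_simps = lor.add_left lor.add_right lor.diff_left lor.diff_right lor.minus_left lor.minus_right
  lor.scaleR_left lor.scaleR_right lor.zero_left lor.zero_right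

lemmas smooth_on_lor = smooth_on_bilinear[OF lor.bounded_bilinear_axioms]

lemma lor_commute: "lor v w = lor w v"
  by (simp add: lor_def inner_commute)

lemma lor_nondegenerate: "(\<And>w. lor v w = 0) \<Longrightarrow> v = 0"
proof -
  assume *: "\<And>w. lor v w = 0"
  \<comment> \<open>Tested against v with reversed time, \<open>lor\<close> becomes the Euclidean
    square of v.\<close>
  have "fst v \<bullet> fst v + snd v * snd v = 0" using *[of "(fst v, - snd v)"] by (simp add: lor_def)
  then have "fst v \<bullet> fst v = 0 \<and> snd v * snd v = 0"
    by (simp add: add_nonneg_eq_0_iff)
  then show "v = 0" by (simp add: prod_eq_iff)
qed

text \<open>Subtracting a multiple of s removes the time component of v without changing
  \<open>lor v v\<close>, since s is null and orthogonal to v. What is left is a Euclidean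
  square.\<close>

lemma lor_null_perp:
  assumes s: "lor s s = 0" "snd s > 0" and v: "lor v s = 0"
  shows "0 \<le> lor v v" "lor v v = 0 \<Longrightarrow> v \<in> span {s}"
proof -
  define c where "c = snd v / snd s"
  define b where "b = fst (v - c *\<^sub>R s)"
  have sn: "snd (v - c *\<^sub>R s) = 0" using s by (simp add: c_def)
  have "lor (v - c *\<^sub>R s) (v - c *\<^sub>R s) = lor v v"
    using s v lor_commute[of s v] by (simp add: lor_simps)
  then have eq: "lor v v = b \<bullet> b" using sn by (simp add: lor_def b_def)
  then show "0 \<le> lor v v" by simp
  assume "lor v v = 0"
  then have "b = 0" using eq by simp
  then have "v = c *\<^sub>R s" using sn by (simp add: b_def prod_eq_iff)
  then show "v \<in> span {s}" by (simp add: span_base span_scale)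
qed

lemma perpD: "v \<in> perp W \<Longrightarrow> w \<in> W \<Longrightarrow> lor v w = 0" "v \<in> perp W \<Longrightarrow> w \<in> W \<Longrightarrow> lor w v = 0"
  using lor_commute[of w v] by (simp_all add: perp_def)

lemma subspace_perp: "subspace (perp W)"
  unfolding subspace_def perp_def by (simp add: lor_simps)

section \<open>Nondegenerate subspaces and their projections\<close>

definition nondegenerate :: "'k::finite mink set \<Rightarrow> bool" where
  "nondegenerate W \<longleftrightarrow> subspace W \<and> (\<forall>v\<in>W. (\<forall>w\<in>W. lor v w = 0) \<longrightarrow> v = 0)"

lemma has_signature_nondegenerate:
  assumes "has_signature W p q"
  shows "nondegenerate W"
proof -
  obtain P N where PN: "subspace P" "subspace N" "W = {v + w | v w. v \<in> P \<and> w \<in> N}"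
    "\<forall>v\<in>P. v \<noteq> 0 \<longrightarrow> lor v v > 0" "\<forall>w\<in>N. w \<noteq> 0 \<longrightarrow> lor w w < 0" "\<forall>v\<in>P. \<forall>w\<in>N. lor v w = 0"
    using assms unfolding has_signature_def by (elim exE conjE) (rule that)
  have "subspace W" unfolding PN(3) by (rule subspace_sums[OF PN(1,2)])
  moreover have "v = 0" if v: "v \<in> W" "\<forall>w\<in>W. lor v w = 0" for v
  proof -
    obtain a b where ab: "v = a + b" "a \<in> P" "b \<in> N" using v(1) PN(3) by blast
    have "a + 0 \<in> W" "0 + b \<in> W"
      using ab subspace_0[OF PN(1)] subspace_0[OF PN(2)] unfolding PN(3) by blast+
    then have "lor v a = 0" "lor v b = 0" using v(2) by auto
    moreover have "lor a b = 0" "lor b a = 0" using PN(6) ab lor_commute[of b a] by auto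
    ultimately have "lor a a = 0" "lor b b = 0" by (simp_all add: ab(1) lor.add_left)
    then have "a = 0" "b = 0" using PN(4,5) ab by force+
    then show ?thesis using ab by simp
  qed
  ultimately show ?thesis unfolding nondegenerate_def by blast
qed

lemma lproj_eqI:
  assumes W: "nondegenerate W" and w: "w \<in> W" "v - w \<in> perp W"
  shows "lproj W v = w"
  unfolding lproj_def
proof (rule the_equality)
  show "w \<in> W \<and> v - w \<in> perp W" using w by simp
  fix z assume z: "z \<in> W \<and> v - z \<in> perp W"
  have sW: "subspace W" using W unfolding nondegenerate_def by blast
  have "z - w \<in> W" by (rule subspace_diff[OF sW]) (use z w in auto)
  moreover have "(v - w) - (v - z) \<in> perp W" by (rule subspace_diff[OF subspace_perp]) (use z w in auto)
  ultimately have "z - w = 0" using W unfolding nondegenerate_def perp_def by auto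
  then show "z = w" by simp
qed

lemma matrix_inv_right_inverse:
  assumes "invertible (A :: real^'n^'n)"
  shows "A ** matrix_inv A = mat 1"
proof -
  have "\<exists>A'. A ** A' = mat 1 \<and> A' ** A = mat 1" using assms by (simp add: invertible_def)
  then show ?thesis unfolding matrix_inv_def by (rule someI2_ex) simp
qed

lemma matrix_inv_eqI:
  assumes "A ** B = mat 1"
  shows "matrix_inv (A :: real^'n^'n) = B"
proof -
  have BA: "B ** A = mat 1" using assms matrix_left_right_inverse by blast
  then have "A ** matrix_inv A = mat 1"
    using assms by (intro matrix_inv_right_inverse) (auto simp: invertible_def)
  then have "B ** (A ** matrix_inv A) = B" by (simp add: matrix_mul_rid)
  then show ?thesis by (simp add: matrix_mul_assoc BA matrix_mul_lid)
qed

text \<open>A kernel vector of the Gram matrix gives a combination of the frame orthogonal to W,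
  hence zero by nondegeneracy. Projecting thereby becomes a linear system to which Cramer's rule
  applies.\<close>

lemma frame_system:
  fixes s :: "'r::finite \<Rightarrow> 'k::finite mink"
  assumes W: "nondegenerate W" and span: "W = span (range s)"
    and indep: "\<And>c. (\<Sum>i\<in>UNIV. c i *\<^sub>R s i) = 0 \<Longrightarrow> \<forall>i. c i = 0"
  shows "det (\<chi> i j. lor (s i) (s j)) \<noteq> 0"
    and "(\<chi> i j. lor (s i) (s j)) *v c = (\<chi> i. lor (s i) v) \<Longrightarrow> lproj W v = (\<Sum>i\<in>UNIV. c $ i *\<^sub>R s i)"
proof -
  let ?G = "(\<chi> i j. lor (s i) (s j)) :: real^'r^'r"
  have G: "(?G *v c) $ i = lor (s i) (\<Sum>j\<in>UNIV. c $ j *\<^sub>R s j)" for c i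
    by (simp add: matrix_vector_mult_def lor.sum_right lor.scaleR_right mult.commute)
  have inW: "(\<Sum>i\<in>UNIV. c i *\<^sub>R s i) \<in> W" for c
    unfolding span by (intro span_sum span_scale span_base) auto
  have perp: "z \<in> perp W" if "\<And>i. lor (s i) z = 0" for z
  proof -
    have "subspace {w. lor z w = 0}"
      unfolding subspace_def by (simp add: lor_simps)
    moreover have "range s \<subseteq> {w. lor z w = 0}" using that lor_commute[of z] by auto
    ultimately have "span (range s) \<subseteq> {w. lor z w = 0}" by (rule span_minimal[rotated])
    then have "lor z w = 0" if "w \<in> span (range s)" for w using that by blast
    then show ?thesis by (simp add: perp_def span)
  qed
  have "\<forall>c. ?G *v c = 0 \<longrightarrow> c = 0"
  proof (intro allI impI)
    fix c assume "?G *v c = 0"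
    then have "(\<Sum>j\<in>UNIV. c $ j *\<^sub>R s j) \<in> perp W" by (intro perp) (simp add: G[symmetric])
    then have "(\<Sum>j\<in>UNIV. c $ j *\<^sub>R s j) = 0" using W inW unfolding nondegenerate_def perp_def by blast
    from indep[OF this] show "c = 0" by (simp add: vec_eq_iff)
  qed
  then have "invertible ?G"
    using matrix_left_invertible_ker[of ?G] matrix_left_right_inverse[of _ ?G] unfolding invertible_def by blast
  then show "det ?G \<noteq> 0" by (simp add: invertible_det_nz)
  assume c: "?G *v c = (\<chi> i. lor (s i) v)"
  show "lproj W v = (\<Sum>i\<in>UNIV. c $ i *\<^sub>R s i)"
  proof (rule lproj_eqI[OF W inW perp])
    fix i show "lor (s i) (v - (\<Sum>i\<in>UNIV. c $ i *\<^sub>R s i)) = 0"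
      using c G[of c i] by (simp add: lor.diff_right vec_eq_iff)
  qed
qed

text \<open>As many spanning vectors as the dimension are independent. The bijection e moves the
  index set from numbers below r to a finite type, as matrices require.\<close>

lemma frame_independent:
  fixes s :: "nat \<Rightarrow> 'k::finite mink" and e :: "'r::finite \<Rightarrow> nat"
  assumes e: "bij_betw e UNIV {..<r}" and W: "W = span (s ` {..<r})" "dim W = r"
  shows "W = span (range (\<lambda>i. s (e i)))" "(\<Sum>i\<in>UNIV. c i *\<^sub>R s (e i)) = 0 \<Longrightarrow> \<forall>i. c i = 0"
proof -
  have re: "range (\<lambda>i. s (e i)) = s ` {..<r}" using e by (metis bij_betw_imp_surj_on image_image)
  then show "W = span (range (\<lambda>i. s (e i)))" using W by simp
  have "r = dim (s ` {..<r})" using W by simp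
  also have "\<dots> \<le> card (s ` {..<r})" by (rule dim_le_card') simp
  finally have "card (s ` {..<r}) = card {..<r}" using card_image_le[of "{..<r}" s] by simp
  then have inj: "inj_on s {..<r}" by (simp add: eq_card_imp_inj_on)
  have ind: "independent (s ` {..<r})"
    by (rule card_le_dim_spanning[of _ W]) (use W \<open>card _ = _\<close> in \<open>auto simp: span_superset\<close>)
  have inje: "inj (\<lambda>i. s (e i))"
    using comp_inj_on[of e UNIV s] inj e by (simp add: bij_betw_def o_def)
  assume z: "(\<Sum>i\<in>UNIV. c i *\<^sub>R s (e i)) = 0"
  define f where "f v = c (inv (\<lambda>i. s (e i)) v)" for v
  have "(\<Sum>v\<in>range (\<lambda>i. s (e i)). f v *\<^sub>R v) = (\<Sum>i\<in>UNIV. c i *\<^sub>R s (e i))"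
    by (subst sum.reindex[OF inje]) (simp add: f_def inv_f_f[OF inje])
  then have "f v = 0" if "v \<in> range (\<lambda>i. s (e i))" for v
    using independentD[OF ind, of "range (\<lambda>i. s (e i))" f v] that z re by simp
  then show "\<forall>i. c i = 0" unfolding f_def using inv_f_f[OF inje] by (metis rangeI)
qed

lemma lproj_nondegenerate:
  assumes W: "nondegenerate (W::'k::finite mink set)"
  shows "lproj W v \<in> W" "v - lproj W v \<in> perp W"
proof -
  have sW: "subspace W" using W by (simp add: nondegenerate_def)
  define Z where "Z = {a + b | a b. a \<in> W \<and> b \<in> perp W}"
  have sZ: "subspace Z" unfolding Z_def by (rule subspace_sums[OF sW subspace_perp])
  have "v \<in> Z"
  proof -
    let ?f = "\<lambda>x. \<lambda>w. lor x w"
    \<comment> \<open>Time reversal identifies \<open>perp W\<close> with the Euclidean complement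
      of the image of W under J, so the Euclidean dimension formula shows that W and
      \<open>perp W\<close> together span everything.\<close>
    define J where "J w = (fst w, - snd w)" for w :: "'k mink"
    have linJ: "linear J" unfolding J_def[abs_def]
      by (intro linearI) (auto simp: prod_eq_iff)
    have lJ: "lor x w = x \<bullet> J w" for x w by (simp add: lor_def J_def inner_prod_def)
    have "dim (J ` W) = dim W"
      by (rule dim_image_eq[OF linJ]) (auto simp: inj_on_def J_def prod_eq_iff)
    moreover have pe: "perp W = {y. \<forall>x\<in>J ` W. orthogonal x y}"
      by (auto simp: perp_def lJ orthogonal_def inner_commute)
    moreover have "dim {y \<in> UNIV. \<forall>x\<in>J ` W. orthogonal x y} + dim (J ` W) = dim (UNIV::'k mink set)"
      by (rule dim_subspace_orthogonal_to_vectors) (auto intro: linear_subspace_image[OF linJ sW])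
    ultimately have d: "dim (perp W) + dim W = dim (UNIV::'k mink set)" by simp
    have "W \<inter> perp W = {0}" using W subspace_0[OF sW] subspace_0[OF subspace_perp[of W]]
      unfolding nondegenerate_def perp_def by blast
    then have "dim Z = dim (UNIV::'k mink set)"
      using dim_sums_Int[OF sW subspace_perp[of W]] d by (simp add: Z_def)
    then have "Z = UNIV" using subspace_dim_equal[OF sZ subspace_UNIV] by simp
    then show ?thesis by simp
  qed
  then obtain a b where "v = a + b" "a \<in> W" "b \<in> perp W" unfolding Z_def by blast
  then have "lproj W v = a" "a \<in> W" "v - a \<in> perp W" using lproj_eqI[OF W, of a v] by auto
  then show "lproj W v \<in> W" "v - lproj W v \<in> perp W" by auto
qed

lemma lproj_id: "nondegenerate W \<Longrightarrow> v \<in> W \<Longrightarrow> lproj W v = v"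
  by (rule lproj_eqI) (auto simp: perp_def lor.zero_left)

lemma linear_lproj:
  assumes W: "nondegenerate (W::'k::finite mink set)"
  shows "linear (lproj W)"
proof (rule linearI)
  have sW: "subspace W" using W by (simp add: nondegenerate_def)
  note p = lproj_nondegenerate[OF W]
  show "lproj W (u + v) = lproj W u + lproj W v" for u v
  proof (rule lproj_eqI[OF W subspace_add[OF sW p(1) p(1)]])
    have "(u - lproj W u) + (v - lproj W v) \<in> perp W" by (rule subspace_add[OF subspace_perp p(2) p(2)])
    then show "u + v - (lproj W u + lproj W v) \<in> perp W" by (simp add: algebra_simps)
  qed
  show "lproj W (c *\<^sub>R v) = c *\<^sub>R lproj W v" for c v
  proof (rule lproj_eqI[OF W subspace_scale[OF sW p(1)]])
    show "c *\<^sub>R v - c *\<^sub>R lproj W v \<in> perp W"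
      using subspace_scale[OF subspace_perp p(2), of c v] by (simp add: scaleR_diff_right)
  qed
qed

lemma lproj_self_adjoint:
  assumes W: "nondegenerate (W::'k::finite mink set)"
  shows "lor (lproj W u) v = lor u (lproj W v)"
proof -
  note p = lproj_nondegenerate[OF W]
  have "lor (lproj W u) (v - lproj W v) = 0" by (rule perpD(2)[OF p(2) p(1)])
  moreover have "lor (u - lproj W u) (lproj W v) = 0" by (rule perpD(1)[OF p(2) p(1)])
  ultimately show ?thesis by (simp add: lor_simps)
qed

lemma lproj_perp:
  assumes W: "nondegenerate (W::'k::finite mink set)"
  shows "lproj (perp W) v = v - lproj W v"
proof (rule lproj_eqI)
  note p = lproj_nondegenerate[OF W]
  show "v - lproj W v \<in> perp W" by (rule p)
  show "v - (v - lproj W v) \<in> perp (perp W)"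
    using perpD(2)[OF _ p(1)[of v]] by (simp add: perp_def)
  have "z = 0" if z: "z \<in> perp W" "\<forall>w\<in>perp W. lor z w = 0" for z
  proof (rule lor_nondegenerate)
    fix w
    have "lor z (lproj W w) = 0" "lor z (w - lproj W w) = 0" using z p unfolding perp_def by blast+
    then show "lor z w = 0" by (simp add: lor.diff_right)
  qed
  then show "nondegenerate (perp W)" unfolding nondegenerate_def using subspace_perp by blast
qed

text \<open>The rank is the cardinality of a type, so that the Gram matrix of a local frame can be
  formed; the coefficients of the projection are then smooth by Cramer's rule.\<close>

lemma smooth_lproj:
  fixes F :: "real^'m::finite \<Rightarrow> 'k::finite mink set"
  assumes sb: "smooth_subbundle CARD('r::finite) U F" and op: "open U"
    and nd: "\<And>x. x \<in> U \<Longrightarrow> nondegenerate (F x)"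
  shows "smooth_on U (\<lambda>x. lproj (F x) v)"
proof (rule smooth_on_local[OF op])
  fix x assume x: "x \<in> U"
  obtain W s where Ws: "open W \<and> x \<in> W \<and> W \<subseteq> U \<and> (\<forall>i<CARD('r). smooth_on W (s i)) \<and>
      (\<forall>y\<in>W. F y = span ((\<lambda>i::nat. s i y) ` {..<CARD('r)}) \<and> dim (F y) = CARD('r))"
    using bspec[OF sb[unfolded smooth_subbundle_def] x] by (elim exE) (rule that)
  then have W: "open W" "x \<in> W" "W \<subseteq> U" and s: "\<And>i. i < CARD('r) \<Longrightarrow> smooth_on W (s i)"
    and F: "\<And>y. y \<in> W \<Longrightarrow> F y = span ((\<lambda>i::nat. s i y) ` {..<CARD('r)}) \<and> dim (F y) = CARD('r)"
    by auto
  obtain e :: "'r \<Rightarrow> nat" where e: "bij_betw e UNIV {..<CARD('r)}"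
    using finite_same_card_bij[of "UNIV::'r set" "{..<CARD('r)}"] by auto
  have lt: "e i < CARD('r)" for i using e by (auto simp: bij_betw_def)
  define G where "G y = ((\<chi> i j. lor (s (e i) y) (s (e j) y)) :: real^'r^'r)" for y
  define bb where "bb y = ((\<chi> i. lor (s (e i) y) v) :: real^'r)" for y
  define c where "c y = matrix_inv (G y) *v bb y" for y
  have fr: "det (G y) \<noteq> 0" "G y *v c = bb y \<Longrightarrow> lproj (F y) v = (\<Sum>i\<in>UNIV. c $ i *\<^sub>R s (e i) y)"
    if y: "y \<in> W" for y c
  proof -
    define t where "t i = s i y" for i
    have "F y = span (t ` {..<CARD('r)})" "dim (F y) = CARD('r)" unfolding t_def using F[OF y] by blast+
    note fi = frame_independent[OF e this]
    have n: "nondegenerate (F y)" using nd y W by blast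
    have G': "G y = (\<chi> i j. lor (t (e i)) (t (e j)))" and b': "bb y = (\<chi> i. lor (t (e i)) v)"
      by (simp_all add: G_def bb_def t_def)
    show "det (G y) \<noteq> 0" unfolding G' by (rule frame_system(1)[OF n fi])
    show "lproj (F y) v = (\<Sum>i\<in>UNIV. c $ i *\<^sub>R s (e i) y)" if "G y *v c = bb y"
      using frame_system(2)[OF n fi that[unfolded G' b']] by (simp add: t_def)
  qed
  have Gc: "G y *v c y = bb y" if "y \<in> W" for y
  proof -
    have "invertible (G y)" using fr(1)[OF that] invertible_det_nz by blast
    then show ?thesis unfolding c_def by (simp add: matrix_vector_mul_assoc matrix_inv_right_inverse)
  qed
  have smc: "smooth_on W (\<lambda>y. c y $ k)" for k
  proof (rule smooth_on_linear_system[OF W(1) _ _ fr(1) Gc])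
    show "smooth_on W (\<lambda>x. G x $ i $ j)" for i j
      unfolding G_def by (simp add: smooth_on_lor[OF s[OF lt] s[OF lt]])
    show "smooth_on W (\<lambda>x. bb x $ i)" for i
      unfolding bb_def by (simp add: smooth_on_lor[OF s[OF lt] smooth_on_const[OF W(1)]])
  qed
  have "smooth_on W (\<lambda>y. \<Sum>i\<in>UNIV. c y $ i *\<^sub>R s (e i) y)"
    by (intro smooth_on_sum smooth_on_scaleR smc s lt W)
  then have "smooth_on W (\<lambda>x. lproj (F x) v)"
    by (rule smooth_on_cong) (rule fr(2)[OF _ Gc])
  then show "\<exists>W. open W \<and> x \<in> W \<and> W \<subseteq> U \<and> smooth_on W (\<lambda>x. lproj (F x) v)" using W by blast
qed

section \<open>Bundles as fields of projections\<close>

text \<open>A bundle is represented by its projection as an operator-valued map. Differentiating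
  sections then reduces to the Leibniz rule and the tensor dP, without local frames.\<close>

locale projection_field =
  fixes U :: "(real^'m::finite) set" and P :: "real^'m \<Rightarrow> 'k::finite mink \<Rightarrow>\<^sub>L 'k mink"
  assumes smooth_P: "smooth_on U P"
    and P_idem: "x \<in> U \<Longrightarrow> P x (P x v) = P x v"
    and P_adj: "x \<in> U \<Longrightarrow> lor (P x u) v = lor u (P x v)"
begin

lemma open_U: "open U" by (rule smooth_on_open[OF smooth_P])

lemma P_differentiable: "x \<in> U \<Longrightarrow> P differentiable (at x)"
  by (rule smooth_on_differentiable[OF smooth_P])

lemma dir_deriv_P_section:
  "x \<in> U \<Longrightarrow> s differentiable (at x) \<Longrightarrow>
   dir_deriv X (\<lambda>y. P y (s y)) x = P x (dir_deriv X s x) + dir_deriv X P x (s x)"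
  by (rule dir_deriv_bilinear[OF bounded_bilinear_blinfun_apply P_differentiable])

lemma dir_deriv_P_const: "x \<in> U \<Longrightarrow> dir_deriv X (\<lambda>y. P y v) x = dir_deriv X P x v"
  using dir_deriv_P_section[of x "\<lambda>_. v" X] by (simp add: blinfun.zero_right)

lemma smooth_P_section: "smooth_on U s \<Longrightarrow> smooth_on U (\<lambda>y. P y (s y))"
  by (rule smooth_on_blinfun_apply[OF smooth_P])

lemma dP_linear: "x \<in> U \<Longrightarrow> linear (\<lambda>X. dir_deriv X P x)"
  by (rule dir_deriv_linear[OF P_differentiable])

text \<open>Evaluated at a vector v because \<open>dir_deriv_commute\<close> asks for values in a
  Euclidean space.\<close>

lemma ddP_commute:
  assumes x: "x \<in> U"
  shows "dir_deriv X (dir_deriv Y P) x v = dir_deriv Y (dir_deriv X P) x v"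
proof -
  have sm: "smooth_on U (\<lambda>y. P y v)" by (rule smooth_P_section[OF smooth_on_const[OF open_U]])
  have "dir_deriv X (dir_deriv Y P) x v = dir_deriv X (dir_deriv Y (\<lambda>y. P y v)) x" for X Y
  proof -
    have "dir_deriv X (dir_deriv Y (\<lambda>y. P y v)) x = dir_deriv X (\<lambda>y. dir_deriv Y P y v) x"
      by (rule dir_deriv_cong_open[OF open_U x dir_deriv_P_const])
    also have "\<dots> = dir_deriv X (dir_deriv Y P) x v"
      by (rule dir_deriv_bounded_linear[OF blinfun.bounded_linear_left
            smooth_on_differentiable[OF smooth_on_dir_deriv[OF smooth_P] x]])
    finally show ?thesis by simp
  qed
  then show ?thesis using dir_deriv_commute[OF sm x] by metis
qed

end

locale nondegenerate_bundle = projection_field U P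
  for U :: "(real^'m::finite) set" and P :: "real^'m \<Rightarrow> 'k::finite mink \<Rightarrow>\<^sub>L 'k mink" +
  fixes F :: "real^'m \<Rightarrow> 'k mink set"
  assumes nondeg: "x \<in> U \<Longrightarrow> nondegenerate (F x)"
    and lproj_P: "x \<in> U \<Longrightarrow> lproj (F x) v = P x v"
begin

lemma P_in: "x \<in> U \<Longrightarrow> P x v \<in> F x"
  using lproj_nondegenerate(1)[OF nondeg] lproj_P by metis

lemma P_id: "x \<in> U \<Longrightarrow> v \<in> F x \<Longrightarrow> P x v = v"
  using lproj_id[OF nondeg] lproj_P by metis

lemma sub_conn_P:
  assumes x: "x \<in> U" and s: "s differentiable (at x)"
  shows "sub_conn F X s x = P x (P x (dir_deriv X s x) + dir_deriv X P x (s x))"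
proof -
  have "dir_deriv X (\<lambda>y. lproj (F y) (s y)) x = dir_deriv X (\<lambda>y. P y (s y)) x"
    by (rule dir_deriv_cong_open[OF open_U x lproj_P])
  then show ?thesis unfolding sub_conn_def by (simp add: lproj_P[OF x] dir_deriv_P_section[OF x s])
qed

text \<open>The projection onto the complement is 1 - P, and the derivatives of s cancel by P P = P;
  this is the tensoriality of \<open>N_form\<close>. The result (1 - 2P) dP equals dP (2P - 1)
  because dP interchanges the two bundles.\<close>

lemma N_form_P:
  assumes x: "x \<in> U" and s: "s differentiable (at x)"
  shows "N_form F X s x = dir_deriv X P x (s x) - 2 *\<^sub>R P x (dir_deriv X P x (s x))"
proof -
  have lp: "lproj (perp_bundle F y) v = v - P y v" if "y \<in> U" for y v
    unfolding perp_bundle_def using lproj_perp[OF nondeg[OF that]] lproj_P[OF that] by simp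
  have "dir_deriv X (\<lambda>y. lproj (perp_bundle F y) (s y)) x = dir_deriv X (\<lambda>y. s y - P y (s y)) x"
    by (rule dir_deriv_cong_open[OF open_U x lp])
  also have "\<dots> = dir_deriv X s x - (P x (dir_deriv X s x) + dir_deriv X P x (s x))"
    by (subst dir_deriv_diff[OF s differentiable_bilinear[OF bounded_bilinear_blinfun_apply P_differentiable[OF x] s]])
      (simp add: dir_deriv_P_section[OF x s])
  finally have "sub_conn (perp_bundle F) X s x = (dir_deriv X s x - (P x (dir_deriv X s x) + dir_deriv X P x (s x)))
     - P x (dir_deriv X s x - (P x (dir_deriv X s x) + dir_deriv X P x (s x)))"
    unfolding sub_conn_def by (simp add: lp[OF x])
  then show ?thesis
    unfolding N_form_def sub_conn_P[OF x s]
    by (simp add: P_idem[OF x] blinfun_simps algebra_simps scaleR_2)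
qed

lemma N_form_section:
  assumes x: "x \<in> U" and s: "s differentiable (at x)" and Ps: "\<And>y. y \<in> U \<Longrightarrow> P y (s y) = s y"
  shows "N_form F X s x = dir_deriv X s x - P x (dir_deriv X s x)"
proof -
  have "dir_deriv X (\<lambda>y. P y (s y)) x = dir_deriv X s x"
    by (rule dir_deriv_cong_open[OF open_U x Ps])
  then have 1: "dir_deriv X P x (s x) = dir_deriv X s x - P x (dir_deriv X s x)"
    using dir_deriv_P_section[OF x s, of X] by (simp add: algebra_simps)
  then have "P x (dir_deriv X P x (s x)) = 0" by (simp add: blinfun.diff_right P_idem[OF x])
  then show ?thesis unfolding N_form_P[OF x s] 1 by simp
qed

text \<open>The factor 1 - 2P in \<open>N_form_P\<close> is an involution. Applying it once more
  recovers dP from N, so a generator for N yields one for dP.\<close>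

lemma rank_one:
  assumes x: "x \<in> U" and rk: "N_rank F x = 1"
  shows "\<exists>\<omega> E. \<forall>X v. dir_deriv X P x v = \<omega> X *\<^sub>R blinfun_apply E v"
proof -
  let ?N = "\<lambda>X. N_endo F x X"
  have N: "?N X e = dir_deriv X P x e - 2 *\<^sub>R P x (dir_deriv X P x e)" for X e
  proof -
    have "bounded_linear (\<lambda>e. dir_deriv X P x e - 2 *\<^sub>R P x (dir_deriv X P x e))"
      by (intro bounded_linear_intros)
    then show ?thesis
      unfolding N_endo_def N_form_P[OF x differentiable_const] by (simp add: bounded_linear_Blinfun_apply)
  qed
  obtain B where B: "B \<subseteq> range ?N" "independent B" "range ?N \<subseteq> span B" "card B = 1"
    using real_vector.basis_exists[of "range ?N"] rk unfolding N_rank_def by metis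
  obtain E where E: "B = {E}" using B(4) card_1_singletonE by blast
  have "\<exists>c. ?N X = c *\<^sub>R E" for X
    using B(3) unfolding E span_singleton by blast
  then obtain \<omega> where \<omega>: "?N X = \<omega> X *\<^sub>R E" for X by metis
  define E' where "E' = Blinfun (\<lambda>v. E v - 2 *\<^sub>R P x (E v))"
  have E': "E' v = E v - 2 *\<^sub>R P x (E v)" for v
    unfolding E'_def by (subst bounded_linear_Blinfun_apply) (auto intro!: bounded_linear_intros)
  have "dir_deriv X P x v = \<omega> X *\<^sub>R E' v" for X v
  proof -
    have "dir_deriv X P x v = ?N X v - 2 *\<^sub>R P x (?N X v)"
      unfolding N by (simp add: blinfun_simps P_idem[OF x] scaleR_2 algebra_simps)
    also have "\<dots> = \<omega> X *\<^sub>R E' v"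
      unfolding \<omega> E' by (simp add: blinfun_simps scaleR_diff_right)
    finally show ?thesis .
  qed
  then show ?thesis by blast
qed

end

lemma projection_of_bundle:
  fixes F :: "real^'m::finite \<Rightarrow> 'k::finite mink set"
  assumes sb: "smooth_subbundle (CARD('m) + 2) U F" and op: "open U"
    and nd: "\<And>x. x \<in> U \<Longrightarrow> nondegenerate (F x)"
  shows "nondegenerate_bundle U (\<lambda>x. Blinfun (lproj (F x))) F"
proof
  have bl: "bounded_linear (lproj (F x))" if "x \<in> U" for x
    using linear_lproj[OF nd[OF that]] by (simp add: linear_conv_bounded_linear)
  have ap: "Blinfun (lproj (F x)) v = lproj (F x) v" if "x \<in> U" for x v
    using bounded_linear_Blinfun_apply[OF bl[OF that]] by simp
  show "lproj (F x) v = Blinfun (lproj (F x)) v" if "x \<in> U" for x v using ap[OF that] by simp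
  \<comment> \<open>\<open>'m option option\<close> is a type with CARD('m) + 2 elements and serves
    as index type for frames of F.\<close>
  have "smooth_subbundle CARD('m option option) U F" using sb by simp
  from smooth_on_cong[OF smooth_lproj[OF this op nd] ap]
  show "smooth_on U (\<lambda>x. Blinfun (lproj (F x)))" by (intro smooth_on_blinfun[OF op]) simp
  fix x assume x: "x \<in> U"
  show "nondegenerate (F x)" by (rule nd[OF x])
  show "Blinfun (lproj (F x)) (Blinfun (lproj (F x)) v) = Blinfun (lproj (F x)) v" for v
    unfolding ap[OF x] by (rule lproj_id[OF nd[OF x] lproj_nondegenerate(1)[OF nd[OF x]]])
  show "lor (Blinfun (lproj (F x)) u) v = lor u (Blinfun (lproj (F x)) v)" for u v
    unfolding ap[OF x] by (rule lproj_self_adjoint[OF nd[OF x]])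
qed

section \<open>Null immersions and rank one envelopes\<close>

text \<open>An injective endomorphism of a finite-dimensional space is onto. Unique existence is
  what gives the definite descriptions in \<open>levi_civita\<close> and \<open>shape_op\<close>
  their meaning.\<close>

lemma bilinear_functional_representation:
  fixes g :: "real^'m::finite \<Rightarrow> real^'m \<Rightarrow> real"
  assumes bg: "bilinear g" and nd: "\<And>X. (\<And>Y. g X Y = 0) \<Longrightarrow> X = 0" and f: "linear f"
  shows "\<exists>!Z. \<forall>W. g Z W = f W"
proof -
  define T where "T Z = (\<chi> i. g Z (axis i 1))" for Z
  have eqI: "h = k" if "linear h" "linear k" "\<And>i. h (axis i 1) = k (axis i 1)" for h k :: "real^'m \<Rightarrow> real"
    by (rule linear_eq_stdbasis[OF that(1,2)]) (use that(3) in \<open>auto simp: Basis_vec_def\<close>)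
  have lin: "linear (g Z)" for Z using bg by (simp add: bilinear_def)
  have linT: "linear T"
    unfolding T_def by (rule linearI) (simp_all add: vec_eq_iff bilinear_simps[OF bg])
  have "inj T"
  proof (subst linear_injective_0[OF linT], intro allI impI)
    fix Z assume "T Z = 0"
    then have "g Z (axis i 1) = 0" for i by (simp add: T_def vec_eq_iff)
    then have "g Z = (\<lambda>_. 0)" by (intro eqI lin) (simp_all add: linear_zero)
    then show "Z = 0" by (intro nd) simp
  qed
  then obtain Z where "T Z = (\<chi> i. f (axis i 1))"
    using linear_injective_imp_surjective[OF linT] by (metis surjD)
  then have "g Z (axis i 1) = f (axis i 1)" for i by (simp add: T_def vec_eq_iff)
  then have "g Z = f" by (rule eqI[OF lin f])
  moreover have "Z' = Z" if "g Z' = f" "g Z = f" for Z'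
  proof -
    have "g (Z' - Z) Y = 0" for Y using that by (simp add: bilinear_lsub[OF bg])
    from nd[OF this] show ?thesis by simp
  qed
  ultimately show ?thesis by (metis ext)
qed

locale null_immersion =
  fixes U :: "(real^'m::finite) set" and \<sigma> :: "real^'m \<Rightarrow> 'k::finite mink"
  assumes smooth_\<sigma>: "smooth_on U \<sigma>"
    and null: "x \<in> U \<Longrightarrow> lor (\<sigma> x) (\<sigma> x) = 0"
    and pos: "x \<in> U \<Longrightarrow> snd (\<sigma> x) > 0"
    and immersion: "x \<in> U \<Longrightarrow> dir_deriv X \<sigma> x \<in> span {\<sigma> x} \<Longrightarrow> X = 0"
begin

section \<open>Metric, Levi-Civita connection and Hessian of a null immersion\<close>

abbreviation "g \<equiv> induced_metric \<sigma>"
abbreviation "\<Gamma> \<equiv> levi_civita g"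
abbreviation "H \<equiv> hessian \<sigma>"

lemma open_U': "open U" by (rule smooth_on_open[OF smooth_\<sigma>])

lemma diff_\<sigma>: "x \<in> U \<Longrightarrow> \<sigma> differentiable (at x)"
  by (rule smooth_on_differentiable[OF smooth_\<sigma>])

lemma smooth_d\<sigma>: "smooth_on U (dir_deriv X \<sigma>)"
  by (rule smooth_on_dir_deriv[OF smooth_\<sigma>])

lemma diff_d\<sigma>: "x \<in> U \<Longrightarrow> dir_deriv X \<sigma> differentiable (at x)"
  by (rule smooth_on_differentiable[OF smooth_d\<sigma>])

lemma linear_d\<sigma>: "x \<in> U \<Longrightarrow> linear (\<lambda>X. dir_deriv X \<sigma> x)"
  by (rule dir_deriv_linear[OF diff_\<sigma>])

lemmas d\<sigma>_add = linear_add[OF linear_d\<sigma>]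
lemmas d\<sigma>_scale = linear_scale[OF linear_d\<sigma>]

lemma dd\<sigma>_commute: "x \<in> U \<Longrightarrow> dir_deriv X (dir_deriv Y \<sigma>) x = dir_deriv Y (dir_deriv X \<sigma>) x"
  by (rule dir_deriv_commute[OF smooth_\<sigma>])

lemma dir_deriv_lor:
  "a differentiable (at x) \<Longrightarrow> b differentiable (at x) \<Longrightarrow>
   dir_deriv X (\<lambda>y. lor (a y) (b y)) x = lor (a x) (dir_deriv X b x) + lor (dir_deriv X a x) (b x)"
  by (rule dir_deriv_bilinear[OF lor.bounded_bilinear_axioms])

lemma lor_d\<sigma>_\<sigma>: "x \<in> U \<Longrightarrow> lor (dir_deriv X \<sigma> x) (\<sigma> x) = 0"
proof -
  assume x: "x \<in> U"
  have "dir_deriv X (\<lambda>y. lor (\<sigma> y) (\<sigma> y)) x = dir_deriv X (\<lambda>_. 0) x"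
    by (rule dir_deriv_cong_open[OF open_U' x null])
  then show ?thesis
    using dir_deriv_lor[OF diff_\<sigma>[OF x] diff_\<sigma>[OF x], of X] lor_commute[of "\<sigma> x" "dir_deriv X \<sigma> x"] by simp
qed

lemma g_sym: "g x X Y = g x Y X"
  unfolding induced_metric_def by (rule lor_commute)

text \<open>The vectors d\<sigma> X are orthogonal to the null vector \<sigma>, so
  \<open>lor_null_perp\<close> makes their squares nonnegative, with zero only along \<sigma>, which
  the immersion condition excludes.\<close>

lemma g_pos: "x \<in> U \<Longrightarrow> X \<noteq> 0 \<Longrightarrow> g x X X > 0"
  using lor_null_perp[OF null pos lor_d\<sigma>_\<sigma>, of x X] immersion[of x X]
  unfolding induced_metric_def by fastforce

lemma bilinear_g: "x \<in> U \<Longrightarrow> bilinear (g x)"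
  unfolding bilinear_def induced_metric_def
  by (auto intro!: linearI simp: d\<sigma>_add d\<sigma>_scale lor_simps)

lemma g_nondegenerate: "x \<in> U \<Longrightarrow> (\<And>Y. g x X Y = 0) \<Longrightarrow> X = 0"
  using g_pos[of x X] by fastforce

lemma g_cancel: "x \<in> U \<Longrightarrow> (\<And>W. g x X W = g x Y W) \<Longrightarrow> X = Y"
  using g_nondegenerate[of x "X - Y"] bilinear_lsub[OF bilinear_g] by force

lemma smooth_g: "smooth_on U (\<lambda>x. g x X Y)"
  unfolding induced_metric_def by (rule smooth_on_lor[OF smooth_d\<sigma> smooth_d\<sigma>])

abbreviation "Gram x \<equiv> (\<chi> a b. g x (axis a 1) (axis b 1))"

lemma Gram_mult: "x \<in> U \<Longrightarrow> (Gram x *v c) $ i = g x (axis i 1) c"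
proof -
  assume x: "x \<in> U"
  have "g x (axis i 1) c = g x (axis i 1) (\<Sum>j\<in>UNIV. c $ j *\<^sub>R axis j 1)"
    using basis_expansion[of c] by (simp add: scalar_mult_eq_scaleR)
  also have "\<dots> = (\<Sum>j\<in>UNIV. c $ j *\<^sub>R g x (axis i 1) (axis j 1))"
    using bilinear_g[OF x] unfolding bilinear_def by (simp add: linear_sum linear_scale)
  finally show ?thesis by (simp add: matrix_vector_mult_def mult.commute)
qed

lemma linear_eq_axis:
  fixes h k :: "real^'m \<Rightarrow> 'b::real_vector"
  assumes "linear h" "linear k" "\<And>i. h (axis i 1) = k (axis i 1)"
  shows "h = k"
  by (rule linear_eq_stdbasis[OF assms(1,2)]) (use assms(3) in \<open>auto simp: Basis_vec_def\<close>)

lemma det_Gram: "x \<in> U \<Longrightarrow> det (Gram x) \<noteq> 0"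
proof -
  assume x: "x \<in> U"
  have "c = 0" if "Gram x *v c = 0" for c
  proof (rule g_nondegenerate[OF x])
    have "g x c (axis i 1) = 0" for i using Gram_mult[OF x, of c i] that by (simp add: g_sym)
    then have "g x c = (\<lambda>_. 0)"
      using bilinear_g[OF x] unfolding bilinear_def by (intro linear_eq_axis) (auto simp: linear_zero)
    then show "g x c Y = 0" for Y by simp
  qed
  then have "\<forall>c. Gram x *v c = 0 \<longrightarrow> c = 0" by blast
  then have "invertible (Gram x)"
    using matrix_left_invertible_ker[of "Gram x"] matrix_left_right_inverse[of _ "Gram x"] unfolding invertible_def by blast
  then show ?thesis by (simp add: invertible_det_nz)
qed

lemma smooth_on_g_solution:
  assumes "\<And>W. smooth_on U (\<lambda>x. f x W)" "\<And>x W. x \<in> U \<Longrightarrow> g x (Z x) W = f x W"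
  shows "smooth_on U Z"
proof (rule smooth_on_vec[OF open_U'])
  fix i show "smooth_on U (\<lambda>x. Z x $ i)"
  proof (rule smooth_on_linear_system[OF open_U', where A = Gram and b = "\<lambda>x. \<chi> j. f x (axis j 1)"])
    show "smooth_on U (\<lambda>x. Gram x $ i $ j)" for i j by (simp add: smooth_g)
    show "smooth_on U (\<lambda>x. (\<chi> j. f x (axis j 1)) $ i)" for i by (simp add: assms(1))
    show "x \<in> U \<Longrightarrow> det (Gram x) \<noteq> 0" for x by (rule det_Gram)
    show "Gram x *v Z x = (\<chi> j. f x (axis j 1))" if x: "x \<in> U" for x
      using Gram_mult[OF x, of "Z x"] assms(2)[OF x] by (simp add: vec_eq_iff g_sym[of x _ "Z x"])
  qed
qed

lemma g_representation:
  assumes "x \<in> U" "linear f"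
  shows "\<exists>!Z. \<forall>W. g x Z W = f W"
  by (rule bilinear_functional_representation[OF bilinear_g[OF assms(1)] g_nondegenerate[OF assms(1)] assms(2)])

text \<open>Expanding the Koszul formula by the Leibniz rule gives six terms, four of which cancel
  by symmetry of second derivatives. So the Levi-Civita connection is the tangential part of flat
  differentiation.\<close>

lemma \<Gamma>_eq:
  assumes x: "x \<in> U"
  shows "g x (\<Gamma> x X Y) W = lor (dir_deriv X (dir_deriv Y \<sigma>) x) (dir_deriv W \<sigma> x)"
proof -
  have koszul: "dir_deriv X (\<lambda>y. g y Y W) x + dir_deriv Y (\<lambda>y. g y X W) x - dir_deriv W (\<lambda>y. g y X Y) x
     = 2 * lor (dir_deriv X (dir_deriv Y \<sigma>) x) (dir_deriv W \<sigma> x)" for W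
    unfolding induced_metric_def dir_deriv_lor[OF diff_d\<sigma>[OF x] diff_d\<sigma>[OF x]]
      dd\<sigma>_commute[OF x, of W] dd\<sigma>_commute[OF x, of Y X]
    by (simp add: lor_commute)
  have lin: "linear (\<lambda>W. lor (dir_deriv X (dir_deriv Y \<sigma>) x) (dir_deriv W \<sigma> x))"
    using d\<sigma>_add[OF x] d\<sigma>_scale[OF x] by (intro linearI) (auto simp: lor_simps)
  have "\<exists>!Z. \<forall>W. 2 * g x Z W = dir_deriv X (\<lambda>y. g y Y W) x + dir_deriv Y (\<lambda>y. g y X W) x - dir_deriv W (\<lambda>y. g y X Y) x"
    unfolding koszul using g_representation[OF x lin] by simp
  from theI'[OF this] show ?thesis unfolding levi_civita_def koszul by simp
qed

lemma \<Gamma>_sym: "x \<in> U \<Longrightarrow> \<Gamma> x X Y = \<Gamma> x Y X"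
proof (rule g_cancel)
  assume x: "x \<in> U"
  show "g x (\<Gamma> x X Y) W = g x (\<Gamma> x Y X) W" for W
    unfolding \<Gamma>_eq[OF x] dd\<sigma>_commute[OF x, of X Y] ..
qed

lemma linear_\<Gamma>: "x \<in> U \<Longrightarrow> linear (\<lambda>X. \<Gamma> x X Y)"
proof (rule linearI)
  assume x: "x \<in> U"
  have l: "linear (\<lambda>X. dir_deriv X (dir_deriv Y \<sigma>) x)" by (rule dir_deriv_linear[OF diff_d\<sigma>[OF x]])
  show "\<Gamma> x (X + Z) Y = \<Gamma> x X Y + \<Gamma> x Z Y" for X Z
    by (rule g_cancel[OF x]) (simp add: \<Gamma>_eq[OF x] bilinear_ladd[OF bilinear_g[OF x]] linear_add[OF l] lor.add_left)
  show "\<Gamma> x (c *\<^sub>R X) Y = c *\<^sub>R \<Gamma> x X Y" for c X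
    by (rule g_cancel[OF x]) (simp add: \<Gamma>_eq[OF x] bilinear_lmul[OF bilinear_g[OF x]] linear_scale[OF l] lor.scaleR_left)
qed

lemma smooth_\<Gamma>: "smooth_on U (\<lambda>x. \<Gamma> x X Y)"
  by (rule smooth_on_g_solution[OF _ \<Gamma>_eq])
    (rule smooth_on_lor[OF smooth_on_dir_deriv[OF smooth_d\<sigma>] smooth_d\<sigma>])

text \<open>The differential as an operator-valued map, so that d\<sigma> along a variable vector
  field can be differentiated by the Leibniz rule.\<close>

definition D\<sigma> :: "real^'m \<Rightarrow> (real^'m) \<Rightarrow>\<^sub>L 'k mink" where
  "D\<sigma> x = Blinfun (\<lambda>X. dir_deriv X \<sigma> x)"

lemma D\<sigma>_apply: "x \<in> U \<Longrightarrow> D\<sigma> x X = dir_deriv X \<sigma> x"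
  unfolding D\<sigma>_def using linear_d\<sigma> by (simp add: bounded_linear_Blinfun_apply linear_conv_bounded_linear)

lemma smooth_D\<sigma>: "smooth_on U D\<sigma>"
  by (rule smooth_on_blinfun[OF open_U'], rule smooth_on_cong[OF smooth_d\<sigma> D\<sigma>_apply])

lemma smooth_d\<sigma>_field: "smooth_on U v \<Longrightarrow> smooth_on U (\<lambda>y. dir_deriv (v y) \<sigma> y)"
  by (rule smooth_on_cong[OF smooth_on_blinfun_apply[OF smooth_D\<sigma>]])
    (simp_all add: D\<sigma>_apply)

lemma dir_deriv_d\<sigma>_field:
  assumes x: "x \<in> U" and v: "v differentiable (at x)"
  shows "dir_deriv X (\<lambda>y. dir_deriv (v y) \<sigma> y) x = dir_deriv X (dir_deriv (v x) \<sigma>) x + dir_deriv (dir_deriv X v x) \<sigma> x"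
proof -
  have dD: "D\<sigma> differentiable (at x)" by (rule smooth_on_differentiable[OF smooth_D\<sigma> x])
  have "dir_deriv X (\<lambda>y. dir_deriv (v y) \<sigma> y) x = dir_deriv X (\<lambda>y. D\<sigma> y (v y)) x"
    by (rule dir_deriv_cong_open[OF open_U' x]) (simp add: D\<sigma>_apply)
  also have "\<dots> = D\<sigma> x (dir_deriv X v x) + dir_deriv X D\<sigma> x (v x)"
    by (rule dir_deriv_bilinear[OF bounded_bilinear_blinfun_apply dD v])
  also have "dir_deriv X D\<sigma> x (v x) = dir_deriv X (\<lambda>y. D\<sigma> y (v x)) x"
    by (rule dir_deriv_bounded_linear[OF blinfun.bounded_linear_left dD, symmetric])
  also have "\<dots> = dir_deriv X (dir_deriv (v x) \<sigma>) x"
    by (rule dir_deriv_cong_open[OF open_U' x]) (simp add: D\<sigma>_apply)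
  finally show ?thesis by (simp add: D\<sigma>_apply[OF x])
qed

lemma smooth_H: "smooth_on U (\<lambda>x. H x X Y)"
  unfolding hessian_def
  by (intro smooth_on_diff smooth_on_dir_deriv smooth_\<sigma> smooth_d\<sigma>_field smooth_\<Gamma>)

lemma diff_H: "x \<in> U \<Longrightarrow> (\<lambda>x. H x X Y) differentiable (at x)"
  by (rule smooth_on_differentiable[OF smooth_H])

lemma lor_H_d\<sigma>: "x \<in> U \<Longrightarrow> lor (H x X Y) (dir_deriv W \<sigma> x) = 0"
  using \<Gamma>_eq[of x X Y W] unfolding hessian_def induced_metric_def by (simp add: lor.diff_left)

lemma H_sym: "x \<in> U \<Longrightarrow> H x X Y = H x Y X"
  unfolding hessian_def by (simp add: dd\<sigma>_commute[of x X Y] \<Gamma>_sym[of x X Y])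

lemma linear_H: "x \<in> U \<Longrightarrow> linear (\<lambda>X. H x X Y)"
proof -
  assume x: "x \<in> U"
  have "linear (\<lambda>X. dir_deriv X (dir_deriv Y \<sigma>) x)" by (rule dir_deriv_linear[OF diff_d\<sigma>[OF x]])
  moreover have "linear (\<lambda>X. dir_deriv (\<Gamma> x X Y) \<sigma> x)"
    using linear_compose[OF linear_\<Gamma>[OF x] linear_d\<sigma>[OF x]] by (simp add: o_def)
  ultimately show ?thesis unfolding hessian_def by (rule linear_compose_sub)
qed

lemma lor_dd\<sigma>_\<sigma>: "x \<in> U \<Longrightarrow> lor (dir_deriv X (dir_deriv Y \<sigma>) x) (\<sigma> x) = - g x X Y"
proof -
  assume x: "x \<in> U"
  have "dir_deriv X (\<lambda>y. lor (dir_deriv Y \<sigma> y) (\<sigma> y)) x = dir_deriv X (\<lambda>_. 0) x"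
    by (rule dir_deriv_cong_open[OF open_U' x lor_d\<sigma>_\<sigma>])
  then have "lor (dir_deriv Y \<sigma> x) (dir_deriv X \<sigma> x) + lor (dir_deriv X (dir_deriv Y \<sigma>) x) (\<sigma> x) = 0"
    using dir_deriv_lor[OF diff_d\<sigma>[OF x] diff_\<sigma>[OF x], of X Y] by simp
  then show ?thesis unfolding induced_metric_def lor_commute[of "dir_deriv X \<sigma> x"] by simp
qed

lemma lor_H_\<sigma>: "x \<in> U \<Longrightarrow> lor (H x X Y) (\<sigma> x) = - g x X Y"
  unfolding hessian_def by (simp add: lor.diff_left lor_dd\<sigma>_\<sigma> lor_d\<sigma>_\<sigma>)

text \<open>Third derivatives of \<sigma> commute. Splitting their tangential part with
  \<open>hessian\<close> as the normal second fundamental form, whose derivative is moved onto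
  d\<sigma> by orthogonality, leaves the curvature and the two products of Hessians.\<close>

lemma gauss_equation:
  assumes x: "x \<in> U"
  shows "g x (riemann g x X Y Z) W = lor (H x Y Z) (H x X W) - lor (H x X Z) (H x Y W)"
proof -
  have cov: "cov_deriv g Y (\<lambda>_. Z) = (\<lambda>y. \<Gamma> y Y Z)" for Y
    by (rule ext) (simp add: cov_deriv_def)
  have one: "lor (dir_deriv X (dir_deriv Y (dir_deriv Z \<sigma>)) x) (dir_deriv W \<sigma> x)
      = g x (cov_deriv g X (\<lambda>y. \<Gamma> y Y Z) x) W - lor (H x Y Z) (H x X W)" for X Y
  proof -
    let ?h = "\<lambda>y. H y Y Z" and ?e = "\<lambda>y. dir_deriv (\<Gamma> y Y Z) \<sigma> y"
    have dG: "(\<lambda>y. \<Gamma> y Y Z) differentiable (at x)" by (rule smooth_on_differentiable[OF smooth_\<Gamma> x])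
    have de: "?e differentiable (at x)" by (rule smooth_on_differentiable[OF smooth_d\<sigma>_field[OF smooth_\<Gamma>] x])
    have "dir_deriv Y (dir_deriv Z \<sigma>) = (\<lambda>y. ?h y + ?e y)" by (rule ext) (simp add: hessian_def)
    then have "dir_deriv X (dir_deriv Y (dir_deriv Z \<sigma>)) x = dir_deriv X ?h x + dir_deriv X ?e x"
      using dir_deriv_add[OF diff_H[OF x] de] by simp
    also have "dir_deriv X ?e x = dir_deriv X (dir_deriv (\<Gamma> x Y Z) \<sigma>) x + dir_deriv (dir_deriv X (\<lambda>y. \<Gamma> y Y Z) x) \<sigma> x"
      by (rule dir_deriv_d\<sigma>_field[OF x dG])
    also have "dir_deriv X (dir_deriv (\<Gamma> x Y Z) \<sigma>) x = H x X (\<Gamma> x Y Z) + dir_deriv (\<Gamma> x X (\<Gamma> x Y Z)) \<sigma> x"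
      by (simp add: hessian_def)
    finally have 1: "dir_deriv X (dir_deriv Y (dir_deriv Z \<sigma>)) x
        = dir_deriv X ?h x + H x X (\<Gamma> x Y Z) + dir_deriv (cov_deriv g X (\<lambda>y. \<Gamma> y Y Z) x) \<sigma> x"
      by (simp add: cov_deriv_def d\<sigma>_add[OF x])
    have "dir_deriv X (\<lambda>y. lor (?h y) (dir_deriv W \<sigma> y)) x = dir_deriv X (\<lambda>_. 0) x"
      by (rule dir_deriv_cong_open[OF open_U' x lor_H_d\<sigma>])
    then have "lor (dir_deriv X ?h x) (dir_deriv W \<sigma> x) = - lor (H x Y Z) (dir_deriv X (dir_deriv W \<sigma>) x)"
      using dir_deriv_lor[OF diff_H[OF x] diff_d\<sigma>[OF x], of X Y Z W] by simp
    also have "\<dots> = - lor (H x Y Z) (H x X W)"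
      using lor_H_d\<sigma>[OF x, of Y Z "\<Gamma> x X W"] by (simp add: hessian_def[of \<sigma> x X W] lor.diff_right)
    finally show ?thesis
      unfolding 1 by (simp add: lor.add_left lor_H_d\<sigma>[OF x] induced_metric_def)
  qed
  have "dir_deriv X (dir_deriv Y (dir_deriv Z \<sigma>)) x = dir_deriv Y (dir_deriv X (dir_deriv Z \<sigma>)) x"
    by (rule dir_deriv_commute[OF smooth_d\<sigma> x])
  then show ?thesis
    using one[of X Y] one[of Y X] unfolding riemann_def cov bilinear_lsub[OF bilinear_g[OF x]] by simp
qed

end

text \<open>By \<open>b_eq\<close> this is the V-orthogonal part of the second derivative of
  \<sigma>, that is, minus \<open>II\<close> of V. Written with dP, it is visibly tensorial.\<close>

definition normal_hessian :: "(real^'m::finite \<Rightarrow> 'k::finite mink \<Rightarrow>\<^sub>L 'k mink) \<Rightarrow> (real^'m \<Rightarrow> 'k mink)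
    \<Rightarrow> real^'m \<Rightarrow> real^'m \<Rightarrow> real^'m \<Rightarrow> 'k mink" where
  "normal_hessian P \<sigma> x X Y = dir_deriv X P x (dir_deriv Y \<sigma> x)"

text \<open>\<open>jet_perp\<close> is the rank condition on V in usable form: within V only
  \<Lambda> is orthogonal to \<sigma> and d\<sigma>. In this form it passes to open subsets and to
  rescaled sections, see \<open>rescale\<close>.\<close>

locale rank_one_envelope = projection_field U P + null_immersion U \<sigma>
  for U :: "(real^'m::finite) set" and P :: "real^'m \<Rightarrow> 'k::finite mink \<Rightarrow>\<^sub>L 'k mink" and \<sigma> :: "real^'m \<Rightarrow> 'k mink" +
  assumes P_\<sigma>: "x \<in> U \<Longrightarrow> P x (\<sigma> x) = \<sigma> x"
    and P_d\<sigma>: "x \<in> U \<Longrightarrow> P x (dir_deriv X \<sigma> x) = dir_deriv X \<sigma> x"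
    and jet_perp: "x \<in> U \<Longrightarrow> P x z = z \<Longrightarrow> lor z (\<sigma> x) = 0 \<Longrightarrow> (\<And>X. lor z (dir_deriv X \<sigma> x) = 0) \<Longrightarrow> z \<in> span {\<sigma> x}"
    and rank1: "x \<in> U \<Longrightarrow> \<exists>\<omega> E. \<forall>X v. dir_deriv X P x v = \<omega> X *\<^sub>R blinfun_apply E v"
begin

abbreviation "b \<equiv> normal_hessian P \<sigma>"

lemmas b_def = normal_hessian_def[of P \<sigma>]

lemma dP_\<sigma>: "x \<in> U \<Longrightarrow> dir_deriv X P x (\<sigma> x) = 0"
proof -
  assume x: "x \<in> U"
  have "dir_deriv X (\<lambda>y. P y (\<sigma> y)) x = dir_deriv X \<sigma> x"
    by (rule dir_deriv_cong_open[OF open_U x P_\<sigma>])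
  then show ?thesis using dir_deriv_P_section[OF x diff_\<sigma>[OF x], of X] P_d\<sigma>[OF x] by simp
qed

lemma b_eq: "x \<in> U \<Longrightarrow> b x X Y = dir_deriv X (dir_deriv Y \<sigma>) x - P x (dir_deriv X (dir_deriv Y \<sigma>) x)"
proof -
  assume x: "x \<in> U"
  have "dir_deriv X (\<lambda>y. P y (dir_deriv Y \<sigma> y)) x = dir_deriv X (dir_deriv Y \<sigma>) x"
    by (rule dir_deriv_cong_open[OF open_U x P_d\<sigma>])
  then show ?thesis using dir_deriv_P_section[OF x diff_d\<sigma>[OF x], of X] by (simp add: b_def algebra_simps)
qed

lemma b_sym: "x \<in> U \<Longrightarrow> b x X Y = b x Y X"
  by (simp add: b_eq dd\<sigma>_commute[of x X Y])

lemma P_b: "x \<in> U \<Longrightarrow> P x (b x X Y) = 0"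
  by (simp add: b_eq blinfun.diff_right P_idem)

lemma P_H: "x \<in> U \<Longrightarrow> P x (H x X Y) = H x X Y - b x X Y"
  by (simp add: hessian_def b_eq blinfun.diff_right P_d\<sigma>)

lemma lor_P_b: "x \<in> U \<Longrightarrow> P x v = v \<Longrightarrow> lor (b x X Y) v = 0"
  using P_adj[of x "b x X Y" v] P_b[of x X Y] by (simp add: lor.zero_left)

lemma bilinear_b: "x \<in> U \<Longrightarrow> bilinear (b x)"
proof -
  assume x: "x \<in> U"
  show ?thesis unfolding bilinear_def b_def
    by (auto intro!: linearI simp: d\<sigma>_add[OF x] d\<sigma>_scale[OF x] blinfun_simps
        linear_add[OF dP_linear[OF x]] linear_scale[OF dP_linear[OF x]] blinfun_simps)
qed

text \<open>Both identities hold because dP X and dP Y are multiples of one operator. The first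
  removes the normal terms from the Gauss and Codazzi equations, the second is the integrability
  condition for parallel sections.\<close>

lemma dP_exchange:
  assumes x: "x \<in> U"
  shows "lor (dir_deriv X P x u) (dir_deriv Y P x v) = lor (dir_deriv Y P x u) (dir_deriv X P x v)"
    "dir_deriv X P x (dir_deriv Y P x v) = dir_deriv Y P x (dir_deriv X P x v)"
proof -
  obtain \<omega> E where E: "\<And>X v. dir_deriv X P x v = \<omega> X *\<^sub>R blinfun_apply E v" using rank1[OF x] by blast
  show "lor (dir_deriv X P x u) (dir_deriv Y P x v) = lor (dir_deriv Y P x u) (dir_deriv X P x v)"
    unfolding E by (simp add: lor_simps)
  show "dir_deriv X P x (dir_deriv Y P x v) = dir_deriv Y P x (dir_deriv X P x v)"
    unfolding E by (simp add: blinfun.scaleR_right)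
qed

text \<open>Rank one of dP only gives b = \<omega> \<otimes> \<theta>; the symmetry of b forces
  \<theta> to be a multiple of \<omega>, as seen by inserting a vector X0 with \<omega> X0 \<noteq>
  0.\<close>

lemma b_rank_one:
  assumes x: "x \<in> U"
  shows "\<exists>\<omega> n. \<forall>X Y. b x X Y = (\<omega> X * \<omega> Y) *\<^sub>R n"
proof -
  obtain \<omega> E where E: "\<And>X v. dir_deriv X P x v = \<omega> X *\<^sub>R blinfun_apply E v" using rank1[OF x] by blast
  define \<theta> where "\<theta> Y = E (dir_deriv Y \<sigma> x)" for Y
  have b: "b x X Y = \<omega> X *\<^sub>R \<theta> Y" for X Y by (simp add: b_def E \<theta>_def)
  show ?thesis
  proof (cases "\<forall>X. \<omega> X = 0")
    case True
    then have "b x X Y = (\<omega> X * \<omega> Y) *\<^sub>R 0" for X Y unfolding b by simp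
    then show ?thesis by blast
  next
    case False
    then obtain X0 where X0: "\<omega> X0 \<noteq> 0" by blast
    have "\<theta> Y = (\<omega> Y / \<omega> X0) *\<^sub>R \<theta> X0" for Y
    proof -
      have "\<omega> X0 *\<^sub>R \<theta> Y = \<omega> Y *\<^sub>R \<theta> X0" using b_sym[OF x, of X0 Y] by (simp add: b)
      then have "(1 / \<omega> X0) *\<^sub>R \<omega> X0 *\<^sub>R \<theta> Y = (1 / \<omega> X0) *\<^sub>R \<omega> Y *\<^sub>R \<theta> X0" by simp
      then show ?thesis using X0 by simp
    qed
    then have "b x X Y = (\<omega> X * \<omega> Y) *\<^sub>R ((1 / \<omega> X0) *\<^sub>R \<theta> X0)" for X Y
      unfolding b by (metis (no_types, lifting) mult.assoc mult_1 scaleR_scaleR times_divide_eq_left times_divide_eq_right mult.right_neutral)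
    then show ?thesis by blast
  qed
qed

text \<open>The complement of d\<sigma> in V is the Lorentzian plane spanned by the null vectors
  \<sigma> and w with product -1, so coefficients are read off by pairing. The remainder y lies
  along \<sigma> by \<open>jet_perp\<close>, and pairing with w kills it.\<close>

lemma normal_decomposition:
  assumes x: "x \<in> U" and w: "P x w = w" "lor w w = 0" "lor w (\<sigma> x) = -1" "\<And>X. lor w (dir_deriv X \<sigma> x) = 0"
    and z: "P x z = z" "\<And>X. lor z (dir_deriv X \<sigma> x) = 0"
  shows "z = - lor z (\<sigma> x) *\<^sub>R w - lor z w *\<^sub>R \<sigma> x"
proof -
  define y where "y = z + lor z (\<sigma> x) *\<^sub>R w + lor z w *\<^sub>R \<sigma> x"
  note bil = lor_simps
  have "lor (\<sigma> x) (dir_deriv X \<sigma> x) = 0" for X using lor_d\<sigma>_\<sigma>[OF x, of X] by (simp add: lor_commute)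
  then have "y \<in> span {\<sigma> x}"
    using w z null[OF x] by (intro jet_perp[OF x]) (simp_all add: y_def bil blinfun_simps P_\<sigma>[OF x])
  then obtain c where c: "y = c *\<^sub>R \<sigma> x" unfolding span_singleton by blast
  have "lor y w = 0" using w by (simp add: y_def bil lor_commute[of "\<sigma> x" w])
  then have "c = 0" using w by (simp add: c lor.scaleR_left lor_commute[of "\<sigma> x" w])
  then have "z + lor z (\<sigma> x) *\<^sub>R w + lor z w *\<^sub>R \<sigma> x = 0" using c by (simp add: y_def)
  then show ?thesis by (simp add: algebra_simps eq_neg_iff_add_eq_0)
qed

text \<open>The V-part of the Hessian is orthogonal to d\<sigma>, hence lies in that plane; pairing
  it with \<sigma> gives - g, the coefficient of \<sigma> comes from pairing with w.\<close>

lemma H_decomposition: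
  assumes x: "x \<in> U" and w: "P x w = w" "lor w w = 0" "lor w (\<sigma> x) = -1" "\<And>X. lor w (dir_deriv X \<sigma> x) = 0"
  shows "H x X Y = g x X Y *\<^sub>R w - lor (dir_deriv X (dir_deriv Y \<sigma>) x) w *\<^sub>R \<sigma> x + b x X Y"
proof -
  have bd: "lor (b x X Y) (dir_deriv Z \<sigma> x) = 0" for Z by (rule lor_P_b[OF x P_d\<sigma>[OF x]])
  have wd: "lor (dir_deriv (\<Gamma> x X Y) \<sigma> x) w = 0" using w(4) by (simp add: lor_commute)
  have "P x (H x X Y) = - lor (P x (H x X Y)) (\<sigma> x) *\<^sub>R w - lor (P x (H x X Y)) w *\<^sub>R \<sigma> x"
    by (rule normal_decomposition[OF x w P_idem[OF x]]) (simp_all add: P_H[OF x] lor.diff_left lor_H_d\<sigma>[OF x] bd)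
  moreover have "lor (P x (H x X Y)) (\<sigma> x) = - g x X Y"
    unfolding P_H[OF x] lor.diff_left lor_H_\<sigma>[OF x] lor_P_b[OF x P_\<sigma>[OF x]] by simp
  moreover have "lor (P x (H x X Y)) w = lor (dir_deriv X (dir_deriv Y \<sigma>) x) w"
    unfolding P_H[OF x] lor.diff_left lor_P_b[OF x w(1)] unfolding hessian_def lor.diff_left wd by simp
  ultimately show ?thesis using P_H[OF x, of X Y] by (simp add: algebra_simps)
qed

end

section \<open>Flat representatives of the conformal class\<close>

text \<open>Bootstrapping: if v is of class k, so is A v, which is its derivative.\<close>

lemma smooth_on_linear_ode_solution:
  assumes op: "open U" and A: "\<And>X. smooth_on U (\<lambda>x. A x X)"
    and v: "\<And>x. x \<in> U \<Longrightarrow> (v has_derivative (\<lambda>X. blinfun_apply (A x X) (v x))) (at x)"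
  shows "smooth_on U v"
proof -
  have d: "v differentiable_on U"
    unfolding differentiable_on_open[OF op] using v differentiableI by blast
  have "Ck_on k U v" for k
  proof (induction k)
    case 0
    show ?case using differentiable_imp_continuous_on[OF d] by simp
  next
    case (Suc k)
    have "Ck_on k U (dir_deriv X v)" for X
    proof (subst Ck_on_cong[OF op])
      show "dir_deriv X v y = A y X (v y)" if "y \<in> U" for y by (rule dir_deriv_eqI[OF v[OF that]])
      show "Ck_on k U (\<lambda>y. A y X (v y))"
        using A[of X] Suc unfolding smooth_on_def by (intro Ck_on_bilinear[OF bounded_bilinear_blinfun_apply op]) auto
    qed
    then show ?case using d by simp
  qed
  then show ?thesis using op by (simp add: smooth_on_def)
qed

context rank_one_envelope
begin

lemma null_normal_exists:
  assumes x: "x \<in> U"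
  obtains w where "P x w = w" "lor w w = 0" "lor w (\<sigma> x) = -1"
proof -
  have "\<sigma> x \<noteq> 0" using pos[OF x] by auto
  then obtain u where u: "lor (\<sigma> x) u \<noteq> 0" using lor_nondegenerate[of "\<sigma> x"] by blast
  define v where "v = (-1 / lor (\<sigma> x) u) *\<^sub>R P x u"
  have Pv: "P x v = v" by (simp add: v_def blinfun_simps P_idem[OF x])
  have v: "lor v (\<sigma> x) = -1"
    using u P_adj[OF x, of u "\<sigma> x"] by (simp add: v_def lor_simps P_\<sigma>[OF x] lor_commute[of u])
  \<comment> \<open>Adding c \<sigma> changes the square of v by 2 c (v, \<sigma>) = - 2 c, so c is
    half that square.\<close>
  show ?thesis
  proof (rule that[of "v + (lor v v / 2) *\<^sub>R \<sigma> x"])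
    show "P x (v + (lor v v / 2) *\<^sub>R \<sigma> x) = v + (lor v v / 2) *\<^sub>R \<sigma> x"
      by (simp add: blinfun_simps Pv P_\<sigma>[OF x])
    show "lor (v + (lor v v / 2) *\<^sub>R \<sigma> x) (v + (lor v v / 2) *\<^sub>R \<sigma> x) = 0"
      using v by (simp add: lor_simps null[OF x] lor_commute[of "\<sigma> x" v])
    show "lor (v + (lor v v / 2) *\<^sub>R \<sigma> x) (\<sigma> x) = -1"
      using v by (simp add: lor_simps null[OF x])
  qed
qed

text \<open>The conditions concern only \<Lambda>, its first derivatives and P: the derivative of
  \<rho> \<sigma> differs from \<rho> d\<sigma> by a multiple of \<sigma>.\<close>

lemma rescale:
  assumes W: "open W" "W \<subseteq> U" and \<rho>: "smooth_on W \<rho>" "\<And>x. x \<in> W \<Longrightarrow> \<rho> x > 0"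
  shows "rank_one_envelope W P (\<lambda>x. \<rho> x *\<^sub>R \<sigma> x)"
proof -
  have in_U: "x \<in> U" if "x \<in> W" for x using W that by blast
  have d: "dir_deriv X (\<lambda>x. \<rho> x *\<^sub>R \<sigma> x) x = \<rho> x *\<^sub>R dir_deriv X \<sigma> x + dir_deriv X \<rho> x *\<^sub>R \<sigma> x" if "x \<in> W" for X x
    by (rule dir_deriv_bilinear[OF bounded_bilinear_scaleR smooth_on_differentiable[OF \<rho>(1) that] diff_\<sigma>[OF in_U[OF that]]])
  have sp: "span {\<rho> x *\<^sub>R \<sigma> x} = span {\<sigma> x}" if "x \<in> W" for x
    using span_image_scale[of "{\<sigma> x}" "\<lambda>_. \<rho> x"] \<rho>(2)[OF that] by simp
  show ?thesis
  proof
    show "smooth_on W P" by (rule smooth_on_subset[OF smooth_P W])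
    show "smooth_on W (\<lambda>x. \<rho> x *\<^sub>R \<sigma> x)" by (intro smooth_on_scaleR \<rho> smooth_on_subset[OF smooth_\<sigma> W])
    fix x assume x: "x \<in> W"
    note xU = in_U[OF x]
    show "P x (P x v) = P x v" for v by (rule P_idem[OF xU])
    show "lor (P x u) v = lor u (P x v)" for u v by (rule P_adj[OF xU])
    show "lor (\<rho> x *\<^sub>R \<sigma> x) (\<rho> x *\<^sub>R \<sigma> x) = 0" by (simp add: lor_simps null[OF xU])
    show "0 < snd (\<rho> x *\<^sub>R \<sigma> x)" using pos[OF xU] \<rho>(2)[OF x] by simp
    show "X = 0" if "dir_deriv X (\<lambda>x. \<rho> x *\<^sub>R \<sigma> x) x \<in> span {\<rho> x *\<^sub>R \<sigma> x}" for X
    proof (rule immersion[OF xU])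
      have "dir_deriv X (\<lambda>x. \<rho> x *\<^sub>R \<sigma> x) x - dir_deriv X \<rho> x *\<^sub>R \<sigma> x \<in> span {\<sigma> x}"
        using that span_scale[OF span_base[of "\<sigma> x" "{\<sigma> x}"], of "dir_deriv X \<rho> x"]
        unfolding sp[OF x] by (intro span_diff) simp_all
      then have "(1 / \<rho> x) *\<^sub>R (\<rho> x *\<^sub>R dir_deriv X \<sigma> x) \<in> span {\<sigma> x}" unfolding d[OF x] by (intro span_scale[of _ _ "1 / \<rho> x"]) simp
      then show "dir_deriv X \<sigma> x \<in> span {\<sigma> x}" using \<rho>(2)[OF x] by simp
    qed
    show "P x (\<rho> x *\<^sub>R \<sigma> x) = \<rho> x *\<^sub>R \<sigma> x" by (simp add: blinfun.scaleR_right P_\<sigma>[OF xU])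
    show "P x (dir_deriv X (\<lambda>x. \<rho> x *\<^sub>R \<sigma> x) x) = dir_deriv X (\<lambda>x. \<rho> x *\<^sub>R \<sigma> x) x" for X
      by (simp add: d[OF x] blinfun_simps P_\<sigma>[OF xU] P_d\<sigma>[OF xU])
    show "z \<in> span {\<rho> x *\<^sub>R \<sigma> x}" if z: "P x z = z" "lor z (\<rho> x *\<^sub>R \<sigma> x) = 0"
      "\<And>X. lor z (dir_deriv X (\<lambda>x. \<rho> x *\<^sub>R \<sigma> x) x) = 0" for z
      unfolding sp[OF x]
    proof (rule jet_perp[OF xU z(1)])
      show 1: "lor z (\<sigma> x) = 0" using z(2) \<rho>(2)[OF x] by (simp add: lor.scaleR_right)
      show "lor z (dir_deriv X \<sigma> x) = 0" for X
        using z(3)[of X] \<rho>(2)[OF x] unfolding d[OF x] by (simp add: lor_simps 1)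
    qed
    show "\<exists>\<omega> E. \<forall>X v. dir_deriv X P x v = \<omega> X *\<^sub>R blinfun_apply E v" by (rule rank1[OF xU])
  qed
qed

lemma flat_of_parallel_null_normal:
  assumes x: "x \<in> U" and sv: "smooth_on U v" and w: "\<And>y. y \<in> U \<Longrightarrow> P y (v y) = v y"
    "\<And>y. y \<in> U \<Longrightarrow> lor (v y) (v y) = 0" "\<And>y. y \<in> U \<Longrightarrow> lor (v y) (\<sigma> y) = -1"
    "\<And>y X. y \<in> U \<Longrightarrow> P y (dir_deriv X v y) = 0"
  shows "riemann g x X Y Z = 0"
proof -
  have dv: "v differentiable (at y)" if "y \<in> U" for y by (rule smooth_on_differentiable[OF sv that])
  have perp: "lor (dir_deriv X v y) z = 0" if "y \<in> U" "P y z = z" for X y z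
    using P_adj[OF that(1), of "dir_deriv X v y" z] that w(4)[OF that(1), of X] by (simp add: lor.zero_left)
  \<comment> \<open>Since dv is orthogonal to V, differentiating (v, \<sigma>) = -1 leaves (v,
    d\<sigma>) = 0.\<close>
  have vd: "lor (dir_deriv X \<sigma> y) (v y) = 0" if y: "y \<in> U" for X y
  proof -
    have "dir_deriv X (\<lambda>y. lor (v y) (\<sigma> y)) y = dir_deriv X (\<lambda>_. -1) y"
      by (rule dir_deriv_cong_open[OF open_U y w(3)])
    then show ?thesis
      using dir_deriv_lor[OF dv[OF y] diff_\<sigma>[OF y], of X] perp[OF y P_\<sigma>[OF y], of X]
      by (simp add: lor_commute[of "v y"])
  qed
  \<comment> \<open>Differentiating once more removes the coefficient of \<sigma> in
    \<open>H_decomposition\<close>; then H = g v + b with v null and orthogonal to b.\<close>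
  have r: "lor (dir_deriv X (dir_deriv Y \<sigma>) x) (v x) = 0" for X Y
  proof -
    have "dir_deriv X (\<lambda>y. lor (dir_deriv Y \<sigma> y) (v y)) x = dir_deriv X (\<lambda>_. 0) x"
      by (rule dir_deriv_cong_open[OF open_U x vd])
    then show ?thesis
      using dir_deriv_lor[OF diff_d\<sigma>[OF x] dv[OF x], of X Y] perp[OF x P_d\<sigma>[OF x], of X Y]
      by (simp add: lor_commute[of "dir_deriv Y \<sigma> x"])
  qed
  have H: "H x X Y = g x X Y *\<^sub>R v x + b x X Y" for X Y
    using H_decomposition[OF x w(1)[OF x] w(2)[OF x] w(3)[OF x], of X Y] vd[OF x] by (simp add: r lor_commute[of "v x"])
  have bv: "lor (b x X Y) (v x) = 0" for X Y by (rule lor_P_b[OF x w(1)[OF x]])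
  have vb: "lor (v x) (b x X Y) = 0" for X Y using bv lor_commute by metis
  have HH: "lor (H x X Y) (H x Z W) = lor (b x X Y) (b x Z W)" for X Y Z W
    unfolding H by (simp add: lor_simps w(2)[OF x] bv vb)
  show ?thesis
  proof (rule g_nondegenerate[OF x])
    fix W
    show "g x (riemann g x X Y Z) W = 0"
      unfolding gauss_equation[OF x] HH b_def using dP_exchange(1)[OF x] by simp
  qed
qed

text \<open>The linear system is solved for u with values in the whole space, starting from a null
  normal w at x0, and only then projected to V. Being null is preserved because the induced
  connection is metric.\<close>

lemma parallel_null_normal_exists:
  assumes x0: "x0 \<in> U"
  obtains B v where "open B" "x0 \<in> B" "B \<subseteq> U" "smooth_on B v" "lor (v x0) (\<sigma> x0) = -1"
    "\<forall>x\<in>B. P x (v x) = v x" "\<forall>x\<in>B. lor (v x) (v x) = 0"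
    "\<forall>x\<in>B. \<forall>X. P x (dir_deriv X v x) = 0"
proof -
  define A where "A x = Blinfun (\<lambda>X. - dir_deriv X P x)" for x
  have A: "A x X = - dir_deriv X P x" if "x \<in> U" for x X
  proof -
    have "linear (\<lambda>X. - dir_deriv X P x)" using linear_compose_neg[OF dP_linear[OF that]] .
    then show ?thesis unfolding A_def by (simp add: bounded_linear_Blinfun_apply linear_conv_bounded_linear)
  qed
  have sA: "smooth_on U (\<lambda>x. A x X)" for X
    by (rule smooth_on_cong[OF smooth_on_minus[OF smooth_on_dir_deriv[OF smooth_P]] A])
  have smA: "smooth_on U A" by (rule smooth_on_blinfun[OF open_U sA])
  have dA: "dir_deriv X A x Y = - dir_deriv X (dir_deriv Y P) x" if x: "x \<in> U" for x X Y
  proof -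
    have "dir_deriv X A x Y = dir_deriv X (\<lambda>y. A y Y) x"
      by (rule dir_deriv_bounded_linear[OF blinfun.bounded_linear_left smooth_on_differentiable[OF smA x], symmetric])
    also have "\<dots> = dir_deriv X (\<lambda>y. - dir_deriv Y P y) x" by (rule dir_deriv_cong_open[OF open_U x A])
    also have "\<dots> = - dir_deriv X (dir_deriv Y P) x"
      by (rule dir_deriv_minus[OF smooth_on_differentiable[OF smooth_on_dir_deriv[OF smooth_P] x]])
    finally show ?thesis .
  qed
  obtain w where w: "P x0 w = w" "lor w w = 0" "lor w (\<sigma> x0) = -1" by (rule null_normal_exists[OF x0])
  \<comment> \<open>The derivatives of A cancel as mixed derivatives of P; the quadratic terms form
    the commutator of dP X and dP Y.\<close>
  have flat: "dir_deriv X A x Y u + A x Y (A x X u) = dir_deriv Y A x X u + A x X (A x Y u)" if x: "x \<in> U" for x X Y u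
    unfolding dA[OF x] A[OF x]
    by (simp add: blinfun_simps ddP_commute[OF x, of X Y] dP_exchange(2)[OF x, of X Y])
  have "\<exists>r u. 0 < r \<and> ball x0 r \<subseteq> U \<and> u x0 = w \<and>
      (\<forall>x\<in>ball x0 r. (u has_derivative (\<lambda>X. A x X (u x))) (at x))"
  proof (rule total_linear_system_local_solution[OF smA x0 flat, where ?v0.0 = w])
    fix r :: real and u
    assume a: "0 < r" "ball x0 r \<subseteq> U" "u x0 = w"
      "\<And>x. x \<in> ball x0 r \<Longrightarrow> (u has_derivative (\<lambda>X. A x X (u x))) (at x)"
    show ?thesis by (intro exI[of _ r] exI[of _ u] conjI ballI) (fact a)+
  qed
  then obtain r u where r: "0 < r" "ball x0 r \<subseteq> U" "u x0 = w"
    and u: "\<And>x. x \<in> ball x0 r \<Longrightarrow> (u has_derivative (\<lambda>X. A x X (u x))) (at x)"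
    by (elim exE conjE) (rule that, assumption+, erule bspec)
  let ?B = "ball x0 r"
  have inU: "x \<in> U" if "x \<in> ?B" for x using r(2) that by blast
  have smu: "smooth_on ?B u"
    by (rule smooth_on_linear_ode_solution[OF open_ball smooth_on_subset[OF sA open_ball r(2)] u])
  define v where "v x = P x (u x)" for x
  have smv: "smooth_on ?B v" unfolding v_def[abs_def]
    by (rule smooth_on_blinfun_apply[OF smooth_on_subset[OF smooth_P open_ball r(2)] smu])
  have Pv: "P x (v x) = v x" if "x \<in> ?B" for x unfolding v_def by (rule P_idem[OF inU[OF that]])
  have Pdv: "P x (dir_deriv X v x) = 0" if x: "x \<in> ?B" for x X
  proof -
    have "dir_deriv X v x = P x (dir_deriv X u x) + dir_deriv X P x (u x)"
      unfolding v_def[abs_def] by (rule dir_deriv_P_section[OF inU[OF x] smooth_on_differentiable[OF smu x]])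
    moreover have "dir_deriv X u x = - dir_deriv X P x (u x)"
      using dir_deriv_eqI[OF u[OF x], of X] by (simp add: A[OF inU[OF x]] blinfun.minus_left)
    ultimately show ?thesis by (simp add: blinfun_simps P_idem[OF inU[OF x]])
  qed
  have v0: "v x0 = w" by (simp add: v_def r(3) w(1))
  have "lor (v x) (v x) = lor (v x0) (v x0)" if x: "x \<in> ?B" for x
  proof -
    have "\<exists>c. \<forall>x\<in>?B. lor (v x) (v x) = c"
    proof (rule has_derivative_zero_constant[OF convex_ball])
      fix y assume y: "y \<in> ?B"
      have dv: "(v has_derivative (\<lambda>X. dir_deriv X v y)) (at y)"
        by (rule dir_deriv_works[OF smooth_on_differentiable[OF smv y]])
      \<comment> \<open>(v, dv) = (P v, dv) = (v, P dv) = 0.\<close>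
      have z: "lor (v y) (dir_deriv X v y) = 0" for X
        using P_adj[OF inU[OF y], of "v y" "dir_deriv X v y"] by (simp add: Pv[OF y] Pdv[OF y] lor.zero_right)
      have "((\<lambda>y. lor (v y) (v y)) has_derivative (\<lambda>X. lor (v y) (dir_deriv X v y) + lor (dir_deriv X v y) (v y))) (at y)"
        by (rule lor.FDERIV[OF dv dv])
      then have "((\<lambda>y. lor (v y) (v y)) has_derivative (\<lambda>X. 0)) (at y)"
        by (simp add: z lor_commute[of _ "v y"])
      then show "((\<lambda>y. lor (v y) (v y)) has_derivative (\<lambda>X. 0)) (at y within ?B)" by (rule has_derivative_at_withinI)
    qed
    then obtain c where c: "\<forall>x\<in>?B. lor (v x) (v x) = c" by blast
    moreover have "x0 \<in> ?B" using r by simp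
    ultimately show ?thesis using x by metis
  qed
  then have "lor (v x) (v x) = 0" if "x \<in> ?B" for x using that w(2) v0 by simp
  then show ?thesis
    by (intro that[of ?B v]) (use r smv Pv Pdv v0 w(3) in \<open>simp_all del: mem_ball add: centre_in_ball\<close>)
qed

proposition flat_representative_exists:
  assumes x0: "x0 \<in> U"
  obtains W \<rho> where "open W" "x0 \<in> W" "W \<subseteq> U" "smooth_on W \<rho>" "\<forall>x\<in>W. \<rho> x > 0"
    "\<forall>x\<in>W. \<forall>X Y Z. riemann (induced_metric (\<lambda>x. \<rho> x *\<^sub>R \<sigma> x)) x X Y Z = 0"
proof -
  obtain B v where B: "open B" "x0 \<in> B" "B \<subseteq> U" and v: "smooth_on B v" "lor (v x0) (\<sigma> x0) = -1"
    "\<forall>x\<in>B. P x (v x) = v x" "\<forall>x\<in>B. lor (v x) (v x) = 0"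
    "\<forall>x\<in>B. \<forall>X. P x (dir_deriv X v x) = 0"
    by (rule parallel_null_normal_exists[OF x0]) (rule that)
  define f where "f x = - lor (v x) (\<sigma> x)" for x
  have smf: "smooth_on B f" unfolding f_def[abs_def]
    by (intro smooth_on_minus smooth_on_lor v smooth_on_subset[OF smooth_\<sigma> B(1,3)])
  \<comment> \<open>f equals 1 at x0, so this neighbourhood contains x0, and dividing \<sigma> by f
    normalises its product with v to -1.\<close>
  define W where "W = B \<inter> f -` {0<..}"
  have W: "open W" "W \<subseteq> B" "x0 \<in> W"
    using continuous_open_preimage[OF smooth_on_continuous[OF smf] B(1), of "{0<..}"] B v(2)
    by (auto simp: W_def f_def)
  have fpos: "f x > 0" if "x \<in> W" for x using that by (simp add: W_def)
  define \<rho> where "\<rho> x = inverse (f x)" for x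
  have sm\<rho>: "smooth_on W \<rho>" unfolding \<rho>_def[abs_def]
    by (rule smooth_on_inverse[OF smooth_on_subset[OF smf W(1,2)]]) (use fpos in force)
  have \<rho>pos: "\<rho> x > 0" if "x \<in> W" for x using fpos[OF that] by (simp add: \<rho>_def)
  have WU: "W \<subseteq> U" using W B by blast
  interpret W: rank_one_envelope W P "\<lambda>x. \<rho> x *\<^sub>R \<sigma> x"
    by (rule rescale[OF W(1) WU sm\<rho> \<rho>pos])
  have "riemann (induced_metric (\<lambda>x. \<rho> x *\<^sub>R \<sigma> x)) x X Y Z = 0" if "x \<in> W" for x X Y Z
  proof (rule W.flat_of_parallel_null_normal[OF that smooth_on_subset[OF v(1) W(1,2)]])
    fix y assume y: "y \<in> W"
    then have yB: "y \<in> B" using W by blast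
    show "P y (v y) = v y" "lor (v y) (v y) = 0" "P y (dir_deriv X v y) = 0" for X using v yB by auto
    show "lor (v y) (\<rho> y *\<^sub>R \<sigma> y) = -1" using fpos[OF y] by (simp add: lor_simps \<rho>_def f_def field_simps)
  qed
  then show ?thesis using \<rho>pos by (intro that[OF W(1,3) WU sm\<rho>]) blast+
qed

end

section \<open>Traces and null rotations in dimension two\<close>

lemma bilinear_axis_expansion:
  fixes B :: "real^'m::finite \<Rightarrow> real^'m \<Rightarrow> 'b::real_vector"
  assumes B: "bilinear B"
  shows "B X Y = (\<Sum>i\<in>UNIV. \<Sum>j\<in>UNIV. (X $ i * Y $ j) *\<^sub>R B (axis i 1) (axis j 1))"
proof -
  have l: "linear (\<lambda>X. B X Y)" "linear (B X)" for X Y using B by (simp_all add: bilinear_def)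
  have e: "Z = (\<Sum>i\<in>UNIV. Z $ i *\<^sub>R axis i 1)" for Z :: "real^'m"
    using basis_expansion[of Z] by (simp add: scalar_mult_eq_scaleR)
  have "B X Y = B (\<Sum>i\<in>UNIV. X $ i *\<^sub>R axis i 1) Y" by (simp only: e[symmetric])
  also have "\<dots> = (\<Sum>i\<in>UNIV. X $ i *\<^sub>R B (axis i 1) Y)"
    using linear_sum[OF l(1), of "\<lambda>i. X $ i *\<^sub>R axis i 1" UNIV Y] by (simp add: linear_scale[OF l(1)])
  also have "\<dots> = (\<Sum>i\<in>UNIV. X $ i *\<^sub>R B (axis i 1) (\<Sum>j\<in>UNIV. Y $ j *\<^sub>R axis j 1))"
    by (simp only: e[symmetric])
  also have "\<dots> = (\<Sum>i\<in>UNIV. X $ i *\<^sub>R (\<Sum>j\<in>UNIV. Y $ j *\<^sub>R B (axis i 1) (axis j 1)))"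
    by (simp only: linear_sum[OF l(2)] linear_scale[OF l(2)])
  finally show ?thesis by (simp add: scaleR_sum_right)
qed

lemma metric_trace_orthonormal:
  fixes g :: "real^'m::finite \<Rightarrow> real^'m \<Rightarrow> real" and B :: "real^'m \<Rightarrow> real^'m \<Rightarrow> 'b::real_vector"
  assumes g: "bilinear g" and B: "bilinear B"
    and ex: "\<And>X. X = g X e1 *\<^sub>R e1 + g X e2 *\<^sub>R e2"
  shows "metric_trace g B = B e1 e1 + B e2 e2"
proof -
  \<comment> \<open>The inverse Gram matrix as the sum of the dyads of an orthonormal frame; the
    expansion \<open>ex\<close> of the coordinate vectors verifies it.\<close>
  define M where "M = ((\<chi> i j. e1 $ i * e1 $ j + e2 $ i * e2 $ j) :: real^'m^'m)"
  let ?G = "(\<chi> a b. g (axis a 1) (axis b 1)) :: real^'m^'m"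
  have lg: "(\<Sum>j\<in>UNIV. g X (axis j 1) * e $ j) = g X e" for X e
  proof -
    have "linear (g X)" using g by (simp add: bilinear_def)
    then have "g X (\<Sum>j\<in>UNIV. e $ j *\<^sub>R axis j 1) = (\<Sum>j\<in>UNIV. e $ j * g X (axis j 1))"
      by (simp add: linear_sum linear_scale)
    then show ?thesis using basis_expansion[of e] by (simp add: scalar_mult_eq_scaleR mult.commute)
  qed
  have "(?G ** M) $ i $ l = mat 1 $ i $ l" for i l
  proof -
    have "(?G ** M) $ i $ l = (\<Sum>j\<in>UNIV. g (axis i 1) (axis j 1) * (e1 $ j * e1 $ l + e2 $ j * e2 $ l))"
      by (simp add: matrix_matrix_mult_def M_def)
    also have "\<dots> = (\<Sum>j\<in>UNIV. g (axis i 1) (axis j 1) * e1 $ j) * e1 $ l + (\<Sum>j\<in>UNIV. g (axis i 1) (axis j 1) * e2 $ j) * e2 $ l"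
      by (simp add: sum_distrib_right sum.distrib distrib_left mult.assoc)
    also have "\<dots> = (g (axis i 1) e1 *\<^sub>R e1 + g (axis i 1) e2 *\<^sub>R e2) $ l" by (simp add: lg)
    also have "\<dots> = axis i 1 $ l" by (simp only: ex[symmetric])
    also have "\<dots> = mat 1 $ i $ l" by (simp add: mat_def axis_def)
    finally show ?thesis .
  qed
  then have "?G ** M = mat 1" by (simp add: vec_eq_iff)
  then have "matrix_inv ?G = M" by (rule matrix_inv_eqI)
  then have "metric_trace g B = (\<Sum>i\<in>UNIV. \<Sum>j\<in>UNIV. (e1 $ i * e1 $ j + e2 $ i * e2 $ j) *\<^sub>R B (axis i 1) (axis j 1))"
    unfolding metric_trace_def by (simp add: M_def)
  also have "\<dots> = B e1 e1 + B e2 e2"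
    unfolding bilinear_axis_expansion[OF B, of e1 e1] bilinear_axis_expansion[OF B, of e2 e2]
    by (simp add: scaleR_add_left sum.distrib)
  finally show ?thesis .
qed

lemma orthonormal_expansion:
  fixes g :: "real^'m::finite \<Rightarrow> real^'m \<Rightarrow> real"
  assumes two: "CARD('m) = 2" and g: "bilinear g"
    and on: "g e1 e1 = 1" "g e2 e2 = 1" "g e1 e2 = 0" "g e2 e1 = 0"
  shows "X = g X e1 *\<^sub>R e1 + g X e2 *\<^sub>R e2"
proof -
  note bil = bilinear_simps[OF g]
  have e2: "e2 \<noteq> 0" using on bilinear_lzero[OF g] by force
  have "e1 \<notin> span {e2}"
  proof
    assume "e1 \<in> span {e2}"
    then obtain k where k: "e1 = k *\<^sub>R e2" unfolding span_singleton by blast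
    then have "g e1 e2 = k" using on by (simp add: bil)
    then have "e1 = 0" using k on by simp
    then show False using on bilinear_lzero[OF g] by force
  qed
  then have "independent {e1, e2}" using e2 by (simp add: independent_insert)
  moreover have "card {e1, e2} = 2"
    using \<open>e1 \<notin> span {e2}\<close> by (metis card_2_iff span_base singletonI)
  ultimately have "UNIV \<subseteq> span {e1, e2}"
    using two by (intro card_ge_dim_independent) auto
  then have "X \<in> span {e1, e2}" by blast
  then obtain a where "X - a *\<^sub>R e1 \<in> span {e2}" unfolding span_insert by blast
  then obtain c where "X - a *\<^sub>R e1 = c *\<^sub>R e2" unfolding span_singleton by blast
  then have X: "X = a *\<^sub>R e1 + c *\<^sub>R e2" by (simp add: algebra_simps)
  have "g X e1 = a" "g X e2 = c" unfolding X by (simp_all add: bil on)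
  then show ?thesis using X by simp
qed

text \<open>For null \<open>s\<close> orthogonal to \<open>t\<close>, this is the exponential of \<open>s \<and> t / 2\<close>.\<close>

definition null_rotation :: "'k::finite mink \<Rightarrow> 'k mink \<Rightarrow> 'k mink \<Rightarrow> 'k mink" where
  "null_rotation s t z = z - (lor z s / 2) *\<^sub>R t + (lor z t / 2) *\<^sub>R s - (lor t t * lor z s / 8) *\<^sub>R s"

lemma linear_null_rotation: "linear (null_rotation s t)"
  by (rule linearI)
    (simp_all add: null_rotation_def lor_simps scaleR_add_left add_divide_distrib
      distrib_left algebra_simps)

lemma null_rotation_fix: "lor z s = 0 \<Longrightarrow> lor z t = 0 \<Longrightarrow> null_rotation s t z = z"
  by (simp add: null_rotation_def)

lemma null_rotation_isometry:
  assumes "lor s s = 0" "lor s t = 0"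
  shows "lor (null_rotation s t u) (null_rotation s t v) = lor u v"
proof -
  have c: "lor t s = 0" "lor s u = lor u s" "lor t u = lor u t" "lor s v = lor v s" "lor t v = lor v t"
    using assms lor_commute by metis+
  show ?thesis
    unfolding null_rotation_def
    by (simp add: lor_simps assms c field_simps)
qed

lemma null_rotation_inverse:
  assumes "lor s s = 0" "lor s t = 0"
  shows "null_rotation s t (null_rotation s (- t) z) = z"
proof -
  have c: "lor t s = 0" using assms lor_commute by metis
  have 1: "lor (null_rotation s (- t) z) s = lor z s"
    by (simp add: null_rotation_def lor_simps assms c)
  have 2: "lor (null_rotation s (- t) z) t = lor z t + lor z s / 2 * lor t t"
    by (simp add: null_rotation_def lor_simps assms c)
  show ?thesis
    unfolding null_rotation_def[of s t "null_rotation s (- t) z"] 1 2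
    by (simp add: null_rotation_def lor_simps add_divide_distrib scaleR_add_left algebra_simps)
      (simp add: scaleR_add_left[symmetric])
qed

text \<open>An isometry conjugates the projection onto W into the projection onto its image, and the
  inverse isometry is the rotation by - t.\<close>

lemma lproj_null_rotation:
  assumes s: "lor s s = 0" "lor s t = 0" and W: "nondegenerate W"
  shows "nondegenerate (null_rotation s t ` W)"
    "lproj (null_rotation s t ` W) z = null_rotation s t (lproj W (null_rotation s (- t) z))"
proof -
  let ?R = "null_rotation s t"
  show nd: "nondegenerate (?R ` W)"
    using W linear_subspace_image[OF linear_null_rotation[of s t]] linear_0[OF linear_null_rotation[of s t]]
    by (auto simp: nondegenerate_def null_rotation_isometry[OF s])
  show "lproj (?R ` W) z = ?R (lproj W (null_rotation s (- t) z))"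
  proof (rule lproj_eqI[OF nd])
    show "?R (lproj W (null_rotation s (- t) z)) \<in> ?R ` W" using lproj_nondegenerate(1)[OF W] by blast
    have "z - ?R (lproj W (null_rotation s (- t) z)) = ?R (null_rotation s (- t) z - lproj W (null_rotation s (- t) z))"
      by (simp add: linear_diff[OF linear_null_rotation] null_rotation_inverse[OF s])
    then show "z - ?R (lproj W (null_rotation s (- t) z)) \<in> perp (?R ` W)"
      using perpD(1)[OF lproj_nondegenerate(2)[OF W]] by (auto simp: perp_def null_rotation_isometry[OF s])
  qed
qed

lemma inj_null_rotation:
  assumes s: "lor s s = 0" "lor s t = 0"
  shows "inj (null_rotation s t)"
proof (rule injI)
  fix u v assume "null_rotation s t u = null_rotation s t v"
  then have "null_rotation s t (u - v) = 0" by (simp add: linear_diff[OF linear_null_rotation])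
  then have "lor (u - v) w = 0" for w
    using null_rotation_isometry[OF s, of "u - v" w] by (simp add: lor.zero_left)
  then show "u = v" using lor_nondegenerate[of "u - v"] by simp
qed

text \<open>Only s \<and> t matters. This makes the rotated congruence independent of the section,
  since the mean normal scales inversely to \<sigma>.\<close>

lemma null_rotation_rescale: "c \<noteq> 0 \<Longrightarrow> null_rotation (c *\<^sub>R s) ((1 / c) *\<^sub>R t) = null_rotation s t"
  by (rule ext) (simp add: null_rotation_def lor_simps)

lemma has_signature_null_rotation:
  assumes s: "lor s s = 0" "lor s t = 0" and W: "has_signature W p q"
  shows "has_signature (null_rotation s t ` W) p q"
proof -
  let ?R = "null_rotation s t"
  note lin = linear_null_rotation[of s t]
  note inj = inj_null_rotation[OF s]
  obtain P N where PN: "subspace P" "subspace N" "dim P = p" "dim N = q" "W = {v + w | v w. v \<in> P \<and> w \<in> N}"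
    "\<forall>v\<in>P. v \<noteq> 0 \<longrightarrow> lor v v > 0" "\<forall>w\<in>N. w \<noteq> 0 \<longrightarrow> lor w w < 0" "\<forall>v\<in>P. \<forall>w\<in>N. lor v w = 0"
    using W unfolding has_signature_def by (elim exE conjE) (rule that)
  have z: "?R v \<noteq> 0 \<Longrightarrow> v \<noteq> 0" for v using linear_0[OF lin] by auto
  show ?thesis
    unfolding has_signature_def
  proof (intro exI conjI)
    show "subspace (?R ` P)" "subspace (?R ` N)" using linear_subspace_image[OF lin] PN by auto
    show "dim (?R ` P) = p" "dim (?R ` N) = q"
      using dim_image_eq[OF lin] inj_on_subset[OF inj] PN by auto
    show "?R ` W = {v + w |v w. v \<in> ?R ` P \<and> w \<in> ?R ` N}"
    proof -
      have "?R ` W = {?R (v + w) |v w. v \<in> P \<and> w \<in> N}" unfolding PN(5) by blast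
      also have "\<dots> = {v + w |v w. v \<in> ?R ` P \<and> w \<in> ?R ` N}" unfolding linear_add[OF lin] by blast
      finally show ?thesis .
    qed
  qed (use PN z in \<open>auto simp: null_rotation_isometry[OF s]\<close>)
qed

text \<open>Minus the trace of \<open>II\<close> for V, the obstruction to V being central.\<close>

definition mean_normal :: "(real^'m::finite \<Rightarrow> 'k::finite mink \<Rightarrow>\<^sub>L 'k mink) \<Rightarrow> (real^'m \<Rightarrow> 'k mink) \<Rightarrow> real^'m \<Rightarrow> 'k mink" where
  "mean_normal P \<sigma> x = metric_trace (induced_metric \<sigma> x) (normal_hessian P \<sigma> x)"

text \<open>The final factor 1/2 makes this the coefficient of \<sigma> in \<open>II_VS\<close>, and
  so the correction of the Schouten tensor in \<open>schouten_eq\<close>.\<close>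

definition channel_potential :: "(real^'m::finite \<Rightarrow> 'k::finite mink \<Rightarrow>\<^sub>L 'k mink) \<Rightarrow> (real^'m \<Rightarrow> 'k mink) \<Rightarrow> 'm tensor2" where
  "channel_potential P \<sigma> x X Y = lor (mean_normal P \<sigma> x)
      (normal_hessian P \<sigma> x X Y - (induced_metric \<sigma> x X Y / 2) *\<^sub>R mean_normal P \<sigma> x) / 2"

locale channel_surface = nondegenerate_bundle U P F + rank_one_envelope U P \<sigma>
  for U :: "(real^'m::finite) set" and P :: "real^'m \<Rightarrow> 'k::finite mink \<Rightarrow>\<^sub>L 'k mink"
    and F :: "real^'m \<Rightarrow> 'k mink set" and \<sigma> :: "real^'m \<Rightarrow> 'k mink" +
  assumes two: "CARD('m) = 2"
    and bundle_F: "smooth_subbundle (CARD('m) + 2) U F"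
begin

abbreviation "tr x \<equiv> metric_trace (g x)"
abbreviation "mn \<equiv> mean_normal P \<sigma>"
abbreviation "b0 x X Y \<equiv> b x X Y - (g x X Y / 2) *\<^sub>R mn x"
abbreviation "q \<equiv> channel_potential P \<sigma>"

section \<open>Traces in orthonormal frames at a point\<close>

definition orthonormal_frame :: "real^'m \<Rightarrow> real^'m \<Rightarrow> real^'m \<Rightarrow> bool" where
  "orthonormal_frame x e1 e2 \<longleftrightarrow> g x e1 e1 = 1 \<and> g x e2 e2 = 1 \<and> g x e1 e2 = 0 \<and> g x e2 e1 = 0"

lemma frame_expansion:
  assumes "x \<in> U" "orthonormal_frame x e1 e2"
  shows "X = g x X e1 *\<^sub>R e1 + g x X e2 *\<^sub>R e2"
  using assms(2) by (intro orthonormal_expansion[OF two bilinear_g[OF assms(1)]]) (auto simp: orthonormal_frame_def)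

lemma frame_trace:
  assumes "x \<in> U" "orthonormal_frame x e1 e2" "bilinear B"
  shows "tr x B = B e1 e1 + B e2 e2"
  by (rule metric_trace_orthonormal[OF bilinear_g[OF assms(1)] assms(3) frame_expansion[OF assms(1,2)]])

lemma frame_exists:
  assumes x: "x \<in> U"
  shows "\<exists>e1 e2. orthonormal_frame x e1 e2"
proof -
  note bg = bilinear_g[OF x]
  note bil = bilinear_simps[OF bg]
  have normalise: "g x ((1 / sqrt (g x X X)) *\<^sub>R X) ((1 / sqrt (g x X X)) *\<^sub>R X) = 1" if "X \<noteq> 0" for X
    using g_pos[OF x that] unfolding bil by (simp add: field_simps)
  define X1 where "X1 = (axis (SOME i. True) 1 :: real^'m)"
  have X1: "X1 \<noteq> 0" by (simp add: X1_def)
  define e1 where "e1 = (1 / sqrt (g x X1 X1)) *\<^sub>R X1"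
  have e1: "g x e1 e1 = 1" unfolding e1_def by (rule normalise[OF X1])
  have "span {e1} \<noteq> UNIV"
  proof
    assume "span {e1} = UNIV"
    then have "dim (UNIV :: (real^'m) set) \<le> card {e1}" by (intro dim_le_card) auto
    then show False using two by simp
  qed
  then obtain X2 where X2: "X2 \<notin> span {e1}" by blast
  define Y where "Y = X2 - g x X2 e1 *\<^sub>R e1"
  have "Y \<noteq> 0"
  proof
    assume "Y = 0"
    then have "X2 = g x X2 e1 *\<^sub>R e1" by (simp add: Y_def)
    then have "X2 \<in> span {e1}" unfolding span_singleton by blast
    then show False using X2 by blast
  qed
  then have e2: "g x ((1 / sqrt (g x Y Y)) *\<^sub>R Y) ((1 / sqrt (g x Y Y)) *\<^sub>R Y) = 1" by (rule normalise)
  have "g x Y e1 = 0" by (simp add: Y_def bil e1)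
  then have e21: "g x ((1 / sqrt (g x Y Y)) *\<^sub>R Y) e1 = 0" by (simp add: bil)
  then have e12: "g x e1 ((1 / sqrt (g x Y Y)) *\<^sub>R Y) = 0" by (subst g_sym)
  have "orthonormal_frame x e1 ((1 / sqrt (g x Y Y)) *\<^sub>R Y)"
    unfolding orthonormal_frame_def by (intro conjI e1 e2 e12 e21)
  then show ?thesis by blast
qed

text \<open>Orthonormal frames are only available pointwise, so smoothness is taken from the
  definition of the trace: each column of the inverse Gram matrix solves a linear system with smooth
  coefficients.\<close>

lemma smooth_tr:
  assumes "\<And>X Y. smooth_on U (\<lambda>x. B x X Y)"
  shows "smooth_on U (\<lambda>x. tr x (B x))"
proof -
  have "smooth_on U (\<lambda>x. matrix_inv (Gram x) $ k $ j)" for k j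
  proof -
    have "smooth_on U (\<lambda>x. column j (matrix_inv (Gram x)) $ k)"
    proof (rule smooth_on_linear_system[OF open_U, where A = Gram and b = "\<lambda>_. axis j 1"])
      show "smooth_on U (\<lambda>x. Gram x $ i $ l)" for i l by (simp add: smooth_g)
      show "smooth_on U (\<lambda>x. axis j 1 $ i)" for i by (rule smooth_on_const[OF open_U])
      show "x \<in> U \<Longrightarrow> det (Gram x) \<noteq> 0" for x by (rule det_Gram)
      show "Gram x *v column j (matrix_inv (Gram x)) = axis j 1" if "x \<in> U" for x
      proof -
        have "Gram x ** matrix_inv (Gram x) = mat 1"
          using det_Gram[OF that] by (intro matrix_inv_right_inverse) (simp add: invertible_det_nz)
        then have "(\<Sum>l\<in>UNIV. Gram x $ i $ l * matrix_inv (Gram x) $ l $ j) = mat 1 $ i $ j" for i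
          by (simp add: matrix_matrix_mult_def vec_eq_iff)
        then show ?thesis
          by (simp add: vec_eq_iff matrix_vector_mult_def column_def mat_def axis_def)
      qed
    qed
    then show ?thesis by (simp add: column_def)
  qed
  then show ?thesis
    unfolding metric_trace_def by (intro smooth_on_sum smooth_on_scaleR assms open_U)
qed

lemma smooth_b: "smooth_on U (\<lambda>x. b x X Y)"
  unfolding b_def
  by (rule smooth_on_blinfun_apply[OF smooth_on_dir_deriv[OF smooth_P] smooth_d\<sigma>])

lemma smooth_mn: "smooth_on U mn"
  unfolding mean_normal_def[abs_def] by (rule smooth_tr[OF smooth_b])

lemma smooth_q: "smooth_on U (\<lambda>x. q x X Y)"
proof -
  have "smooth_on U (\<lambda>x. (1 / 2) * lor (mn x) (b x X Y - ((1 / 2) * g x X Y) *\<^sub>R mn x))"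
    by (intro smooth_on_mult smooth_on_const open_U smooth_on_lor
        smooth_on_diff smooth_on_scaleR smooth_mn smooth_b smooth_g)
  then show ?thesis by (simp add: channel_potential_def)
qed

lemma bilinear_q: "x \<in> U \<Longrightarrow> bilinear (q x)"
proof -
  assume x: "x \<in> U"
  note bil = bilinear_simps[OF bilinear_g[OF x]] bilinear_simps[OF bilinear_b[OF x]]
  show ?thesis
    unfolding bilinear_def channel_potential_def
    by (auto intro!: linearI simp: bil lor_simps field_simps)
qed

lemma q_sym: "x \<in> U \<Longrightarrow> q x X Y = q x Y X"
  by (simp add: channel_potential_def b_sym[of x X Y] g_sym[of x X Y])

lemma P_mn: "x \<in> U \<Longrightarrow> P x (mn x) = 0"
proof -
  assume x: "x \<in> U"
  obtain e1 e2 where e: "orthonormal_frame x e1 e2" using frame_exists[OF x] by blast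
  show ?thesis by (simp add: mean_normal_def frame_trace[OF x e bilinear_b[OF x]] blinfun.add_right P_b[OF x])
qed

lemma lor_P_mn: "x \<in> U \<Longrightarrow> P x v = v \<Longrightarrow> lor v (mn x) = 0"
  using P_adj[of x v "mn x"] P_mn[of x] by (simp add: lor.zero_right)

lemma tr_b0: "x \<in> U \<Longrightarrow> bilinear (\<lambda>X Y. b0 x X Y) \<and> tr x (b0 x) = 0"
proof
  assume x: "x \<in> U"
  note bil = bilinear_simps[OF bilinear_g[OF x]] bilinear_simps[OF bilinear_b[OF x]]
  show B: "bilinear (\<lambda>X Y. b0 x X Y)"
    unfolding bilinear_def by (auto intro!: linearI simp: bil algebra_simps add_divide_distrib)
  obtain e1 e2 where e: "orthonormal_frame x e1 e2" using frame_exists[OF x] by blast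
  have mn: "mn x = b x e1 e1 + b x e2 e2" unfolding mean_normal_def by (rule frame_trace[OF x e bilinear_b[OF x]])
  have "tr x (b0 x) = b0 x e1 e1 + b0 x e2 e2" by (rule frame_trace[OF x e B])
  also have "\<dots> = (b x e1 e1 + b x e2 e2) - ((1 / 2) *\<^sub>R mn x + (1 / 2) *\<^sub>R mn x)"
    using e by (simp only: orthonormal_frame_def add_diff_add)
  also have "(1 / 2) *\<^sub>R mn x + (1 / 2) *\<^sub>R mn x = mn x" by (simp flip: scaleR_add_left)
  finally show "tr x (b0 x) = 0" using mn by simp
qed

end

section \<open>The Cotton--York potential\<close>

context channel_surface
begin

definition VS :: "real^'m \<Rightarrow> 'k mink set" where
  "VS x = null_rotation (\<sigma> x) (mn x) ` F x"

lemma \<sigma>_mn: "x \<in> U \<Longrightarrow> lor (\<sigma> x) (mn x) = 0"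
  by (rule lor_P_mn[OF _ P_\<sigma>])

lemma nondegenerate_VS: "x \<in> U \<Longrightarrow> nondegenerate (VS x)"
  unfolding VS_def by (rule lproj_null_rotation(1)[OF null \<sigma>_mn nondeg])

text \<open>Conjugate P by the rotation. The inverse rotation contributes half of (z, t), and the
  rotation and its inverse each contribute an eighth of (t, t) (z, \<sigma>), which gives the
  quarter.\<close>

lemma lproj_VS:
  assumes x: "x \<in> U"
  shows "lproj (VS x) z = P x z - (lor z (\<sigma> x) / 2) *\<^sub>R mn x
      - (lor z (mn x) / 2 + lor (mn x) (mn x) * lor z (\<sigma> x) / 4) *\<^sub>R \<sigma> x"
proof -
  let ?a = "lor z (\<sigma> x)" and ?c = "lor z (mn x)" and ?N = "lor (mn x) (mn x)"
  have 1: "P x (null_rotation (\<sigma> x) (- mn x) z) = P x z - (?c / 2 + ?N * ?a / 8) *\<^sub>R \<sigma> x"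
    by (simp add: null_rotation_def blinfun_simps
        P_\<sigma>[OF x] P_mn[OF x] lor_simps scaleR_add_left)
  have 2: "lor (P x z) (\<sigma> x) = ?a" "lor (P x z) (mn x) = 0"
    using P_adj[OF x, of z "\<sigma> x"] P_adj[OF x, of z "mn x"] by (simp_all add: P_\<sigma>[OF x] P_mn[OF x] lor.zero_right)
  have 3: "null_rotation (\<sigma> x) (mn x) (P x z) = P x z - (?a / 2) *\<^sub>R mn x - (?N * ?a / 8) *\<^sub>R \<sigma> x"
    by (simp add: null_rotation_def 2)
  have 4: "null_rotation (\<sigma> x) (mn x) (\<sigma> x) = \<sigma> x" by (rule null_rotation_fix[OF null[OF x] \<sigma>_mn[OF x]])
  have "lproj (VS x) z = null_rotation (\<sigma> x) (mn x) (P x z - (?c / 2 + ?N * ?a / 8) *\<^sub>R \<sigma> x)"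
    unfolding VS_def lproj_null_rotation(2)[OF null[OF x] \<sigma>_mn[OF x] nondeg[OF x]] lproj_P[OF x] 1 ..
  also have "\<dots> = P x z - (?a / 2) *\<^sub>R mn x - (?N * ?a / 8) *\<^sub>R \<sigma> x - (?c / 2 + ?N * ?a / 8) *\<^sub>R \<sigma> x"
    unfolding linear_diff[OF linear_null_rotation] linear_scale[OF linear_null_rotation] 3 4 ..
  also have "\<dots> = P x z - (?a / 2) *\<^sub>R mn x - (?N * ?a / 8 + (?c / 2 + ?N * ?a / 8)) *\<^sub>R \<sigma> x"
    unfolding scaleR_add_left by simp
  also have "?N * ?a / 8 + (?c / 2 + ?N * ?a / 8) = ?c / 2 + ?N * ?a / 4" by simp
  finally show ?thesis .
qed

lemma lproj_VS_fix: "x \<in> U \<Longrightarrow> P x z = z \<Longrightarrow> lor z (\<sigma> x) = 0 \<Longrightarrow> lproj (VS x) z = z"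
  by (simp add: lproj_VS lor_P_mn)

lemma mem_VS: "x \<in> U \<Longrightarrow> P x z = z \<Longrightarrow> lor z (\<sigma> x) = 0 \<Longrightarrow> z \<in> VS x"
  using lproj_nondegenerate(1)[OF nondegenerate_VS, of x z] lproj_VS_fix by simp

lemma \<sigma>_VS: "x \<in> U \<Longrightarrow> \<sigma> x \<in> VS x"
  by (rule mem_VS[OF _ P_\<sigma> null])

lemma d\<sigma>_VS: "x \<in> U \<Longrightarrow> dir_deriv X \<sigma> x \<in> VS x"
  by (rule mem_VS[OF _ P_d\<sigma> lor_d\<sigma>_\<sigma>])

lemma subbundle_VS: "smooth_subbundle (CARD('m) + 2) U VS"
  unfolding smooth_subbundle_def
proof
  fix x assume x: "x \<in> U"
  obtain W s where Ws: "open W \<and> x \<in> W \<and> W \<subseteq> U \<and> (\<forall>i<CARD('m) + 2. smooth_on W (s i)) \<and>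
      (\<forall>y\<in>W. F y = span ((\<lambda>i::nat. s i y) ` {..<CARD('m) + 2}) \<and> dim (F y) = CARD('m) + 2)"
    using bspec[OF bundle_F[unfolded smooth_subbundle_def] x] by (elim exE) (rule that)
  let ?s = "\<lambda>i y. null_rotation (\<sigma> y) (mn y) (s i y)"
  have W: "open W" "W \<subseteq> U" using Ws by auto
  have "smooth_on W (?s i)" if "i < CARD('m) + 2" for i
  proof -
    have si: "smooth_on W (s i)" using Ws that by blast
    have "smooth_on W (\<lambda>y. s i y - ((1 / 2) * lor (s i y) (\<sigma> y)) *\<^sub>R mn y + ((1 / 2) * lor (s i y) (mn y)) *\<^sub>R \<sigma> y
        - ((1 / 8) * (lor (mn y) (mn y) * lor (s i y) (\<sigma> y))) *\<^sub>R \<sigma> y)"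
      by (intro smooth_on_add smooth_on_diff smooth_on_scaleR smooth_on_mult smooth_on_const W si
          smooth_on_lor smooth_on_subset[OF smooth_\<sigma> W] smooth_on_subset[OF smooth_mn W])
    then show ?thesis by (simp add: null_rotation_def)
  qed
  moreover have "VS y = span ((\<lambda>i. ?s i y) ` {..<CARD('m) + 2}) \<and> dim (VS y) = CARD('m) + 2" if y: "y \<in> W" for y
  proof
    have yU: "y \<in> U" using y W by blast
    have F: "F y = span ((\<lambda>i::nat. s i y) ` {..<CARD('m) + 2})" "dim (F y) = CARD('m) + 2" using Ws y by blast+
    show "VS y = span ((\<lambda>i. ?s i y) ` {..<CARD('m) + 2})"
      unfolding VS_def F(1) linear_span_image[OF linear_null_rotation, symmetric] image_image ..
    show "dim (VS y) = CARD('m) + 2"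
      unfolding VS_def F(2)[symmetric]
      by (rule dim_image_eq[OF linear_null_rotation])
        (rule inj_on_subset[OF inj_null_rotation[OF null[OF yU] \<sigma>_mn[OF yU]] subset_UNIV])
  qed
  ultimately show "\<exists>W s. open W \<and> x \<in> W \<and> W \<subseteq> U \<and> (\<forall>i<CARD('m) + 2. smooth_on W (s i)) \<and>
      (\<forall>y\<in>W. VS y = span ((\<lambda>i::nat. s i y) ` {..<CARD('m) + 2}) \<and> dim (VS y) = CARD('m) + 2)"
    using Ws by (intro exI[of _ W] exI[of _ ?s]) blast
qed

lemma q_eq: "q x X Y = lor (b x X Y) (mn x) / 2 - g x X Y * lor (mn x) (mn x) / 4"
  by (simp add: channel_potential_def lor_simps lor_commute[of "mn x" "b x X Y"])

text \<open>For z = dd\<sigma> the products entering \<open>lproj_VS\<close> are (z, \<sigma>) = - g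
  and (z, t) = (b, t). The first replaces b by its tracefree part, and the coefficients of \<sigma>
  combine to q.\<close>

lemma II_VS:
  assumes x: "x \<in> U"
  shows "II VS \<sigma> x X Y = - (b0 x X Y + q x X Y *\<^sub>R \<sigma> x)"
proof -
  interpret VS: nondegenerate_bundle U "\<lambda>x. Blinfun (lproj (VS x))" VS
    by (rule projection_of_bundle[OF subbundle_VS open_U nondegenerate_VS])
  let ?z = "dir_deriv X (dir_deriv Y \<sigma>) x"
  have "N_form VS X (dir_deriv Y \<sigma>) x = ?z - Blinfun (lproj (VS x)) ?z"
    by (rule VS.N_form_section[OF x diff_d\<sigma>[OF x] VS.P_id[OF _ d\<sigma>_VS]])
  also have "\<dots> = ?z - lproj (VS x) ?z" by (simp add: VS.lproj_P[OF x])
  finally have N: "N_form VS X (dir_deriv Y \<sigma>) x = ?z - lproj (VS x) ?z" .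
  have z: "lor ?z (\<sigma> x) = - g x X Y" by (rule lor_dd\<sigma>_\<sigma>[OF x])
  have "lor ?z (mn x) = lor (P x ?z) (mn x) + lor (b x X Y) (mn x)"
    by (simp add: b_eq[OF x] lor.diff_left)
  then have zm: "lor ?z (mn x) = lor (b x X Y) (mn x)" using lor_P_mn[OF x P_idem[OF x]] by simp
  have "?z - lproj (VS x) ?z = b x X Y - (g x X Y / 2) *\<^sub>R mn x + q x X Y *\<^sub>R \<sigma> x"
    unfolding lproj_VS[OF x] z zm q_eq by (simp add: b_eq[OF x] algebra_simps)
  then show ?thesis unfolding II_def N by simp
qed

lemma tr_q: "x \<in> U \<Longrightarrow> tr x (q x) = 0"
proof -
  assume x: "x \<in> U"
  obtain e1 e2 where e: "orthonormal_frame x e1 e2" using frame_exists[OF x] by blast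
  have "b0 x e1 e1 + b0 x e2 e2 = 0"
    using tr_b0[OF x] frame_trace[OF x e, of "b0 x"] by simp
  then have "lor (mn x) (b0 x e1 e1 + b0 x e2 e2) = 0" by (simp add: lor.zero_right)
  then show ?thesis
    unfolding frame_trace[OF x e bilinear_q[OF x]] by (simp add: channel_potential_def lor.add_right)
qed

lemma tr_II_VS: "x \<in> U \<Longrightarrow> tr x (II VS \<sigma> x) = 0"
proof -
  assume x: "x \<in> U"
  obtain e1 e2 where e: "orthonormal_frame x e1 e2" using frame_exists[OF x] by blast
  have B: "bilinear (b0 x)" using tr_b0[OF x] by simp
  have bl: "bilinear (\<lambda>X Y. - (b0 x X Y + q x X Y *\<^sub>R \<sigma> x))"
    unfolding bilinear_def
    by (auto intro!: linearI simp: bilinear_simps[OF B]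
        bilinear_simps[OF bilinear_q[OF x]] scaleR_add_left scaleR_add_right scaleR_diff_right simp del: minus_diff_eq)
  have "tr x (II VS \<sigma> x) = tr x (\<lambda>X Y. - (b0 x X Y + q x X Y *\<^sub>R \<sigma> x))"
    by (rule arg_cong[of _ _ "tr x"]) (intro ext II_VS[OF x])
  also have "\<dots> = - ((b0 x e1 e1 + b0 x e2 e2) + (q x e1 e1 + q x e2 e2) *\<^sub>R \<sigma> x)"
    unfolding frame_trace[OF x e bl] by (simp add: algebra_simps)
  also have "\<dots> = 0"
    using tr_b0[OF x] frame_trace[OF x e B] tr_q[OF x] frame_trace[OF x e bilinear_q[OF x]] by simp
  finally show ?thesis .
qed

text \<open>The null vector of V orthogonal to d\<sigma> with (w, \<sigma>) = -1, the
  \<open>w\<close> of \<open>H_decomposition\<close>, written by a formula that is visibly smooth: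
  the trace of H pairs to -2 with \<sigma>, so half its V-part has the right product, and a multiple
  of \<sigma> makes it null. The tensor r below plays the role of the Schouten tensor for V.\<close>

definition w :: "real^'m \<Rightarrow> 'k mink" where
  "w x = (let y = (1 / 2) *\<^sub>R P x (tr x (H x)) in y + (lor y y / 2) *\<^sub>R \<sigma> x)"

abbreviation "r x X Y \<equiv> lor (dir_deriv X (dir_deriv Y \<sigma>) x) (w x)"

lemma bilinear_H: "x \<in> U \<Longrightarrow> bilinear (H x)"
proof -
  assume x: "x \<in> U"
  have "H x X = (\<lambda>Y. H x Y X)" for X by (rule ext) (rule H_sym[OF x])
  then have "linear (H x X)" for X by (rule ssubst) (rule linear_H[OF x])
  then show ?thesis unfolding bilinear_def using linear_H[OF x] by blast
qed

lemma w_props: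
  assumes x: "x \<in> U"
  shows "P x (w x) = w x" "lor (w x) (w x) = 0" "lor (w x) (\<sigma> x) = -1" "lor (w x) (dir_deriv X \<sigma> x) = 0"
    "lor (tr x (H x)) (\<sigma> x) = - 2"
proof -
  obtain e1 e2 where e: "orthonormal_frame x e1 e2" using frame_exists[OF x] by blast
  have trH: "tr x (H x) = H x e1 e1 + H x e2 e2" by (rule frame_trace[OF x e bilinear_H[OF x]])
  define y where "y = (1 / 2) *\<^sub>R P x (tr x (H x))"
  have w: "w x = y + (lor y y / 2) *\<^sub>R \<sigma> x" by (simp add: w_def y_def Let_def)
  show t\<sigma>: "lor (tr x (H x)) (\<sigma> x) = - 2"
    using e by (simp add: trH lor.add_left lor_H_\<sigma>[OF x] orthonormal_frame_def)
  have y\<sigma>: "lor y (\<sigma> x) = -1"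
    using P_adj[OF x, of "tr x (H x)" "\<sigma> x"] t\<sigma> by (simp add: y_def lor.scaleR_left P_\<sigma>[OF x])
  have yd: "lor y (dir_deriv X \<sigma> x) = 0" for X
    using P_adj[OF x, of "tr x (H x)" "dir_deriv X \<sigma> x"]
    by (simp add: y_def lor.scaleR_left P_d\<sigma>[OF x] trH lor.add_left lor_H_d\<sigma>[OF x])
  have Py: "P x y = y" by (simp add: y_def blinfun.scaleR_right P_idem[OF x])
  show "P x (w x) = w x" by (simp add: w blinfun_simps Py P_\<sigma>[OF x])
  show "lor (w x) (w x) = 0"
    using y\<sigma> by (simp add: w lor_simps null[OF x] lor_commute[of "\<sigma> x" y])
  show "lor (w x) (\<sigma> x) = -1" using y\<sigma> by (simp add: w lor_simps null[OF x])
  have "lor (\<sigma> x) (dir_deriv X \<sigma> x) = 0" using lor_d\<sigma>_\<sigma>[OF x] lor_commute[of "\<sigma> x"] by simp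
  then show "lor (w x) (dir_deriv X \<sigma> x) = 0" by (simp add: w lor_simps yd)
qed

lemma smooth_w: "smooth_on U w"
proof -
  have y: "smooth_on U (\<lambda>x. (1 / 2) *\<^sub>R P x (tr x (H x)))"
    by (intro smooth_on_scaleR smooth_on_const open_U smooth_P_section smooth_tr smooth_H)
  have "smooth_on U (\<lambda>x. (1 / 2) *\<^sub>R P x (tr x (H x)) +
      ((1 / 2) * lor ((1 / 2) *\<^sub>R P x (tr x (H x))) ((1 / 2) *\<^sub>R P x (tr x (H x)))) *\<^sub>R \<sigma> x)"
    by (intro smooth_on_add smooth_on_scaleR[of U "\<lambda>x. (1 / 2) * _ x" \<sigma>] smooth_on_mult smooth_on_const open_U y smooth_\<sigma>
        smooth_on_lor[OF y y])
  then show ?thesis by (simp add: w_def[abs_def] Let_def)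
qed

lemma diff_w: "x \<in> U \<Longrightarrow> w differentiable (at x)"
  by (rule smooth_on_differentiable[OF smooth_w])

lemma H_eq: "x \<in> U \<Longrightarrow> H x X Y = g x X Y *\<^sub>R w x - r x X Y *\<^sub>R \<sigma> x + b x X Y"
  by (rule H_decomposition[OF _ w_props(1-4)])

lemma r_sym: "x \<in> U \<Longrightarrow> r x X Y = r x Y X"
  by (simp add: dd\<sigma>_commute[of x X Y])

lemma bilinear_r: "x \<in> U \<Longrightarrow> bilinear (\<lambda>X Y. r x X Y)"
proof -
  assume x: "x \<in> U"
  have l: "linear (\<lambda>X. dir_deriv X (dir_deriv Y \<sigma>) x)" for Y by (rule dir_deriv_linear[OF diff_d\<sigma>[OF x]])
  have 1: "linear (\<lambda>X. r x X Y)" for Y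
    by (rule linearI) (simp_all add: linear_add[OF l] linear_scale[OF l] lor_simps)
  have "(\<lambda>Y. r x X Y) = (\<lambda>Y. r x Y X)" for X by (rule ext) (rule r_sym[OF x])
  then have "linear (\<lambda>Y. r x X Y)" for X by (rule ssubst) (rule 1)
  then show ?thesis unfolding bilinear_def using 1 by blast
qed

lemma lor_w_b: "x \<in> U \<Longrightarrow> lor (w x) (b x X Y) = 0" "x \<in> U \<Longrightarrow> lor (\<sigma> x) (b x X Y) = 0"
  using lor_P_b[OF _ w_props(1)] lor_P_b[OF _ P_\<sigma>] lor_commute by metis+

lemma lor_H_H:
  assumes x: "x \<in> U"
  shows "lor (H x X Y) (H x Z W) = g x X Y * r x Z W + r x X Y * g x Z W + lor (b x X Y) (b x Z W)"
proof -
  have "lor (\<sigma> x) (w x) = -1" using w_props(3)[OF x] lor_commute[of "\<sigma> x"] by simp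
  moreover have "lor (b x X Y) (w x) = 0" "lor (b x X Y) (\<sigma> x) = 0"
    by (rule lor_P_b[OF x w_props(1)[OF x]] lor_P_b[OF x P_\<sigma>[OF x]])+
  ultimately show ?thesis
    unfolding H_eq[OF x]
    by (simp add: lor_simps
        w_props(2,3)[OF x] null[OF x] lor_w_b[OF x])
qed

text \<open>The normal terms in the Gauss equation cancel by \<open>dP_exchange\<close>. On a
  surface the remaining mixed product of g and r is the trace of r times the area form squared, as
  expansion in an orthonormal frame shows.\<close>

lemma gauss_curvature_eq:
  assumes x: "x \<in> U"
  shows "gauss_curvature g x = tr x (\<lambda>X Y. r x X Y)"
proof -
  obtain e1 e2 where e: "orthonormal_frame x e1 e2" using frame_exists[OF x] by blast
  let ?t = "r x e1 e1 + r x e2 e2"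
  have t: "tr x (\<lambda>X Y. r x X Y) = ?t" by (rule frame_trace[OF x e bilinear_r[OF x]])
  have key: "g x (riemann g x X Y Y) X = ?t * (g x X X * g x Y Y - (g x X Y)\<^sup>2)" for X Y
  proof -
    have "lor (b x Y Y) (b x X X) = lor (b x X Y) (b x Y X)"
      unfolding b_def by (rule dP_exchange(1)[OF x])
    then have 1: "g x (riemann g x X Y Y) X = g x Y Y * r x X X + r x Y Y * g x X X - 2 * (g x X Y * r x X Y)"
      unfolding gauss_equation[OF x] lor_H_H[OF x] g_sym[of x Y X] r_sym[OF x, of Y X] by simp
    define x1 x2 y1 y2 where "x1 = g x X e1" "x2 = g x X e2" "y1 = g x Y e1" "y2 = g x Y e2"
    have X: "X = x1 *\<^sub>R e1 + x2 *\<^sub>R e2" and Y: "Y = y1 *\<^sub>R e1 + y2 *\<^sub>R e2"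
      unfolding x1_x2_y1_y2_def by (rule frame_expansion[OF x e])+
    have exp: "B (a *\<^sub>R e1 + c *\<^sub>R e2) (a' *\<^sub>R e1 + c' *\<^sub>R e2)
        = a * a' * B e1 e1 + a * c' * B e1 e2 + c * a' * B e2 e1 + c * c' * B e2 e2"
      if B: "bilinear B" for B :: "real^'m \<Rightarrow> real^'m \<Rightarrow> real" and a c a' c'
      by (simp add: bilinear_simps[OF B] algebra_simps)
    show ?thesis
      unfolding 1 unfolding X Y exp[OF bilinear_g[OF x]] exp[OF bilinear_r[OF x]] r_sym[OF x, of e2 e1]
      using e by (simp add: orthonormal_frame_def power2_eq_square algebra_simps)
  qed
  show ?thesis
    unfolding gauss_curvature_def t
  proof (rule the_equality)
    show "\<forall>X Y. g x (riemann g x X Y Y) X = ?t * (g x X X * g x Y Y - (g x X Y)\<^sup>2)" using key by blast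
    \<comment> \<open>On an orthonormal pair the area factor is 1, so K is determined there.\<close>
    fix K assume "\<forall>X Y. g x (riemann g x X Y Y) X = K * (g x X X * g x Y Y - (g x X Y)\<^sup>2)"
    from this[rule_format, of e1 e2] key[of e1 e2] show "K = ?t" using e by (simp add: orthonormal_frame_def)
  qed
qed

text \<open>Projecting the tracefree Hessian along the rotated bundle gives \<open>r0\<close> as the
  tracefree part of r plus q. The curvature is the trace of r, so adding half of it times g restores
  the full r.\<close>

lemma schouten_eq:
  assumes x: "x \<in> U"
  shows "schouten VS \<sigma> x X Y = r x X Y + q x X Y"
proof -
  let ?t = "tr x (\<lambda>X Y. r x X Y)"
  let ?z = "tracefree_part (g x) (H x) X Y"
  obtain e1 e2 where e: "orthonormal_frame x e1 e2" using frame_exists[OF x] by blast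
  have z: "?z = H x X Y - (g x X Y / 2) *\<^sub>R tr x (H x)" by (simp add: tracefree_part_def two)
  have trb: "mn x = b x e1 e1 + b x e2 e2" unfolding mean_normal_def by (rule frame_trace[OF x e bilinear_b[OF x]])
  have trr: "?t = r x e1 e1 + r x e2 e2" by (rule frame_trace[OF x e bilinear_r[OF x]])
  have "tr x (H x) = H x e1 e1 + H x e2 e2" by (rule frame_trace[OF x e bilinear_H[OF x]])
  also have "\<dots> = 2 *\<^sub>R w x - ?t *\<^sub>R \<sigma> x + mn x"
    unfolding H_eq[OF x] trb trr using e by (simp add: orthonormal_frame_def scaleR_2 algebra_simps)
  finally have trH: "tr x (H x) = 2 *\<^sub>R w x - ?t *\<^sub>R \<sigma> x + mn x" .
  have zz: "?z = (g x X Y / 2 * ?t - r x X Y) *\<^sub>R \<sigma> x + b0 x X Y"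
    unfolding z H_eq[OF x] trH by (simp add: algebra_simps)
  have 1: "lor ?z (\<sigma> x) = 0"
    unfolding z by (simp add: lor_simps w_props(5)[OF x] lor_H_\<sigma>[OF x])
  have 2: "lor ?z (mn x) = 2 * q x X Y"
    unfolding zz q_eq by (simp add: lor_simps \<sigma>_mn[OF x])
  have 3: "P x ?z = (g x X Y / 2 * ?t - r x X Y) *\<^sub>R \<sigma> x"
    unfolding zz by (simp add: blinfun_simps P_\<sigma>[OF x] P_b[OF x] P_mn[OF x])
  have "lproj (VS x) ?z = (g x X Y / 2 * ?t - r x X Y) *\<^sub>R \<sigma> x - q x X Y *\<^sub>R \<sigma> x"
    unfolding lproj_VS[OF x] 1 2 3 by simp
  then have lp: "lproj (VS x) ?z = - ((r x X Y - g x X Y / 2 * ?t + q x X Y) *\<^sub>R \<sigma> x)"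
    by (simp add: algebra_simps)
  have "\<sigma> x \<noteq> 0" using pos[OF x] by auto
  then have "r0 VS \<sigma> x X Y = r x X Y - g x X Y / 2 * ?t + q x X Y"
    unfolding r0_def lp by (intro the_equality) auto
  then show ?thesis unfolding schouten_def gauss_curvature_eq[OF x] by simp
qed

text \<open>The derivative of w is orthogonal to w and \<sigma>, pairs with d\<sigma> to - r, and
  has normal part dP w. Against dd\<sigma> = H + d\<sigma> \<Gamma> this leaves one term with
  \<Gamma> and one with b.\<close>

lemma dir_deriv_r:
  assumes x: "x \<in> U"
  shows "dir_deriv X (\<lambda>y. r y Y Z) x = lor (dir_deriv X (dir_deriv Y (dir_deriv Z \<sigma>)) x) (w x)
    - r x X (\<Gamma> x Y Z) + lor (dir_deriv Y P x (dir_deriv Z \<sigma> x)) (dir_deriv X P x (w x))"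
proof -
  let ?A = "dir_deriv Y (dir_deriv Z \<sigma>) x" and ?dw = "dir_deriv X w x"
  have dA: "dir_deriv Y (dir_deriv Z \<sigma>) differentiable (at x)"
    by (rule smooth_on_differentiable[OF smooth_on_dir_deriv[OF smooth_d\<sigma>] x])
  have 1: "dir_deriv X (\<lambda>y. r y Y Z) x = lor ?A ?dw + lor (dir_deriv X (dir_deriv Y (dir_deriv Z \<sigma>)) x) (w x)"
    by (rule dir_deriv_lor[OF dA diff_w[OF x]])
  have "dir_deriv X (\<lambda>y. P y (w y)) x = ?dw" by (rule dir_deriv_cong_open[OF open_U x w_props(1)])
  then have dw: "?dw = P x ?dw + dir_deriv X P x (w x)"
    using dir_deriv_P_section[OF x diff_w[OF x], of X] by simp
  have "dir_deriv X (\<lambda>y. lor (w y) (w y)) x = dir_deriv X (\<lambda>_. 0) x" by (rule dir_deriv_cong_open[OF open_U x w_props(2)])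
  then have ww: "lor (w x) ?dw = 0"
    using dir_deriv_lor[OF diff_w[OF x] diff_w[OF x], of X] lor_commute[of ?dw "w x"] by simp
  have "dir_deriv X (\<lambda>y. lor (w y) (\<sigma> y)) x = dir_deriv X (\<lambda>_. -1) x" by (rule dir_deriv_cong_open[OF open_U x w_props(3)])
  then have sw: "lor (\<sigma> x) ?dw = 0"
    using dir_deriv_lor[OF diff_w[OF x] diff_\<sigma>[OF x], of X] lor_commute[of ?dw "\<sigma> x"] w_props(4)[OF x] by simp
  have "dir_deriv X (\<lambda>y. lor (w y) (dir_deriv V \<sigma> y)) x = dir_deriv X (\<lambda>_. 0) x" for V
    by (rule dir_deriv_cong_open[OF open_U x w_props(4)])
  then have dw': "lor (dir_deriv V \<sigma> x) ?dw = - r x X V" for V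
    using dir_deriv_lor[OF diff_w[OF x] diff_d\<sigma>[OF x], of X V] lor_commute[of "w x"] lor_commute[of ?dw] by (simp add: eq_neg_iff_add_eq_0 add.commute)
  have A: "?A = H x Y Z + dir_deriv (\<Gamma> x Y Z) \<sigma> x" by (simp add: hessian_def)
  have "lor ?A ?dw = lor (H x Y Z) ?dw + lor (dir_deriv (\<Gamma> x Y Z) \<sigma> x) ?dw"
    by (subst A) (rule lor.add_left)
  also have "lor (H x Y Z) ?dw = lor (b x Y Z) ?dw"
    unfolding H_eq[OF x] by (simp add: lor_simps ww sw)
  finally have "lor ?A ?dw = lor (b x Y Z) ?dw - r x X (\<Gamma> x Y Z)" using dw' by simp
  also have "lor (b x Y Z) ?dw = lor (b x Y Z) (P x ?dw) + lor (b x Y Z) (dir_deriv X P x (w x))"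
    by (subst dw) (rule lor.add_right)
  also have "lor (b x Y Z) (P x ?dw) = 0" by (rule lor_P_b[OF x P_idem[OF x]])
  finally show ?thesis unfolding 1 b_def by simp
qed

text \<open>In the antisymmetrisation the third derivatives agree, the normal terms agree by rank
  one, and the term r(X, \<Gamma> Y Z) of \<open>dir_deriv_r\<close> cancels against the connection
  term of the covariant derivative with X and Y exchanged.\<close>

lemma codazzi:
  assumes x: "x \<in> U"
  shows "ext_cov_deriv g (\<lambda>x X Y. r x X Y) x X Y Z = 0"
proof -
  have "dir_deriv X (dir_deriv Y (dir_deriv Z \<sigma>)) x = dir_deriv Y (dir_deriv X (dir_deriv Z \<sigma>)) x"
    by (rule dir_deriv_commute[OF smooth_d\<sigma> x])
  moreover have "lor (dir_deriv Y P x (dir_deriv Z \<sigma> x)) (dir_deriv X P x (w x))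
     = lor (dir_deriv X P x (dir_deriv Z \<sigma> x)) (dir_deriv Y P x (w x))"
    by (rule dP_exchange(1)[OF x])
  ultimately show ?thesis
    unfolding ext_cov_deriv_def cov_deriv2_def dir_deriv_r[OF x] \<Gamma>_sym[OF x, of Y X] by simp
qed

lemma cotton_york_eq:
  assumes x: "x \<in> U"
  shows "ext_cov_deriv g q x X Y Z = cotton_york VS \<sigma> x X Y Z"
proof -
  have dr: "(\<lambda>y. r y Y Z) differentiable (at x)" for Y Z
    by (rule differentiable_bilinear[OF lor.bounded_bilinear_axioms
          smooth_on_differentiable[OF smooth_on_dir_deriv[OF smooth_d\<sigma>] x] diff_w[OF x]])
  have dq: "(\<lambda>y. q y Y Z) differentiable (at x)" for Y Z by (rule smooth_on_differentiable[OF smooth_q x])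
  have "dir_deriv X (\<lambda>y. schouten VS \<sigma> y Y Z) x = dir_deriv X (\<lambda>y. r y Y Z + q y Y Z) x" for X Y Z
    by (rule dir_deriv_cong_open[OF open_U x schouten_eq])
  then have d: "dir_deriv X (\<lambda>y. schouten VS \<sigma> y Y Z) x = dir_deriv X (\<lambda>y. r y Y Z) x + dir_deriv X (\<lambda>y. q y Y Z) x" for X Y Z
    using dir_deriv_add[OF dr dq] by simp
  have "cotton_york VS \<sigma> x X Y Z = ext_cov_deriv g (\<lambda>x X Y. r x X Y) x X Y Z + ext_cov_deriv g q x X Y Z"
    unfolding cotton_york_def ext_cov_deriv_def cov_deriv2_def d schouten_eq[OF x] by simp
  then show ?thesis using codazzi[OF x] by simp
qed

text \<open>Both q and the form g(S _, _) of the shape operator are multiples of one tensor B. If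
  the second multiple is nonzero, q is proportional to g(S _, _), so q(X, S Y) is proportional to
  g(S X, S Y), which is symmetric; otherwise S vanishes.\<close>

lemma potential_commutes:
  assumes x: "x \<in> U" and u: "u \<in> perp (VS x)"
  shows "q x X (shape_op VS \<sigma> x Y u) = q x Y (shape_op VS \<sigma> x X u)"
proof -
  \<comment> \<open>The normal u is orthogonal to \<sigma>, so the term q \<sigma> of
    \<open>II_VS\<close> does not reach the shape operator.\<close>
  have \<sigma>u: "lor (\<sigma> x) u = 0" by (rule perpD(2)[OF u \<sigma>_VS[OF x]])
  have II: "lor (II VS \<sigma> x Y W) u = - lor (b0 x Y W) u" for Y W
    unfolding II_VS[OF x] by (simp add: lor_simps \<sigma>u)
  have B: "bilinear (b0 x)" using tr_b0[OF x] by simp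
  have "linear (\<lambda>W. lor (II VS \<sigma> x Y W) u)" for Y
    unfolding II by (rule linearI) (simp_all only: bilinear_simps[OF B] lor_simps minus_add_distrib scaleR_minus_right real_scaleR_def mult_minus_right)
  from theI'[OF g_representation[OF x this]]
  have S: "g x (shape_op VS \<sigma> x Y u) W = - lor (b0 x Y W) u" for Y W
    unfolding shape_op_def II by blast
  obtain \<omega> n where n: "\<And>X Y. b x X Y = (\<omega> X * \<omega> Y) *\<^sub>R n" using b_rank_one[OF x] by blast
  obtain e1 e2 where e: "orthonormal_frame x e1 e2" using frame_exists[OF x] by blast
  define N where "N = \<omega> e1 * \<omega> e1 + \<omega> e2 * \<omega> e2"
  have mn: "mn x = N *\<^sub>R n"
    unfolding mean_normal_def frame_trace[OF x e bilinear_b[OF x]] n N_def by (simp add: scaleR_add_left)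
  define B where "B X Y = \<omega> X * \<omega> Y - g x X Y / 2 * N" for X Y
  have b0: "b0 x X Y = B X Y *\<^sub>R n" for X Y unfolding n mn B_def by (simp add: scaleR_diff_left)
  have q: "q x X Y = N * lor n n / 2 * B X Y" for X Y
    unfolding channel_potential_def b0 unfolding mn by (simp add: lor_simps)
  have S': "g x (shape_op VS \<sigma> x Y u) W = - (lor n u * B Y W)" for Y W
    unfolding S b0 by (simp add: lor.scaleR_left mult.commute)
  show ?thesis
  proof (cases "lor n u = 0")
    case True
    then have "shape_op VS \<sigma> x Y u = 0" for Y using S'[of Y] by (intro g_nondegenerate[OF x]) simp
    then show ?thesis by (simp add: bilinear_rzero[OF bilinear_q[OF x]])
  next
    case False
    have "B Y W = - g x (shape_op VS \<sigma> x Y u) W / lor n u" for Y W using False unfolding S' by simp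
    then show ?thesis unfolding q by (simp add: g_sym[of x "shape_op VS \<sigma> x X u" "shape_op VS \<sigma> x Y u"])
  qed
qed

end

text \<open>A change of chart acts through \<open>T\<close>, a change of section through the factor \<open>\<rho>\<close>.\<close>

lemma potential_transform:
  assumes "channel_surface U P F \<sigma>" "channel_surface U' P' F' \<sigma>'"
    and x: "x \<in> U" "x' \<in> U'" and \<rho>: "\<rho> > 0"
    and g: "\<And>X Y. induced_metric \<sigma> x X Y = \<rho>\<^sup>2 * induced_metric \<sigma>' x' (T X) (T Y)"
    and b: "\<And>X Y. normal_hessian P \<sigma> x X Y = \<rho> *\<^sub>R normal_hessian P' \<sigma>' x' (T X) (T Y)"
  shows "mean_normal P \<sigma> x = (1 / \<rho>) *\<^sub>R mean_normal P' \<sigma>' x'"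
    "channel_potential P \<sigma> x X Y = channel_potential P' \<sigma>' x' (T X) (T Y)"
proof -
  interpret a: channel_surface U P F \<sigma> by fact
  interpret c: channel_surface U' P' F' \<sigma>' by fact
  obtain e1 e2 where e: "a.orthonormal_frame x e1 e2" using a.frame_exists[OF x(1)] by blast
  note bg = c.bilinear_g[OF x(2)] and bb = c.bilinear_b[OF x(2)]
  \<comment> \<open>The image frame is stretched by \<rho> to compensate the factor \<rho> squared
    between the metrics; traces in it acquire that factor.\<close>
  have e': "c.orthonormal_frame x' (\<rho> *\<^sub>R T e1) (\<rho> *\<^sub>R T e2)"
    using e unfolding a.orthonormal_frame_def c.orthonormal_frame_def g
    by (simp add: bilinear_simps[OF bg] power2_eq_square)
  have 1: "mean_normal P \<sigma> x = \<rho> *\<^sub>R (c.b x' (T e1) (T e1) + c.b x' (T e2) (T e2))"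
    unfolding mean_normal_def a.frame_trace[OF x(1) e a.bilinear_b[OF x(1)]] b by (simp add: scaleR_add_right)
  have 2: "mean_normal P' \<sigma>' x' = (\<rho> * \<rho>) *\<^sub>R (c.b x' (T e1) (T e1) + c.b x' (T e2) (T e2))"
    unfolding mean_normal_def c.frame_trace[OF x(2) e' bb]
    by (simp add: bilinear_simps[OF bb] scaleR_add_right)
  show 3: "mean_normal P \<sigma> x = (1 / \<rho>) *\<^sub>R mean_normal P' \<sigma>' x'" unfolding 1 2 using \<rho> by simp
  show "channel_potential P \<sigma> x X Y = channel_potential P' \<sigma>' x' (T X) (T Y)"
    unfolding channel_potential_def 3 g b using \<rho>
    by (simp add: lor_simps power2_eq_square field_simps)
qed

section \<open>Passage to the manifold\<close>

text \<open>Nondegeneracy provides w in W with (w, \<sigma>) \<noteq> 0. The map sending (X, a, c)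
  to d\<sigma> X + a \<sigma> + c w is injective, hence onto W by dimension. Pairing z with \<sigma>
  removes c, and positivity of g removes X.\<close>

lemma jet_perp_of_dim:
  fixes \<sigma> :: "real^'m::finite \<Rightarrow> 'k::finite mink"
  assumes "null_immersion U \<sigma>" and x: "x \<in> U"
    and W: "nondegenerate W" "dim W = CARD('m) + 2" and in_W: "\<sigma> x \<in> W" "\<And>X. dir_deriv X \<sigma> x \<in> W"
    and z: "z \<in> W" "lor z (\<sigma> x) = 0" "\<And>X. lor z (dir_deriv X \<sigma> x) = 0"
  shows "z \<in> span {\<sigma> x}"
proof -
  interpret null_immersion U \<sigma> by fact
  have sW: "subspace W" using W by (simp add: nondegenerate_def)
  have s0: "\<sigma> x \<noteq> 0" using pos[OF x] by auto
  then obtain w where w: "w \<in> W" "lor w (\<sigma> x) \<noteq> 0"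
    using W(1) in_W(1) lor_commute unfolding nondegenerate_def by metis
  define f where "f p = dir_deriv (fst p) \<sigma> x + fst (snd p) *\<^sub>R \<sigma> x + snd (snd p) *\<^sub>R w" for p :: "(real^'m) \<times> real \<times> real"
  have lin: "linear f"
    unfolding f_def by (rule linearI) (simp_all add: d\<sigma>_add[OF x] d\<sigma>_scale[OF x] algebra_simps)
  have lf: "lor (f p) (\<sigma> x) = snd (snd p) * lor w (\<sigma> x)" for p
    by (simp add: f_def lor_simps lor_d\<sigma>_\<sigma>[OF x] null[OF x])
  have "inj f"
  proof (subst linear_injective_0[OF lin], intro allI impI)
    fix p assume f0: "f p = 0"
    then have b: "snd (snd p) = 0" using lf[of p] w by (simp add: lor.zero_left)
    then have "dir_deriv (fst p) \<sigma> x = (- fst (snd p)) *\<^sub>R \<sigma> x" using f0 by (simp add: f_def eq_neg_iff_add_eq_0)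
    then have "dir_deriv (fst p) \<sigma> x \<in> span {\<sigma> x}" unfolding span_singleton by blast
    then have X: "fst p = 0" by (rule immersion[OF x])
    then have "fst (snd p) *\<^sub>R \<sigma> x = 0" using f0 b linear_0[OF linear_d\<sigma>[OF x]] by (simp add: f_def)
    then have "fst (snd p) = 0" using s0 scaleR_eq_0_iff by blast
    then show "p = 0" using X b by (simp add: prod_eq_iff)
  qed
  then have "dim (range f) = CARD('m) + 2" using dim_image_eq[OF lin, of UNIV] by simp
  moreover have "range f \<subseteq> W"
    using in_W w(1) sW by (auto simp: f_def intro!: subspace_add subspace_scale)
  ultimately have "range f = W"
    using W(2) by (intro subspace_dim_equal[OF linear_subspace_image[OF lin subspace_UNIV] sW]) auto
  then obtain p where p: "z = f p" using z(1) by blast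
  have b: "snd (snd p) = 0" using lf[of p] z(2) w(2) p by simp
  have zf: "z = dir_deriv (fst p) \<sigma> x + fst (snd p) *\<^sub>R \<sigma> x" using p b by (simp add: f_def)
  have "lor (\<sigma> x) (dir_deriv (fst p) \<sigma> x) = 0" using lor_d\<sigma>_\<sigma>[OF x] lor_commute by metis
  then have "g x (fst p) (fst p) = 0"
    using z(3)[of "fst p"] unfolding zf induced_metric_def by (simp add: lor_simps)
  then have "fst p = 0" using g_pos[OF x, of "fst p"] by force
  then have "z = fst (snd p) *\<^sub>R \<sigma> x" using zf linear_0[OF linear_d\<sigma>[OF x]] by simp
  then show ?thesis unfolding span_singleton by blast
qed

lemma smooth_subbundleD:
  assumes "smooth_subbundle r U F" "x \<in> U"
  shows "subspace (F x)" "dim (F x) = r"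
proof -
  obtain W s where "open W \<and> x \<in> W \<and> W \<subseteq> U \<and> (\<forall>i<r. smooth_on W (s i)) \<and>
      (\<forall>y\<in>W. F y = span ((\<lambda>i::nat. s i y) ` {..<r}) \<and> dim (F y) = r)"
    using bspec[OF assms(1)[unfolded smooth_subbundle_def] assms(2)] by (elim exE) (rule that)
  then have F: "F x = span ((\<lambda>i. s i x) ` {..<r})" "dim (F x) = r" by blast+
  show "subspace (F x)" unfolding F(1) by (rule subspace_span)
  show "dim (F x) = r" by (rule F(2))
qed

lemma smooth_subbundle_cong:
  assumes "smooth_subbundle r U F" "\<And>x. x \<in> U \<Longrightarrow> G x = F x"
  shows "smooth_subbundle r U G"
  unfolding smooth_subbundle_def
proof
  fix x assume x: "x \<in> U"
  obtain W s where Ws: "open W \<and> x \<in> W \<and> W \<subseteq> U \<and> (\<forall>i<r. smooth_on W (s i)) \<and>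
      (\<forall>y\<in>W. F y = span ((\<lambda>i::nat. s i y) ` {..<r}) \<and> dim (F y) = r)"
    using bspec[OF assms(1)[unfolded smooth_subbundle_def] x] by (elim exE) (rule that)
  have "G y = span ((\<lambda>i::nat. s i y) ` {..<r}) \<and> dim (G y) = r" if "y \<in> W" for y
  proof -
    have "G y = F y" using Ws that assms(2) by blast
    then show ?thesis using Ws that by metis
  qed
  then show "\<exists>W s. open W \<and> x \<in> W \<and> W \<subseteq> U \<and> (\<forall>i<r. smooth_on W (s i)) \<and>
      (\<forall>y\<in>W. G y = span ((\<lambda>i::nat. s i y) ` {..<r}) \<and> dim (G y) = r)"
    using Ws by (intro exI[of _ W] exI[of _ s]) blast
qed

text \<open>The congruence glued over the manifold and the one built in a chart coincide on the
  chart domain only, so \<open>N_form\<close> must be seen to depend on a neighbourhood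
  alone.\<close>

lemma N_form_cong:
  assumes op: "open U" and x: "x \<in> U" and eq: "\<And>y. y \<in> U \<Longrightarrow> F y = G y"
  shows "N_form F X s x = N_form G X s x"
proof -
  have "sub_conn F' X s x = sub_conn G' X s x" if "\<And>y. y \<in> U \<Longrightarrow> F' y = G' y" for F' G'
  proof -
    have "dir_deriv X (\<lambda>y. lproj (F' y) (s y)) x = dir_deriv X (\<lambda>y. lproj (G' y) (s y)) x"
      by (rule dir_deriv_cong_open[OF op x]) (simp add: that)
    then show ?thesis unfolding sub_conn_def that[OF x] by simp
  qed
  from this[of F G] this[of "perp_bundle F" "perp_bundle G"] eq show ?thesis
    unfolding N_form_def perp_bundle_def by simp
qed

lemma ext_cov_deriv_cong:
  assumes op: "open U" and x: "x \<in> U" and eq: "\<And>y X Y. y \<in> U \<Longrightarrow> q y X Y = q' y X Y"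
  shows "ext_cov_deriv g q x X Y Z = ext_cov_deriv g q' x X Y Z"
proof -
  have "dir_deriv X (\<lambda>y. q y Y Z) x = dir_deriv X (\<lambda>y. q' y Y Z) x" for X Y Z
    by (rule dir_deriv_cong_open[OF op x eq])
  then show ?thesis unfolding ext_cov_deriv_def cov_deriv2_def eq[OF x] by simp
qed

section \<open>A canonical positive section\<close>

lemma null_snd_nonzero: "lor v v = 0 \<Longrightarrow> v \<noteq> 0 \<Longrightarrow> snd v \<noteq> 0"
  by (auto simp: lor_def prod_eq_iff)

text \<open>Normalising the last coordinate to 1 selects a vector that depends on the null line
  alone, hence on the point of the manifold and not on the chart.\<close>

definition unit_point :: "'k::finite mink set \<Rightarrow> 'k mink" where
  "unit_point l = (THE v. v \<in> l \<and> snd v = 1)"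

lemma unit_point_eqI:
  assumes "l = span {v}" "snd v \<noteq> 0"
  shows "unit_point l = (1 / snd v) *\<^sub>R v"
  unfolding unit_point_def
proof (rule the_equality)
  show "(1 / snd v) *\<^sub>R v \<in> l \<and> snd ((1 / snd v) *\<^sub>R v) = 1" using assms by (simp add: span_base span_scale)
  fix u assume u: "u \<in> l \<and> snd u = 1"
  then obtain c where "u = c *\<^sub>R v" using assms unfolding span_singleton by blast
  then show "u = (1 / snd v) *\<^sub>R v" using u assms(2) by (auto simp: field_simps)
qed

lemma unit_point_section:
  fixes l :: "real^'m::finite \<Rightarrow> 'k::finite mink set"
  assumes op: "open U" and sb: "smooth_subbundle 1 U l" and null: "\<And>x v. x \<in> U \<Longrightarrow> v \<in> l x \<Longrightarrow> lor v v = 0"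
  shows "pos_section U l (\<lambda>x. unit_point (l x))"
    "x \<in> U \<Longrightarrow> v \<in> l x \<Longrightarrow> snd v > 0 \<Longrightarrow> v = snd v *\<^sub>R unit_point (l x)"
proof -
  have loc: "\<exists>W s. open W \<and> x \<in> W \<and> W \<subseteq> U \<and> smooth_on W s \<and>
      (\<forall>y\<in>W. l y = span {s y} \<and> snd (s y) \<noteq> 0)" if x: "x \<in> U" for x
  proof -
    obtain W s where Ws: "open W \<and> x \<in> W \<and> W \<subseteq> U \<and> (\<forall>i<1. smooth_on W (s i)) \<and>
        (\<forall>y\<in>W. l y = span ((\<lambda>i::nat. s i y) ` {..<1}) \<and> dim (l y) = 1)"
      using bspec[OF sb[unfolded smooth_subbundle_def] x] by (elim exE) (rule that)
    have "{..<1::nat} = {0}" by auto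
    then have l: "l y = span {s 0 y}" "dim (l y) = 1" if "y \<in> W" for y using Ws that by auto
    have "s 0 y \<noteq> 0" if "y \<in> W" for y using l[OF that] by auto
    moreover have "lor (s 0 y) (s 0 y) = 0" if "y \<in> W" for y
      using null[of y "s 0 y"] l(1)[OF that] Ws that by (auto simp: span_base)
    ultimately have "snd (s 0 y) \<noteq> 0" if "y \<in> W" for y using null_snd_nonzero that by blast
    then show ?thesis using Ws l by (intro exI[of _ W] exI[of _ "s 0"]) auto
  qed
  have sm: "smooth_on U (\<lambda>x. unit_point (l x))"
  proof (rule smooth_on_local[OF op])
    fix x assume "x \<in> U"
    then obtain W s where W: "open W" "x \<in> W" "W \<subseteq> U" "smooth_on W s" and
      l: "\<And>y. y \<in> W \<Longrightarrow> l y = span {s y} \<and> snd (s y) \<noteq> 0" using loc by meson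
    have "smooth_on W (\<lambda>y. inverse (snd (s y)) *\<^sub>R s y)"
      by (intro smooth_on_scaleR smooth_on_inverse smooth_on_bounded_linear[OF bounded_linear_snd] W) (use l in auto)
    then have "smooth_on W (\<lambda>x. unit_point (l x))"
      by (rule smooth_on_cong) (simp add: unit_point_eqI l inverse_eq_divide)
    then show "\<exists>W. open W \<and> x \<in> W \<and> W \<subseteq> U \<and> smooth_on W (\<lambda>x. unit_point (l x))" using W by blast
  qed
  have pt: "unit_point (l x) \<in> l x \<and> snd (unit_point (l x)) = 1 \<and>
      (\<forall>v\<in>l x. v = snd v *\<^sub>R unit_point (l x))" if x: "x \<in> U" for x
  proof -
    obtain s where s: "l x = span {s}" "snd s \<noteq> 0" using loc[OF x] by meson
    have "v = snd v *\<^sub>R unit_point (l x)" if v: "v \<in> l x" for v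
    proof -
      obtain c where "v = c *\<^sub>R s" using v unfolding s(1) span_singleton by blast
      then show ?thesis using s(2) by (simp add: unit_point_eqI[OF s])
    qed
    then show ?thesis using s(2) unfolding unit_point_eqI[OF s] by (simp add: s(1) span_base span_scale)
  qed
  show "pos_section U l (\<lambda>x. unit_point (l x))" unfolding pos_section_def using sm pt by auto
  show "v = snd v *\<^sub>R unit_point (l x)" if "x \<in> U" "v \<in> l x" "snd v > 0" using pt that by blast
qed

locale channel_atlas =
  fixes M :: "'a topology" and A :: "('a, 'm::finite) chart set"
    and L :: "'a \<Rightarrow> 'k::finite mink set" and V :: "'a \<Rightarrow> 'k mink set"
  assumes manifold: "smooth_manifold M A"
    and immersed: "immersed_submanifold A L"
    and enveloped: "enveloped_congruence A L V"
    and rank_V: "\<forall>(U, \<psi>)\<in>A. \<forall>x\<in>U. N_rank (V \<circ> \<psi>) x = 1"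
begin

abbreviation "sec \<psi> \<equiv> (\<lambda>x. unit_point ((L \<circ> \<psi>) x))"
abbreviation "proj \<psi> \<equiv> (\<lambda>x. Blinfun (lproj ((V \<circ> \<psi>) x)))"

lemma chart:
  assumes "(U, \<psi>) \<in> A"
  shows "open U" "inj_on \<psi> U" "smooth_subbundle 1 U (L \<circ> \<psi>)"
    "x \<in> U \<Longrightarrow> v \<in> L (\<psi> x) \<Longrightarrow> lor v v = 0"
    "pos_section U (L \<circ> \<psi>) \<sigma> \<Longrightarrow> x \<in> U \<Longrightarrow> dir_deriv X \<sigma> x \<in> L (\<psi> x) \<Longrightarrow> X = 0"
    "smooth_subbundle (CARD('m) + 2) U (V \<circ> \<psi>)"
    "x \<in> U \<Longrightarrow> has_signature (V (\<psi> x)) (CARD('m) + 1) 1"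
    "pos_section U (L \<circ> \<psi>) \<sigma> \<Longrightarrow> x \<in> U \<Longrightarrow> jet1 \<sigma> x \<subseteq> V (\<psi> x)"
    "x \<in> U \<Longrightarrow> N_rank (V \<circ> \<psi>) x = 1"
proof -
  have "embedding_map (top_of_set U) M \<psi>" "open U"
    using manifold assms unfolding smooth_manifold_def by auto
  then show "open U" "inj_on \<psi> U" by (auto simp: embedding_map_def dest: homeomorphic_imp_injective_map)
  note i = bspec[OF immersed[unfolded immersed_submanifold_def] assms, unfolded prod.case]
  show "smooth_subbundle 1 U (L \<circ> \<psi>)" using i by blast
  show "x \<in> U \<Longrightarrow> v \<in> L (\<psi> x) \<Longrightarrow> lor v v = 0" using i by blast
  show "pos_section U (L \<circ> \<psi>) \<sigma> \<Longrightarrow> x \<in> U \<Longrightarrow> dir_deriv X \<sigma> x \<in> L (\<psi> x) \<Longrightarrow> X = 0" using i by blast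
  note e = bspec[OF enveloped[unfolded enveloped_congruence_def] assms, unfolded prod.case]
  show "smooth_subbundle (CARD('m) + 2) U (V \<circ> \<psi>)" using e by blast
  show "x \<in> U \<Longrightarrow> has_signature (V (\<psi> x)) (CARD('m) + 1) 1" using e by blast
  show "pos_section U (L \<circ> \<psi>) \<sigma> \<Longrightarrow> x \<in> U \<Longrightarrow> jet1 \<sigma> x \<subseteq> V (\<psi> x)" using e by blast
  show "x \<in> U \<Longrightarrow> N_rank (V \<circ> \<psi>) x = 1"
    using bspec[OF rank_V assms, unfolded prod.case] by blast
qed

lemma sec: "(U, \<psi>) \<in> A \<Longrightarrow> pos_section U (L \<circ> \<psi>) (sec \<psi>)"
  using unit_point_section(1)[OF chart(1,3)] chart(4) by (metis comp_apply)

lemma nondegenerate_chart: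
  assumes c: "(U, \<psi>) \<in> A"
  shows "nondegenerate_bundle U (proj \<psi>) (V \<circ> \<psi>)"
  by (rule projection_of_bundle[OF chart(6)[OF c] chart(1)[OF c]])
    (use has_signature_nondegenerate[OF chart(7)[OF c]] in simp)

lemma envelope_chart:
  assumes c: "(U, \<psi>) \<in> A" and \<sigma>: "pos_section U (L \<circ> \<psi>) \<sigma>"
  shows "rank_one_envelope U (proj \<psi>) \<sigma>"
proof -
  interpret nondegenerate_bundle U "proj \<psi>" "V \<circ> \<psi>" by (rule nondegenerate_chart[OF c])
  have \<sigma>L: "\<sigma> x \<in> L (\<psi> x)" "snd (\<sigma> x) > 0" if "x \<in> U" for x using \<sigma> that by (auto simp: pos_section_def)
  have jet: "\<sigma> x \<in> V (\<psi> x)" "dir_deriv X \<sigma> x \<in> V (\<psi> x)" if "x \<in> U" for x X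
    using chart(8)[OF c \<sigma> that] unfolding jet1_def by (meson insertI1 insertI2 rangeI span_base subsetD)+
  have imm: "null_immersion U \<sigma>"
  proof
    show "smooth_on U \<sigma>" using \<sigma> by (simp add: pos_section_def)
    fix x assume x: "x \<in> U"
    show "lor (\<sigma> x) (\<sigma> x) = 0" by (rule chart(4)[OF c x \<sigma>L(1)[OF x]])
    show "0 < snd (\<sigma> x)" by (rule \<sigma>L(2)[OF x])
    show "X = 0" if "dir_deriv X \<sigma> x \<in> span {\<sigma> x}" for X
    proof (rule chart(5)[OF c \<sigma> x])
      have "subspace (L (\<psi> x))" using smooth_subbundleD(1)[OF chart(3)[OF c] x] by simp
      then have "span {\<sigma> x} \<subseteq> L (\<psi> x)" using \<sigma>L(1)[OF x] by (intro span_minimal) auto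
      then show "dir_deriv X \<sigma> x \<in> L (\<psi> x)" using that by blast
    qed
  qed
  then interpret null_immersion U \<sigma> .
  show ?thesis
  proof
    fix x assume x: "x \<in> U"
    show P\<sigma>: "proj \<psi> x (\<sigma> x) = \<sigma> x" by (rule P_id[OF x]) (simp add: jet[OF x])
    show Pd: "proj \<psi> x (dir_deriv X \<sigma> x) = dir_deriv X \<sigma> x" for X by (rule P_id[OF x]) (simp add: jet[OF x])
    show "z \<in> span {\<sigma> x}" if "proj \<psi> x z = z" "lor z (\<sigma> x) = 0" "\<And>X. lor z (dir_deriv X \<sigma> x) = 0" for z
    proof (rule jet_perp_of_dim[OF imm x nondeg[OF x]])
      show "dim ((V \<circ> \<psi>) x) = CARD('m) + 2" by (rule smooth_subbundleD(2)[OF chart(6)[OF c] x])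
      show "z \<in> (V \<circ> \<psi>) x" using P_in[OF x, of z] that(1) by simp
    qed (use jet[OF x] that in auto)
    show "\<exists>\<omega> E. \<forall>X v. dir_deriv X (proj \<psi>) x v = \<omega> X *\<^sub>R blinfun_apply E v"
      by (rule rank_one[OF x chart(9)[OF c x]])
  qed
qed

lemma conformally_flat: "conformally_flat A L"
  unfolding conformally_flat_def
proof (clarify)
  fix U \<psi> x assume c: "(U, \<psi>) \<in> A" and x: "x \<in> U"
  interpret rank_one_envelope U "proj \<psi>" "sec \<psi>" by (rule envelope_chart[OF c sec[OF c]])
  obtain W \<rho> where W: "open W" "x \<in> W" "W \<subseteq> U" "smooth_on W \<rho>" "\<forall>x\<in>W. \<rho> x > 0"
    "\<forall>y\<in>W. \<forall>X Y Z. riemann (induced_metric (\<lambda>x. \<rho> x *\<^sub>R sec \<psi> x)) y X Y Z = 0"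
    by (rule flat_representative_exists[OF x]) (rule that)
  have "pos_section W (L \<circ> \<psi>) (\<lambda>x. \<rho> x *\<^sub>R sec \<psi> x)"
    unfolding pos_section_def
  proof (intro conjI ballI)
    show "smooth_on W (\<lambda>x. \<rho> x *\<^sub>R sec \<psi> x)"
      by (intro smooth_on_scaleR W smooth_on_subset[OF smooth_\<sigma> W(1,3)])
    fix y assume y: "y \<in> W"
    then have yU: "y \<in> U" using W by blast
    have "sec \<psi> y \<in> (L \<circ> \<psi>) y" "snd (sec \<psi> y) > 0" using sec[OF c] yU by (auto simp: pos_section_def)
    then show "\<rho> y *\<^sub>R sec \<psi> y \<in> (L \<circ> \<psi>) y" "0 < snd (\<rho> y *\<^sub>R sec \<psi> y)"
      using subspace_scale[OF smooth_subbundleD(1)[OF chart(3)[OF c] yU]] W(5) y by auto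
  qed
  then show "\<exists>W \<sigma>. open W \<and> x \<in> W \<and> W \<subseteq> U \<and> pos_section W (L \<circ> \<psi>) \<sigma> \<and>
      (\<forall>y\<in>W. \<forall>X Y Z. riemann (induced_metric \<sigma>) y X Y Z = 0)"
    using W by (intro exI[of _ W] exI[of _ "\<lambda>x. \<rho> x *\<^sub>R sec \<psi> x"]) blast
qed

text \<open>\<open>sec\<close> and \<open>proj\<close> come from functions on the manifold, so over
  an overlap those of one chart are those of the other composed with \<tau>; the rest is the chain
  rule. Thus \<open>potential_transform\<close> applies with factor 1.\<close>

lemma chart_change:
  assumes c: "(U, \<psi>) \<in> A" "(U', \<psi>') \<in> A" and x: "x \<in> U" "\<psi> x \<in> \<psi>' ` U'"
  defines "\<tau> \<equiv> transition (U, \<psi>) (U', \<psi>')"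
  shows "\<tau> x \<in> U'" "\<psi>' (\<tau> x) = \<psi> x"
    "induced_metric (sec \<psi>) x X Y = induced_metric (sec \<psi>') (\<tau> x) (dir_deriv X \<tau> x) (dir_deriv Y \<tau> x)"
    "normal_hessian (proj \<psi>) (sec \<psi>) x X Y
      = normal_hessian (proj \<psi>') (sec \<psi>') (\<tau> x) (dir_deriv X \<tau> x) (dir_deriv Y \<tau> x)"
proof -
  define N where "N = {y \<in> U. \<psi> y \<in> \<psi>' ` U'}"
  have "smooth_on N \<tau>"
    using manifold c unfolding smooth_manifold_def \<tau>_def N_def by fast
  then have N: "open N" "x \<in> N" and d\<tau>: "\<tau> differentiable (at x)"
    using x by (simp_all add: smooth_on_open smooth_on_differentiable N_def)
  have \<tau>: "\<tau> y \<in> U'" "\<psi>' (\<tau> y) = \<psi> y" if "y \<in> N" for y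
    using that unfolding N_def \<tau>_def transition_def by (auto simp: inv_into_into f_inv_into_f)
  show "\<tau> x \<in> U'" "\<psi>' (\<tau> x) = \<psi> x" using \<tau> N by auto
  interpret rank_one_envelope U' "proj \<psi>'" "sec \<psi>'" by (rule envelope_chart[OF c(2) sec[OF c(2)]])
  have s: "dir_deriv X (sec \<psi>) x = dir_deriv (dir_deriv X \<tau> x) (sec \<psi>') (\<tau> x)" for X
    using dir_deriv_cong_open[OF N, where f = "sec \<psi>" and g = "\<lambda>y. sec \<psi>' (\<tau> y)" and X = X]
      dir_deriv_chain[OF d\<tau> diff_\<sigma>[OF \<tau>(1)[OF N(2)]], of X] \<tau>(2) by simp
  have p: "dir_deriv X (proj \<psi>) x = dir_deriv (dir_deriv X \<tau> x) (proj \<psi>') (\<tau> x)" for X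
    using dir_deriv_cong_open[OF N, where f = "proj \<psi>" and g = "\<lambda>y. proj \<psi>' (\<tau> y)" and X = X]
      dir_deriv_chain[OF d\<tau> P_differentiable[OF \<tau>(1)[OF N(2)]], of X] \<tau>(2) by simp
  show "induced_metric (sec \<psi>) x X Y = induced_metric (sec \<psi>') (\<tau> x) (dir_deriv X \<tau> x) (dir_deriv Y \<tau> x)"
    unfolding induced_metric_def s ..
  show "normal_hessian (proj \<psi>) (sec \<psi>) x X Y
      = normal_hessian (proj \<psi>') (sec \<psi>') (\<tau> x) (dir_deriv X \<tau> x) (dir_deriv Y \<tau> x)"
    unfolding normal_hessian_def s p ..
qed

text \<open>The derivative of the scaling factor contributes only multiples of \<sigma>. They drop
  out of the metric, as \<sigma> is null and orthogonal to its derivatives, and out of the normal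
  Hessian, as dP \<sigma> = 0.\<close>

lemma section_change:
  assumes c: "(U, \<psi>) \<in> A" and \<sigma>: "pos_section U (L \<circ> \<psi>) \<sigma>" and x: "x \<in> U"
  shows "snd (\<sigma> x) > 0" "\<sigma> x = snd (\<sigma> x) *\<^sub>R sec \<psi> x"
    "induced_metric \<sigma> x X Y = (snd (\<sigma> x))\<^sup>2 * induced_metric (sec \<psi>) x X Y"
    "normal_hessian (proj \<psi>) \<sigma> x X Y = snd (\<sigma> x) *\<^sub>R normal_hessian (proj \<psi>) (sec \<psi>) x X Y"
proof -
  interpret rank_one_envelope U "proj \<psi>" \<sigma> by (rule envelope_chart[OF c \<sigma>])
  interpret s: rank_one_envelope U "proj \<psi>" "sec \<psi>" by (rule envelope_chart[OF c sec[OF c]])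
  have eq: "\<sigma> y = snd (\<sigma> y) *\<^sub>R sec \<psi> y" if "y \<in> U" for y
    by (rule unit_point_section(2)[OF chart(1,3)[OF c] _ that])
      (use \<sigma> chart(4)[OF c] that in \<open>auto simp: pos_section_def\<close>)
  show "snd (\<sigma> x) > 0" by (rule pos[OF x])
  show "\<sigma> x = snd (\<sigma> x) *\<^sub>R sec \<psi> x" by (rule eq[OF x])
  have ds: "(\<lambda>y. snd (\<sigma> y)) differentiable (at x)"
    by (rule differentiable_bounded_linear[OF bounded_linear_snd diff_\<sigma>[OF x]])
  have d: "dir_deriv X \<sigma> x = snd (\<sigma> x) *\<^sub>R dir_deriv X (sec \<psi>) x + dir_deriv X (\<lambda>y. snd (\<sigma> y)) x *\<^sub>R sec \<psi> x" for X
    using dir_deriv_cong_open[OF open_U x eq, where X = X] dir_deriv_bilinear[OF bounded_bilinear_scaleR ds s.diff_\<sigma>[OF x], of X]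
    by simp
  have "lor (sec \<psi> x) (dir_deriv X (sec \<psi>) x) = 0" for X using s.lor_d\<sigma>_\<sigma>[OF x] lor_commute by metis
  then show "induced_metric \<sigma> x X Y = (snd (\<sigma> x))\<^sup>2 * induced_metric (sec \<psi>) x X Y"
    unfolding induced_metric_def d
    by (simp add: lor_simps s.lor_d\<sigma>_\<sigma>[OF x] s.null[OF x] power2_eq_square
        del: comp_apply)
  show "normal_hessian (proj \<psi>) \<sigma> x X Y = snd (\<sigma> x) *\<^sub>R normal_hessian (proj \<psi>) (sec \<psi>) x X Y"
    unfolding normal_hessian_def d by (simp add: blinfun_simps s.dP_\<sigma>[OF x] del: comp_apply)
qed

end

section \<open>Surfaces: gluing the central congruence and the potential\<close>

locale channel_surface_atlas = channel_atlas M A L V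
  for M :: "'a topology" and A :: "('a, 'm::finite) chart set"
    and L :: "'a \<Rightarrow> 'k::finite mink set" and V :: "'a \<Rightarrow> 'k mink set" +
  assumes two: "CARD('m) = 2"
begin

lemma surface_chart:
  assumes c: "(U, \<psi>) \<in> A" and \<sigma>: "pos_section U (L \<circ> \<psi>) \<sigma>"
  shows "channel_surface U (proj \<psi>) (V \<circ> \<psi>) \<sigma>"
proof -
  interpret nondegenerate_bundle U "proj \<psi>" "V \<circ> \<psi>" by (rule nondegenerate_chart[OF c])
  interpret rank_one_envelope U "proj \<psi>" \<sigma> by (rule envelope_chart[OF c \<sigma>])
  show ?thesis by standard (rule two, rule chart(6)[OF c])
qed

text \<open>An arbitrary chart around p is chosen; \<open>normal_at_chart\<close> shows that every
  chart gives the same value.\<close>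

definition normal_at :: "'a \<Rightarrow> 'k mink" where
  "normal_at p = (let (U, \<psi>) = (SOME c. c \<in> A \<and> p \<in> snd c ` fst c)
     in mean_normal (proj \<psi>) (sec \<psi>) (inv_into U \<psi> p))"

definition central :: "'a \<Rightarrow> 'k mink set" where
  "central p = null_rotation (unit_point (L p)) (normal_at p) ` V p"

definition potential :: "('a, 'm) chart \<Rightarrow> 'm tensor2" where
  "potential c = channel_potential (proj (snd c)) (sec (snd c))"

lemma normal_at_chart:
  assumes c: "(U, \<psi>) \<in> A" and x: "x \<in> U"
  shows "normal_at (\<psi> x) = mean_normal (proj \<psi>) (sec \<psi>) x"
proof -
  define c' where "c' = (SOME c. c \<in> A \<and> \<psi> x \<in> snd c ` fst c)"
  have "c' \<in> A \<and> \<psi> x \<in> snd c' ` fst c'"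
    unfolding c'_def by (rule someI[of _ "(U, \<psi>)"]) (use c x in auto)
  then obtain U' \<psi>' where c': "c' = (U', \<psi>')" "(U', \<psi>') \<in> A" "\<psi> x \<in> \<psi>' ` U'" by (metis prod.collapse)
  note cc = chart_change[OF c c'(2) x c'(3)]
  have "mean_normal (proj \<psi>) (sec \<psi>) x
      = (1 / 1) *\<^sub>R mean_normal (proj \<psi>') (sec \<psi>') (transition (U, \<psi>) (U', \<psi>') x)"
    by (rule potential_transform(1)[OF surface_chart[OF c sec[OF c]] surface_chart[OF c'(2) sec[OF c'(2)]] x cc(1),
          where T = "\<lambda>X. dir_deriv X (transition (U, \<psi>) (U', \<psi>')) x"]) (simp_all only: cc power_one mult_1_left scaleR_one zero_less_one)
  then show ?thesis unfolding normal_at_def c'_def[symmetric] c'(1) by (simp add: transition_def)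
qed

text \<open>The weights cancel: \<sigma> is multiplied and the mean normal divided by the same
  factor, so neither the null rotation nor the potential notices the section.\<close>

lemma section_change_surface:
  assumes c: "(U, \<psi>) \<in> A" and \<sigma>: "pos_section U (L \<circ> \<psi>) \<sigma>" and x: "x \<in> U"
  shows "central (\<psi> x) = channel_surface.VS (proj \<psi>) (V \<circ> \<psi>) \<sigma> x"
    "potential (U, \<psi>) x X Y = channel_potential (proj \<psi>) \<sigma> x X Y"
proof -
  note sc = section_change[OF c \<sigma> x]
  interpret channel_surface U "proj \<psi>" "V \<circ> \<psi>" \<sigma> by (rule surface_chart[OF c \<sigma>])
  note pt = potential_transform[OF surface_chart[OF c \<sigma>] surface_chart[OF c sec[OF c]] x x sc(1), where T = "\<lambda>X. X",
      OF sc(3,4)]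
  have "VS x = null_rotation (snd (\<sigma> x) *\<^sub>R sec \<psi> x) ((1 / snd (\<sigma> x)) *\<^sub>R normal_at (\<psi> x)) ` V (\<psi> x)"
    unfolding VS_def pt(1) normal_at_chart[OF c x] sc(2)[symmetric] by simp
  also have "\<dots> = central (\<psi> x)"
    using null_rotation_rescale[of "snd (\<sigma> x)" "sec \<psi> x" "normal_at (\<psi> x)"] sc(1) by (simp add: central_def)
  finally show "central (\<psi> x) = VS x" by simp
  show "potential (U, \<psi>) x X Y = channel_potential (proj \<psi>) \<sigma> x X Y" using pt(2) by (simp add: potential_def)
qed

lemma II_central:
  assumes c: "(U, \<psi>) \<in> A" and \<sigma>: "pos_section U (L \<circ> \<psi>) \<sigma>" and x: "x \<in> U"
  shows "II (central \<circ> \<psi>) \<sigma> x = II (channel_surface.VS (proj \<psi>) (V \<circ> \<psi>) \<sigma>) \<sigma> x"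
  unfolding II_def
  by (intro ext arg_cong[of _ _ uminus] N_form_cong[OF chart(1)[OF c] x]) (simp add: section_change_surface(1)[OF c \<sigma>])

lemma central_congruence: "central_congruence A L central"
proof -
  have "smooth_subbundle (CARD('m) + 2) U (central \<circ> \<psi>)" "x \<in> U \<Longrightarrow> has_signature (central (\<psi> x)) (CARD('m) + 1) 1"
    if c: "(U, \<psi>) \<in> A" for U \<psi> x
  proof -
    interpret channel_surface U "proj \<psi>" "V \<circ> \<psi>" "sec \<psi>" by (rule surface_chart[OF c sec[OF c]])
    note eq = section_change_surface(1)[OF c sec[OF c]]
    show "smooth_subbundle (CARD('m) + 2) U (central \<circ> \<psi>)"
      by (rule smooth_subbundle_cong[OF subbundle_VS]) (simp add: eq)
    show "has_signature (central (\<psi> x)) (CARD('m) + 1) 1" if x: "x \<in> U"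
      unfolding eq[OF x] VS_def
      by (rule has_signature_null_rotation[OF null[OF x] \<sigma>_mn[OF x]]) (use chart(7)[OF c x] in simp)
  qed
  moreover have "z \<in> jet1 \<sigma> x \<Longrightarrow> z \<in> central (\<psi> x)" "metric_trace (induced_metric \<sigma> x) (II (central \<circ> \<psi>) \<sigma> x) = 0"
    if c: "(U, \<psi>) \<in> A" and \<sigma>: "pos_section U (L \<circ> \<psi>) \<sigma>" and x: "x \<in> U" for U \<psi> \<sigma> x z
  proof -
    interpret channel_surface U "proj \<psi>" "V \<circ> \<psi>" \<sigma> by (rule surface_chart[OF c \<sigma>])
    have "subspace (VS x)" using nondegenerate_VS[OF x] by (simp add: nondegenerate_def)
    then have "jet1 \<sigma> x \<subseteq> central (\<psi> x)"
      unfolding section_change_surface(1)[OF c \<sigma> x] jet1_def using \<sigma>_VS[OF x] d\<sigma>_VS[OF x]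
      by (intro span_minimal) auto
    then show "z \<in> jet1 \<sigma> x \<Longrightarrow> z \<in> central (\<psi> x)" by blast
    show "metric_trace (induced_metric \<sigma> x) (II (central \<circ> \<psi>) \<sigma> x) = 0"
      unfolding II_central[OF c \<sigma> x] by (rule tr_II_VS[OF x])
  qed
  ultimately show ?thesis unfolding central_congruence_def enveloped_congruence_def by auto
qed

lemma smooth_potential: "smooth_tensor2 A potential"
  unfolding smooth_tensor2_def Let_def
proof (clarify, intro conjI ballI allI, goal_cases)
  case (1 U \<psi> x)
  interpret channel_surface U "proj \<psi>" "V \<circ> \<psi>" "sec \<psi>" by (rule surface_chart[OF 1(1) sec[OF 1(1)]])
  show ?case using bilinear_q[OF 1(2)] by (simp add: potential_def)
next
  case (2 U \<psi> X Y)
  interpret channel_surface U "proj \<psi>" "V \<circ> \<psi>" "sec \<psi>" by (rule surface_chart[OF 2 sec[OF 2]])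
  show ?case using smooth_q by (simp add: potential_def)
next
  case (3 U \<psi> chart')
  obtain U' \<psi>' where c'_eq: "chart' = (U', \<psi>')" by (cases chart')
  have c: "(U, \<psi>) \<in> A" and c': "(U', \<psi>') \<in> A" using 3 c'_eq by simp_all
  show ?case
    unfolding c'_eq prod.case
  proof (intro ballI impI allI)
    fix x X Y assume x: "x \<in> U" and x': "\<psi> x \<in> \<psi>' ` U'"
    note cc = chart_change[OF c c' x x']
    show "potential (U, \<psi>) x X Y = potential (U', \<psi>') (transition (U, \<psi>) (U', \<psi>') x)
        (dir_deriv X (transition (U, \<psi>) (U', \<psi>')) x) (dir_deriv Y (transition (U, \<psi>) (U', \<psi>')) x)"
      unfolding potential_def snd_conv
      by (rule potential_transform(2)[OF surface_chart[OF c sec[OF c]] surface_chart[OF c' sec[OF c']] x cc(1),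
            where \<rho> = 1 and T = "\<lambda>X. dir_deriv X (transition (U, \<psi>) (U', \<psi>')) x"]) (simp_all only: cc power_one mult_1_left scaleR_one zero_less_one)
  qed
qed

lemma commuting_potential: "commuting_cotton_york_potential A L central potential"
proof -
  have "(\<forall>X Y. potential (U, \<psi>) x X Y = potential (U, \<psi>) x Y X) \<and>
      metric_trace (induced_metric \<sigma> x) (potential (U, \<psi>) x) = 0 \<and>
      (\<forall>X Y Z. ext_cov_deriv (induced_metric \<sigma>) (potential (U, \<psi>)) x X Y Z = cotton_york (central \<circ> \<psi>) \<sigma> x X Y Z) \<and>
      (\<forall>X Y. \<forall>u\<in>perp ((central \<circ> \<psi>) x). potential (U, \<psi>) x X (shape_op (central \<circ> \<psi>) \<sigma> x Y u)
         = potential (U, \<psi>) x Y (shape_op (central \<circ> \<psi>) \<sigma> x X u))"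
    if c: "(U, \<psi>) \<in> A" and \<sigma>: "pos_section U (L \<circ> \<psi>) \<sigma>" and x: "x \<in> U" for U \<psi> \<sigma> x
  proof -
    interpret channel_surface U "proj \<psi>" "V \<circ> \<psi>" \<sigma> by (rule surface_chart[OF c \<sigma>])
    have V: "(central \<circ> \<psi>) y = VS y" if "y \<in> U" for y using section_change_surface(1)[OF c \<sigma> that] by simp
    have Q: "potential (U, \<psi>) y X Y = q y X Y" if "y \<in> U" for y X Y by (rule section_change_surface(2)[OF c \<sigma> that])
    have Qx: "potential (U, \<psi>) x = q x" by (intro ext Q[OF x])
    have S: "schouten (central \<circ> \<psi>) \<sigma> y X Y = schouten VS \<sigma> y X Y" if "y \<in> U" for y X Y
      unfolding schouten_def r0_def V[OF that] ..
    have sh: "shape_op (central \<circ> \<psi>) \<sigma> x Y u = shape_op VS \<sigma> x Y u" for Y u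
      unfolding shape_op_def II_central[OF c \<sigma> x] ..
    have "ext_cov_deriv g (potential (U, \<psi>)) x X Y Z = cotton_york (central \<circ> \<psi>) \<sigma> x X Y Z" for X Y Z
    proof -
      have "ext_cov_deriv g (potential (U, \<psi>)) x X Y Z = ext_cov_deriv g q x X Y Z"
        by (rule ext_cov_deriv_cong[OF open_U x Q])
      also have "\<dots> = cotton_york VS \<sigma> x X Y Z" by (rule cotton_york_eq[OF x])
      also have "\<dots> = cotton_york (central \<circ> \<psi>) \<sigma> x X Y Z"
        unfolding cotton_york_def by (rule ext_cov_deriv_cong[OF open_U x S[symmetric]])
      finally show ?thesis .
    qed
    then show ?thesis
      unfolding sh V[OF x] Qx using q_sym[OF x] tr_q[OF x] potential_commutes[OF x] by blast
  qed
  then show ?thesis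
    unfolding commuting_cotton_york_potential_def Let_def using smooth_potential by auto
qed

end

theorem corollary16p5:
  fixes n :: nat
    and M :: "'a topology"
    and A :: "('a, 'm::finite) chart set"
    and L :: "'a \<Rightarrow> 'k::finite mink set"
  assumes "CARD('k) = n + 1"
    and "2 \<le> CARD('m)" and "CARD('m) < n"
    and "smooth_manifold M A"
    and "immersed_submanifold A L"
    and "channel_submanifold A L"
  shows "moebius_flat A L"
proof -
  obtain V where V: "enveloped_congruence A L V" "\<forall>(U, \<psi>)\<in>A. \<forall>x\<in>U. N_rank (V \<circ> \<psi>) x = 1"
    and flat: "normal_bundle_flat A L"
    using assms(6) unfolding channel_submanifold_def by blast
  interpret channel_atlas M A L V by standard (fact assms(4,5) V)+
  show ?thesis
  proof (cases "CARD('m) = 2")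
    case True
    interpret channel_surface_atlas M A L V by standard (fact True)
    show ?thesis
      unfolding moebius_flat_def using True flat central_congruence commuting_potential by auto
  next
    case False
    then show ?thesis unfolding moebius_flat_def using assms(2) flat conformally_flat by auto
  qed
qed

end
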